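(* Let $p\ge5$ be a prime number and $G$ a subgroup of $\mathrm{GL}_2(\mathbb{F}_p)$ containing $-I$ and such that $|G|$ is not divisible by $p$. Let $H$ be a subgroup of $\det G$ and let $\mathcal{O}\subset M_p$ be a $G_H$-invariant subset of $M_p=\mathbb{F}_p^2\smallsetminus\{(0,0)\}$ satisfying $$\sum_{\mathbf{a}\in\mathcal{O}}a_1^2=\sum_{\mathbf{a}\in\mathcal{O}}a_1a_2=\sum_{\mathbf{a}\in\mathcal{O}}a_2^2=0\quad\text{in }\mathbb{F}_p,$$ where $\mathbf{a}=(a_1,a_2)$. Let $m$ be an integer such that $2\mid m$ and $12\mid m|\mathcal{O}|$. Fix a lifting $\mathbf{a}\mapsto\tilde{\mathbf{a}}$ of the set $\mathcal{O}$ and define $$u=\prod_{\mathbf{a}\in\mathcal{O}}g_{\tilde{\mathbf{a}}}^m.$$ Then $u$ defines a function in $\mathbb{Q}(\zeta_p)(X_G)$. Further, there exists $k\in\mathbb{Z}$ (which is unique modulo $p$ when $H\ne1$) such that $\zeta_p^ku\in K(X_G)$, where $K=\mathbb{Q}(\zeta_p)^H$.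
   Context: Modular curves. $\zeta_p$ is a primitive $p$-th root of unity, and $(\mathbb{Z}/p\mathbb{Z})^\times=\mathbb{F}_p^\times$ is identified with $\mathrm{Gal}(\mathbb{Q}(\zeta_p)/\mathbb{Q})$ via $\zeta_p\mapsto\zeta_p^d$. The field $\mathbb{Q}(\zeta_p)(X(p))$ consists of the $\Gamma(p)$-automorphic functions of weight $0$ on the Poincaré upper half-plane $\mathcal{H}$ (meromorphic, also at the cusps) whose $q$-expansion in powers of $q^{1/p}$ ($q=e^{2\pi i\tau}$) has coefficients in $\mathbb{Q}(\zeta_p)$. The group $\mathrm{GL}_2(\mathbb{F}_p)$ acts on it on the right (action written $u\mapsto u^\sigma$) so that: for $\sigma\in\mathrm{SL}_2(\mathbb{F}_p)$, $u^\sigma=u\circ\tilde\sigma$ with $\tilde\sigma\in\mathrm{SL}_2(\mathbb{Z})$ any lifting of $\sigma$; for $\sigma=\begin{pmatrix}1&0\\0&d\end{pmatrix}$, $u^\sigma$ is obtained by applying $\zeta_p\mapsto\zeta_p^d$ to the coefficients of the $q$-expansion. This identifies $\mathrm{GL}_2(\mathbb{F}_p)/\{\pm1\}$ with the Galois group over $\mathbb{Q}(j)$. For a subgroup $G\ni -I$ of $\mathrm{GL}_2(\mathbb{F}_p)$, $X_G$ is the modular curve whose function field is the $G$-invariant subfield of $\mathbb{Q}(\zeta_p)(X(p))$. For a subgroup $H$ of $\det G\subset\mathbb{F}_p^\times$ put $G_H=\{g\in G:\det g\in H\}$; with $K=\mathbb{Q}(\zeta_p)^H$, the field $K(X_G)$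 is the $G_H$-invariant subfield of $\mathbb{Q}(\zeta_p)(X(p))$. In particular ($H=1$) $\mathbb{Q}(\zeta_p)(X_G)$ is the subfield invariant under $G\cap\mathrm{SL}_2(\mathbb{F}_p)$. The group $G_H$ acts on $M_p$ (row vectors) from the right by matrix multiplication. Liftings. We identify $(p^{-1}\mathbb{Z}/\mathbb{Z})^2$ with $\mathbb{F}_p^2$ (via multiplication by $p$). A lifting of a subset $A\subset\mathbb{F}_p^2$ is a map $A\to p^{-1}\mathbb{Z}^2$, $\mathbf{a}\mapsto\tilde{\mathbf{a}}$, such that the class of $\tilde{\mathbf{a}}$ modulo $\mathbb{Z}^2$ corresponds to $\mathbf{a}$. Siegel functions. For $\tilde{\mathbf{a}}=(\tilde a_1,\tilde a_2)\in\mathbb{Q}^2\smallsetminus\mathbb{Z}^2$ the Siegel function on $\mathcal{H}$ is $$g_{\tilde{\mathbf{a}}}(\tau)=-q^{B_2(\tilde a_1)/2}e^{\pi i\tilde a_2(\tilde a_1-1)}\prod_{n=0}^\infty\bigl(1-q^{n+\tilde a_1}e^{2\pi i\tilde a_2}\bigr)\bigl(1-q^{n+1-\tilde a_1}e^{-2\pi i\tilde a_2}\bigr),$$ where $q^a=e^{2\pi ia\tau}$ for $a\in\mathbb{Q}$ and $B_2(T)=T^2-T+1/6$. *)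

theory Defs
  imports
    "HOL-Complex_Analysis.Complex_Analysis"
    "HOL-Algebra.Algebraic_Closure_Type"
    "HOL-Algebra.Generated_Fields"
    "Berlekamp_Zassenhaus.Finite_Field"
begin

unbundle no fps_syntax

text \<open>
  The prime \<open>p\<close> is \<open>CARD('p)\<close> for a type \<open>'p :: prime_card\<close>, so that the field with \<open>p\<close> elements
  is the type \<open>'p mod_ring\<close>.  Elements of the plane over it are row vectors, and \<open>a v* g\<close> is the
  product of the row vector \<open>a\<close> with the matrix \<open>g\<close>.
\<close>

section \<open>Groups of matrices\<close>

abbreviation Fp_units :: "'p::prime_card mod_ring monoid" where
  "Fp_units \<equiv> units_of (ring_of_type_algebra :: 'p mod_ring ring)"

definition GL2 :: "('p::prime_card mod_ring ^ 2 ^ 2) monoid" where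
  "GL2 = units_of \<lparr>carrier = UNIV, mult = (**), one = mat 1\<rparr>"

definition SL2Z :: "(int ^ 2 ^ 2) set" where
  "SL2Z = {A. det A = 1}"

definition Gamma :: "nat \<Rightarrow> (int ^ 2 ^ 2) set" where
  "Gamma n = {A \<in> SL2Z. \<forall>i j. [A $ i $ j = mat 1 $ i $ j] (mod int n)}"

definition diag_matrix :: "'a \<Rightarrow> 'a \<Rightarrow> 'a::zero ^ 2 ^ 2" where
  "diag_matrix x y = vector [vector [x, 0], vector [0, y]]"

definition SL2_lift :: "'p::prime_card mod_ring ^ 2 ^ 2 \<Rightarrow> int ^ 2 ^ 2" where
  "SL2_lift \<sigma> = (SOME A. A \<in> SL2Z \<and> map_matrix of_int A = \<sigma>)"

definition det_part :: "('p::prime_card mod_ring ^ 2 ^ 2) set \<Rightarrow> 'p mod_ring set \<Rightarrow>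
    ('p mod_ring ^ 2 ^ 2) set" where
  "det_part G H = {g \<in> G. det g \<in> H}"


section \<open>Cyclotomic fields\<close>

definition primitive_root_of_unity :: "nat \<Rightarrow> complex \<Rightarrow> bool" where
  "primitive_root_of_unity n \<zeta> \<longleftrightarrow> \<zeta> ^ n = 1 \<and> (\<forall>k\<in>{0<..<n}. \<zeta> ^ k \<noteq> 1)"

text \<open>The subfield \<open>\<rat>(\<zeta>)\<close> of the complex numbers, as a set.\<close>
definition Q_adjoin :: "complex \<Rightarrow> complex set" where
  "Q_adjoin \<zeta> = generate_field (ring_of_type_algebra :: complex ring) {\<zeta>}"

text \<open>
  The automorphism of \<open>\<rat>(\<zeta>)\<close> with \<open>\<zeta> \<mapsto> \<zeta>\<^sup>d\<close>.  Its values outside \<open>\<rat>(\<zeta>)\<close> are arbitrary;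
  on \<open>\<rat>(\<zeta>)\<close> it is uniquely determined.
\<close>
definition cyclotomic_aut :: "complex \<Rightarrow> 'p::prime_card mod_ring \<Rightarrow> complex \<Rightarrow> complex" where
  "cyclotomic_aut \<zeta> d =
     (let F = (ring_of_type_algebra :: complex ring)\<lparr>carrier := Q_adjoin \<zeta>\<rparr>
      in SOME s. s \<in> ring_iso F F \<and> s \<zeta> = \<zeta> ^ nat (to_int_mod_ring d))"


section \<open>Automorphic functions of weight 0\<close>

definition upper_half_plane :: "complex set"  (\<open>\<H>\<close>) where
  "\<H> = {\<tau>. Im \<tau> > 0}"

text \<open>
  Meromorphic functions on \<open>\<H>\<close> are represented by elements of \<open>extensional \<H>\<close> that are nicely
  meromorphic (removable singularities are removed, and the value at a pole is 0), so that equality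
  of meromorphic functions on \<open>\<H>\<close> is equality in HOL.
\<close>
definition act_SL2Z :: "(complex \<Rightarrow> complex) \<Rightarrow> int ^ 2 ^ 2 \<Rightarrow> complex \<Rightarrow> complex" where
  "act_SL2Z f A =
     (\<lambda>\<tau>\<in>\<H>. f (moebius (of_int (A $ 1 $ 1)) (of_int (A $ 1 $ 2))
                         (of_int (A $ 2 $ 1)) (of_int (A $ 2 $ 2)) \<tau>))"

text \<open>
  \<open>has_q_expansion n f F\<close>: for \<open>Im \<tau>\<close> large, \<open>f \<tau>\<close> is the sum of the Laurent series \<open>F\<close> in
  \<open>q\<^bsup>1/n\<^esup> = exp (2 \<pi> \<i> \<tau> / n)\<close>.  As \<open>F\<close> has finite principal part, this expresses that \<open>f\<close> is
  meromorphic at the cusp at infinity.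
\<close>
definition has_q_expansion :: "nat \<Rightarrow> (complex \<Rightarrow> complex) \<Rightarrow> complex fls \<Rightarrow> bool" where
  "has_q_expansion n f F \<longleftrightarrow>
     fls_conv_radius F > 0 \<and>
     (\<exists>B. \<forall>\<tau>\<in>\<H>. Im \<tau> > B \<longrightarrow> f \<tau> = eval_fls F (exp (2 * of_real pi * \<i> * \<tau> / of_nat n)))"

definition automorphic_functions :: "nat \<Rightarrow> (complex \<Rightarrow> complex) set" where
  "automorphic_functions n =
     {f \<in> extensional \<H>.
        f nicely_meromorphic_on \<H> \<and>
        (\<forall>A\<in>Gamma n. act_SL2Z f A = f) \<and>
        (\<forall>A\<in>SL2Z. \<exists>F. has_q_expansion n (act_SL2Z f A) F)}"

text \<open>For \<open>\<zeta>\<close> a primitive \<open>p\<close>-th root of unity, this is the field \<open>\<rat>(\<zeta>)(X(p))\<close>.\<close>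
definition function_field_X :: "nat \<Rightarrow> complex \<Rightarrow> (complex \<Rightarrow> complex) set" where
  "function_field_X p \<zeta> =
     {f \<in> automorphic_functions p.
        \<exists>F. has_q_expansion p f F \<and> (\<forall>n. fls_nth F n \<in> Q_adjoin \<zeta>)}"


section \<open>The Galois action and the function fields of modular curves\<close>

text \<open>The action of the matrix with diagonal entries \<open>1, d\<close>.\<close>
definition act_diag :: "complex \<Rightarrow> (complex \<Rightarrow> complex) \<Rightarrow> 'p::prime_card mod_ring \<Rightarrow>
    complex \<Rightarrow> complex" where
  "act_diag \<zeta> u d =
     (THE v. v \<in> function_field_X CARD('p) \<zeta> \<and>
        (\<exists>F F'. has_q_expansion CARD('p) u F \<and> has_q_expansion CARD('p) v F' \<and>
                (\<forall>n. fls_nth F' n = cyclotomic_aut \<zeta> d (fls_nth F n))))"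

text \<open>
  The right action \<open>u \<mapsto> u\<^sup>\<sigma>\<close>.  With \<open>d = det \<sigma>\<close>, one has
  \<open>\<sigma> = \<sigma>\<^sub>1 ** diag_matrix 1 d\<close> where \<open>det \<sigma>\<^sub>1 = 1\<close>; as the action is a right action, \<open>\<sigma>\<^sub>1\<close> acts first.
\<close>
definition act_GL2 :: "complex \<Rightarrow> (complex \<Rightarrow> complex) \<Rightarrow> 'p::prime_card mod_ring ^ 2 ^ 2 \<Rightarrow>
    complex \<Rightarrow> complex" where
  "act_GL2 \<zeta> u \<sigma> =
     act_diag \<zeta> (act_SL2Z u (SL2_lift (\<sigma> ** diag_matrix 1 (inverse (det \<sigma>))))) (det \<sigma>)"

text \<open>
  The field \<open>K(X\<^sub>G)\<close> for \<open>K = \<rat>(\<zeta>)\<^sup>H\<close>, where \<open>H\<close> is a subgroup of \<open>det G\<close>: the subfield of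
  \<open>\<rat>(\<zeta>)(X(p))\<close> that is invariant under \<open>{g \<in> G. det g \<in> H}\<close>.  For \<open>H = {1}\<close>, one has \<open>K = \<rat>(\<zeta>)\<close>.
\<close>
definition function_field_XG :: "complex \<Rightarrow> ('p::prime_card mod_ring ^ 2 ^ 2) set \<Rightarrow>
    'p mod_ring set \<Rightarrow> (complex \<Rightarrow> complex) set" where
  "function_field_XG \<zeta> G H =
     {u \<in> function_field_X CARD('p) \<zeta>. \<forall>g\<in>det_part G H. act_GL2 \<zeta> u g = u}"


section \<open>Liftings and Siegel functions\<close>

definition is_lifting :: "('p::prime_card mod_ring ^ 2) set \<Rightarrow>
    ('p mod_ring ^ 2 \<Rightarrow> rat ^ 2) \<Rightarrow> bool" where
  "is_lifting A l \<longleftrightarrow>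
     (\<forall>a\<in>A. \<forall>i. \<exists>n::int. l a $ i = of_int n / of_nat CARD('p) \<and> of_int n = a $ i)"

definition q_pow :: "rat \<Rightarrow> complex \<Rightarrow> complex" where
  "q_pow a \<tau> = exp (2 * of_real pi * \<i> * of_rat a * \<tau>)"

definition B2 :: "rat \<Rightarrow> rat" where
  "B2 t = t ^ 2 - t + 1 / 6"

definition siegel :: "rat ^ 2 \<Rightarrow> complex \<Rightarrow> complex" where
  "siegel a \<tau> =
     - q_pow (B2 (a $ 1) / 2) \<tau> * exp (of_real pi * \<i> * of_rat (a $ 2 * (a $ 1 - 1))) *
     (\<Prod>n. (1 - q_pow (of_nat n + a $ 1) \<tau> * exp (2 * of_real pi * \<i> * of_rat (a $ 2))) *
           (1 - q_pow (of_nat n + 1 - a $ 1) \<tau> * exp (- 2 * of_real pi * \<i> * of_rat (a $ 2))))"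

end

theory Submission
  imports Defs
begin

text \<open>
  Write \<open>e(x) = exp(2\<pi>\<i>x)\<close>.  Up to an elementary exponential factor, the Siegel function at
  \<open>a = (a\<^sub>1, a\<^sub>2)\<close> is the value of a theta product at the point \<open>z = a\<^sub>1\<tau> + a\<^sub>2\<close>.  Three of its properties
  carry the proof.

    \<^item> Shifting \<open>a\<close> by an integral vector \<open>b\<close> multiplies the square of the Siegel function by the root
      of unity \<open>e(a\<^sub>1b\<^sub>2 - a\<^sub>2b\<^sub>1)\<close> (\<open>siegel_square_shift\<close>).
    \<^item> For a matrix \<open>A\<close> in the modular group, the function at \<open>a\<close> evaluated in \<open>A\<tau>\<close> is the function
      at the row vector \<open>aA\<close> evaluated in \<open>\<tau>\<close>, up to a 12th root of unity that depends on \<open>A\<close> and \<open>\<tau>\<close>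
      but not on \<open>a\<close> (\<open>siegel_equivariant_SL2Z\<close>).
    \<^item> The expansion of a suitable product in \<open>q\<^bsup>1/p\<^esup>\<close> has coefficients in \<open>\<rat>(\<zeta>)\<close>, and applying
      \<open>\<zeta> \<mapsto> \<zeta>\<^sup>d\<close> to them replaces every \<open>a\<^sub>2\<close> by \<open>d a\<^sub>2\<close> (\<open>admissible_q_expansion\<close>, \<open>conj_qlaurent\<close>).

  In the product over \<open>Orb\<close> of \<open>m\<close>-th powers, the 12th roots of unity cancel because 12 divides
  \<open>m |Orb|\<close>.  The quadratic relations make the exponents of \<open>q\<close> and the constants have denominator
  \<open>p\<close> instead of \<open>p\<^sup>2\<close>, and they make the product invariant under \<open>\<Gamma>(p)\<close>.  So the product \<open>u\<close> lies in
  the field of level \<open>p\<close>.  If \<open>\<sigma>\<close> is in \<open>G\<^sub>H\<close>, then the second and the third property show that \<open>u\<^sup>\<sigma>\<close> is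
  the product attached to another lifting of the same set \<open>Orb\<close>; by the first property it
  equals \<open>e(c(\<sigma>)/p) u\<close> with an integer \<open>c(\<sigma>)\<close>, and \<open>c\<close> satisfies the cocycle relation
  \<open>c(\<sigma>\<sigma>') = det \<sigma>' c(\<sigma>) + c(\<sigma>')\<close> modulo \<open>p\<close>.

  As \<open>p\<close> does not divide the order of \<open>G\<^sub>H\<close>, averaging over \<open>G\<^sub>H\<close> gives \<open>c(\<sigma>) = k\<^sub>0 (1 - det \<sigma>)\<close>
  for one integer \<open>k\<^sub>0\<close> (\<open>cocycle_is_coboundary\<close>).  Hence
  \<open>e(k/p) u\<close> is fixed by \<open>\<sigma>\<close> if and only if \<open>p\<close> divides \<open>(1 - det \<sigma>) (k\<^sub>0 - k)\<close>.  This holds for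
  every \<open>k\<close> if \<open>det \<sigma> = 1\<close>, which gives the invariance of \<open>u\<close>; it holds for \<open>k = k\<^sub>0\<close> and all \<open>\<sigma>\<close>;
  and if some \<open>\<sigma>\<close> has \<open>det \<sigma> \<noteq> 1\<close>, then it forces \<open>k\<close> to be \<open>k\<^sub>0\<close> modulo \<open>p\<close>.

  The choice operators in the definition of the action also have to be resolved.  The automorphism
  \<open>\<zeta> \<mapsto> \<zeta>\<^sup>d\<close> exists because the cyclotomic polynomial is irreducible (\<open>cyclotomic_aut_exists\<close>), a
  lifting to the modular group exists because reduction modulo \<open>p\<close> is surjective
  (\<open>SL2_reduction_surj\<close>), and a meromorphic function is determined by its \<open>q\<close>-expansion
  (\<open>nicely_meromorphic_eq_holomorphic\<close>).
\<close>

unbundle no Formal_Power_Series.fps_syntax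
hide_const (open) up_ring.monom up_ring.coeff Polynomials.degree Polynomials.lead_coeff
  module.smult Divisibility.prime Divisibility.irreducible

section \<open>The theta product and the Siegel functions\<close>

definition e2pi :: "complex \<Rightarrow> complex" where
  "e2pi z = exp (2 * of_real pi * \<i> * z)"

lemma e2pi_0 [simp]: "e2pi 0 = 1" by (simp add: e2pi_def)
lemma e2pi_nonzero [simp]: "e2pi z \<noteq> 0" by (simp add: e2pi_def)
lemma e2pi_add: "e2pi (x + y) = e2pi x * e2pi y" by (simp add: e2pi_def exp_add ring_distribs)
lemma e2pi_minus: "e2pi (- x) = inverse (e2pi x)" by (simp add: e2pi_def exp_minus)
lemma e2pi_diff: "e2pi (x - y) = e2pi x / e2pi y" by (simp add: e2pi_def exp_diff ring_distribs)
lemma e2pi_of_int [simp]: "e2pi (of_int n) = 1"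
  by (simp add: e2pi_def exp_eq_1)
lemma e2pi_1 [simp]: "e2pi 1 = 1" using e2pi_of_int[of 1] by simp
lemma e2pi_of_nat_mult: "e2pi (of_nat n * z) = e2pi z ^ n"
  unfolding e2pi_def exp_of_nat_mult[symmetric] by (simp add: mult_ac)
lemma e2pi_of_int_mult: "e2pi (of_int n * z) = e2pi z powi n"
proof -
  have "e2pi (of_int n * z) = exp (of_int n * (2 * of_real pi * \<i> * z))"
    by (simp add: e2pi_def mult_ac)
  also have "\<dots> = e2pi z powi n" by (simp add: exp_power_int e2pi_def mult_ac)
  finally show ?thesis .
qed
lemma e2pi_sum: "e2pi (\<Sum>i\<in>I. f i) = (\<Prod>i\<in>I. e2pi (f i))"
  by (induction I rule: infinite_finite_induct) (simp_all add: e2pi_add)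
lemma norm_e2pi: "norm (e2pi z) = exp (- 2 * pi * Im z)"
  by (simp add: e2pi_def norm_exp_eq_Re)
lemma e2pi_eq_iff: "e2pi x = e2pi y \<longleftrightarrow> (\<exists>n::int. x = y + of_int n)"
proof
  assume "e2pi x = e2pi y"
  then obtain n :: int where n: "2 * of_real pi * \<i> * x = 2 * of_real pi * \<i> * y + of_real (of_int (2 * n) * pi) * \<i>"
    unfolding e2pi_def exp_eq by blast
  hence "(2 * of_real pi * \<i>) * x = (2 * of_real pi * \<i>) * (y + of_int n)"
    by (simp add: algebra_simps)
  thus "\<exists>n::int. x = y + of_int n" by (subst (asm) mult_left_cancel) auto
qed (auto simp: e2pi_add)
lemma e2pi_holomorphic [holomorphic_intros]: "f holomorphic_on A \<Longrightarrow> (\<lambda>z. e2pi (f z)) holomorphic_on A"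
  unfolding e2pi_def by (intro holomorphic_intros)
abbreviation unity_root :: "nat \<Rightarrow> int \<Rightarrow> complex" where
  "unity_root p k \<equiv> e2pi (of_int k / of_nat p)"

text \<open>
  The infinite q-Pochhammer symbol \<open>(w; q)\<^sub>\<infinity>\<close>.
\<close>
definition qpoch :: "complex \<Rightarrow> complex \<Rightarrow> complex" where
  "qpoch q w = (\<Prod>n. 1 - w * q ^ n)"

lemma qpoch_convergent:
  fixes q w :: complex
  assumes "norm q < 1"
  shows "convergent_prod (\<lambda>n. 1 - w * q ^ n)"
proof -
  have "summable (\<lambda>n. norm w * norm q ^ n)"
    using assms by (intro summable_mult summable_geometric) auto
  hence "abs_convergent_prod (\<lambda>n. 1 - w * q ^ n)"
    by (simp add: abs_convergent_prod_conv_summable norm_mult norm_power)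
  thus ?thesis by (rule abs_convergent_prod_imp_convergent_prod)
qed

lemma qpoch_eq_0_iff:
  assumes "norm q < 1"
  shows "qpoch q w = 0 \<longleftrightarrow> (\<exists>n. w * q ^ n = 1)"
proof -
  have "(\<lambda>n. 1 - w * q ^ n) has_prod qpoch q w"
    unfolding qpoch_def using qpoch_convergent[OF assms] by (rule convergent_prod_has_prod)
  from has_prod_eq_0_iff[OF this] show ?thesis by auto
qed

lemma qpoch_LIMSEQ:
  fixes q w :: complex
  assumes "norm q < 1"
  shows "(\<lambda>N. \<Prod>n<N. 1 - w * q ^ n) \<longlonglongrightarrow> qpoch q w"
proof -
  have "(\<lambda>N. \<Prod>n\<le>N. 1 - w * q ^ n) \<longlonglongrightarrow> qpoch q w"
    unfolding qpoch_def by (rule convergent_prod_LIMSEQ[OF qpoch_convergent[OF assms]])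
  hence "(\<lambda>N. \<Prod>n<Suc N. 1 - w * q ^ n) \<longlonglongrightarrow> qpoch q w"
    by (simp only: lessThan_Suc_atMost)
  thus ?thesis by (rule LIMSEQ_imp_Suc)
qed

lemma qpoch_step:
  assumes "norm q < 1"
  shows "qpoch q w = (1 - w) * qpoch q (w * q)"
proof -
  have "(\<lambda>N. \<Prod>n<Suc N. 1 - w * q ^ n) \<longlonglongrightarrow> qpoch q w"
    using qpoch_LIMSEQ[OF assms] by (rule LIMSEQ_Suc)
  moreover have "(\<Prod>n<Suc N. 1 - w * q ^ n) = (1 - w) * (\<Prod>n<N. 1 - w * q * q ^ n)" for N
    by (subst prod.lessThan_Suc_shift) (simp add: mult_ac)
  moreover have "(\<lambda>N. (1 - w) * (\<Prod>n<N. 1 - w * q * q ^ n)) \<longlonglongrightarrow> (1 - w) * qpoch q (w * q)"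
    by (intro tendsto_intros qpoch_LIMSEQ assms)
  ultimately show ?thesis using LIMSEQ_unique by auto
qed

text \<open>
  The base and the argument are functions of the same variable because the product is needed in
  three roles: as a function of \<open>z\<close> for fixed \<open>\<tau>\<close>, as a function of \<open>\<tau>\<close>, and as a function of
  \<open>q\<^bsup>1/p\<^esup>\<close>.
\<close>
lemma qpoch_uniform_limit:
  fixes q w :: "complex \<Rightarrow> complex"
  assumes K: "compact K" and q: "continuous_on K q" "\<And>x. x \<in> K \<Longrightarrow> norm (q x) < 1"
    and w: "continuous_on K w"
  shows "uniform_limit K (\<lambda>N x. \<Prod>n<N. 1 - w x * q x ^ n) (\<lambda>x. qpoch (q x) (w x)) sequentially"
proof (cases "K = {}")
  case False
  have "continuous_on K (\<lambda>x. norm (q x))" by (intro continuous_intros q)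
  from continuous_attains_sup[OF K False this] obtain x0 where
    x0: "x0 \<in> K" "\<And>x. x \<in> K \<Longrightarrow> norm (q x) \<le> norm (q x0)" by blast
  have "bounded (w ` K)" using K w compact_continuous_image compact_imp_bounded by blast
  then obtain M where M: "\<And>x. x \<in> K \<Longrightarrow> norm (w x) \<le> M"
    unfolding bounded_iff by blast
  have "uniformly_convergent_on K (\<lambda>N x. \<Prod>n<N. 1 - w x * q x ^ n)"
  proof (rule uniformly_convergent_on_prod')
    show "uniformly_convergent_on K (\<lambda>N x. \<Sum>n<N. norm (1 - w x * q x ^ n - 1))"
    proof (rule Weierstrass_m_test')
      show "summable (\<lambda>n. M * norm (q x0) ^ n)"
        using q(2)[OF x0(1)] by (intro summable_mult summable_geometric) auto
      show "norm (norm (1 - w x * q x ^ n - 1)) \<le> M * norm (q x0) ^ n" if "x \<in> K" for n x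
      proof -
        have "M \<ge> 0" using M[OF that] norm_ge_zero order_trans by blast
        thus ?thesis using M[OF that] x0(2)[OF that]
          by (auto simp: norm_mult norm_power intro!: mult_mono power_mono)
      qed
    qed
  qed (intro continuous_intros q w K)+
  then obtain g where g: "uniform_limit K (\<lambda>N x. \<Prod>n<N. 1 - w x * q x ^ n) g sequentially"
    unfolding uniformly_convergent_on_def by blast
  have "g x = qpoch (q x) (w x)" if "x \<in> K" for x
    using tendsto_uniform_limitI[OF g that] qpoch_LIMSEQ[OF q(2)[OF that]] LIMSEQ_unique by blast
  with g show ?thesis by (simp cong: uniform_limit_cong')
qed (simp add: uniform_limit_iff)

lemma qpoch_holomorphic:
  fixes q w :: "complex \<Rightarrow> complex"
  assumes S: "open S" and q: "q holomorphic_on S" "\<And>x. x \<in> S \<Longrightarrow> norm (q x) < 1"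
    and w: "w holomorphic_on S"
  shows "(\<lambda>x. qpoch (q x) (w x)) holomorphic_on S"
proof (rule holomorphic_uniform_sequence[OF S])
  show "(\<lambda>x. \<Prod>n<N. 1 - w x * q x ^ n) holomorphic_on S" for N
    by (intro holomorphic_intros q w)
  fix x assume "x \<in> S"
  then obtain d where d: "d > 0" "cball x d \<subseteq> S" using S open_contains_cball by blast
  have "uniform_limit (cball x d) (\<lambda>N x. \<Prod>n<N. 1 - w x * q x ^ n) (\<lambda>x. qpoch (q x) (w x)) sequentially"
    using d q(2) holomorphic_on_imp_continuous_on[OF q(1)] holomorphic_on_imp_continuous_on[OF w]
    by (intro qpoch_uniform_limit) (auto intro: continuous_on_subset)
  with d show "\<exists>d>0. cball x d \<subseteq> S \<and> uniform_limit (cball x d)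
       (\<lambda>N x. \<Prod>n<N. 1 - w x * q x ^ n) (\<lambda>x. qpoch (q x) (w x)) sequentially" by blast
qed

text \<open>
  By the triple product identity, this is the Jacobi theta function in multiplicative form, up to
  the factor \<open>(q; q)\<^sub>\<infinity>\<close> and elementary factors.
\<close>
definition theta :: "complex \<Rightarrow> complex \<Rightarrow> complex" where
  "theta q w = qpoch q w * qpoch q (q / w)"

text \<open>
  Replacing \<open>w\<close> by \<open>q w\<close> moves the factor \<open>1 - w\<close> of the first product to the factor \<open>1 - 1/w\<close> of the
  second one, and \<open>(1 - 1/w) / (1 - w) = -1/w\<close>.
\<close>
lemma theta_shift:
  assumes q: "norm q < 1" "q \<noteq> 0" and w: "w \<noteq> 0"
  shows "theta q (q * w) = - theta q w / w"
proof -
  have 1: "qpoch q w = (1 - w) * qpoch q (q * w)" using qpoch_step[OF q(1), of w] by (simp add: mult.commute)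
  have 2: "qpoch q (1 / w) = (1 - 1 / w) * qpoch q (q / w)" using qpoch_step[OF q(1), of "1 / w"] by simp
  have "theta q (q * w) = qpoch q (q * w) * qpoch q (1 / w)" using q(2) w by (simp add: theta_def)
  also have "\<dots> = - theta q w / w" unfolding theta_def 1 2 using w by (simp add: field_simps)
  finally show ?thesis .
qed

lemma theta_eq_0D:
  assumes q: "norm q < 1" "q \<noteq> 0" and "w \<noteq> 0" "theta q w = 0"
  shows "\<exists>k::int. w = q powi k"
proof -
  from assms consider n where "w * q ^ n = 1" | n where "q / w * q ^ n = 1"
    unfolding theta_def using qpoch_eq_0_iff[OF q(1)] by auto
  thus ?thesis
  proof cases
    case 1
    hence "w = q powi (- int n)" using q by (simp add: power_int_minus field_simps)
    thus ?thesis by blast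
  next
    case 2
    hence "w = q powi (int (Suc n))" using q assms(3) unfolding power_int_of_nat by (simp add: field_simps)
    thus ?thesis by blast
  qed
qed

lemma theta_1: "norm q < 1 \<Longrightarrow> theta q 1 = 0"
  using qpoch_eq_0_iff[of q 1] by (auto simp: theta_def intro: exI[of _ 0])

text \<open>
  The theta product on the additive side: a quasi-periodic entire function of \<open>z\<close> with simple zeros
  exactly at the lattice points \<open>m\<tau> + n\<close>.
\<close>
definition theta_kernel :: "complex \<Rightarrow> complex \<Rightarrow> complex" where
  "theta_kernel \<tau> z = theta (e2pi \<tau>) (e2pi z)"

lemma norm_e2pi_less_1: "\<tau> \<in> \<H> \<Longrightarrow> norm (e2pi \<tau>) < 1"
  by (simp add: norm_e2pi upper_half_plane_def)

lemma open_upper_half_plane: "open \<H>"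
  unfolding upper_half_plane_def by (simp add: open_halfspace_Im_gt)

lemma theta_kernel_add_1: "theta_kernel \<tau> (z + 1) = theta_kernel \<tau> z"
  by (simp add: theta_kernel_def e2pi_add)

lemma theta_kernel_add_tau: "\<tau> \<in> \<H> \<Longrightarrow> theta_kernel \<tau> (z + \<tau>) = - e2pi (- z) * theta_kernel \<tau> z"
  using theta_shift[OF norm_e2pi_less_1, of \<tau> "e2pi z"]
  by (simp add: theta_kernel_def e2pi_add[of z \<tau>] e2pi_minus divide_inverse mult.commute[of "e2pi z"] mult.commute[of "inverse (e2pi z)"])

lemma theta_kernel_0: "\<tau> \<in> \<H> \<Longrightarrow> theta_kernel \<tau> 0 = 0"
  by (simp add: theta_kernel_def theta_1 norm_e2pi_less_1)

lemma theta_kernel_eq_0D: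
  assumes "\<tau> \<in> \<H>" "theta_kernel \<tau> z = 0"
  shows "\<exists>m n::int. z = of_int m * \<tau> + of_int n"
proof -
  obtain k :: int where "e2pi z = e2pi \<tau> powi k"
    using theta_eq_0D[of "e2pi \<tau>" "e2pi z"] assms norm_e2pi_less_1 unfolding theta_kernel_def by auto
  hence "e2pi z = e2pi (of_int k * \<tau>)" by (simp add: e2pi_of_int_mult)
  thus ?thesis unfolding e2pi_eq_iff by blast
qed

lemma theta_kernel_holomorphic:
  assumes "f holomorphic_on S" "g holomorphic_on S" "open S" "f ` S \<subseteq> \<H>"
  shows "(\<lambda>x. theta_kernel (f x) (g x)) holomorphic_on S"
  unfolding theta_kernel_def theta_def using assms norm_e2pi_less_1
  by (intro holomorphic_intros qpoch_holomorphic) auto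

text \<open>
  The zero at the origin comes from the single factor \<open>1 - e(z)\<close>; all other factors are nonzero
  there.
\<close>
lemma deriv_theta_kernel_0_nonzero:
  assumes \<tau>: "\<tau> \<in> \<H>"
  shows "deriv (theta_kernel \<tau>) 0 \<noteq> 0"
proof -
  define q where "q = e2pi \<tau>"
  have q: "norm q < 1" "q \<noteq> 0" using norm_e2pi_less_1[OF \<tau>] by (auto simp: q_def)
  define g where "g z = qpoch q (e2pi z * q) * qpoch q (q / e2pi z)" for z
  have hol: "g holomorphic_on UNIV" unfolding g_def
    using q by (intro holomorphic_intros qpoch_holomorphic) auto
  have eq: "theta_kernel \<tau> z = (1 - e2pi z) * g z" for z
    unfolding theta_kernel_def theta_def g_def q_def[symmetric] using qpoch_step[OF q(1), of "e2pi z"] by simp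
  have 1: "(g has_field_derivative deriv g 0) (at 0)"
    using hol by (intro holomorphic_derivI[of _ UNIV]) auto
  have 2: "((\<lambda>z. 1 - e2pi z) has_field_derivative - (2 * of_real pi * \<i>)) (at 0)"
    unfolding e2pi_def by (auto intro!: derivative_eq_intros)
  have "(theta_kernel \<tau> has_field_derivative (- (2 * of_real pi * \<i>) * g 0)) (at 0)"
    unfolding eq using DERIV_mult[OF 2 1] by simp
  hence "deriv (theta_kernel \<tau>) 0 = - (2 * of_real pi * \<i>) * g 0" by (rule DERIV_imp_deriv)
  moreover have "g 0 \<noteq> 0"
  proof
    assume "g 0 = 0"
    then obtain n where "q * q ^ n = 1" unfolding g_def using qpoch_eq_0_iff[OF q(1)] by auto
    hence "norm q ^ Suc n = 1" by (metis norm_one norm_power power_Suc)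
    moreover have "norm q ^ Suc n < 1" using q by (intro power_Suc_less_one) auto
    ultimately show False by linarith
  qed
  ultimately show ?thesis by simp
qed

text \<open>
  With \<open>z = a\<^sub>1\<tau> + a\<^sub>2\<close>, the two exponents \<open>B\<^sub>2(a\<^sub>1)\<tau>/2\<close> and \<open>a\<^sub>2(a\<^sub>1 - 1)/2\<close> of the definition combine to
  \<open>(a\<^sub>1z - z + \<tau>/6)/2\<close>.
\<close>
lemma siegel_eq_theta_kernel:
  fixes a :: "rat ^ 2"
  assumes \<tau>: "\<tau> \<in> \<H>" and z: "z = of_rat (a $ 1) * \<tau> + of_rat (a $ 2)"
  shows "siegel a \<tau> = - e2pi ((of_rat (a $ 1) * z - z + \<tau> / 6) / 2) * theta_kernel \<tau> z"
proof -
  define q where "q = e2pi \<tau>"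
  have q: "norm q < 1" "q \<noteq> 0" using norm_e2pi_less_1[OF \<tau>] by (auto simp: q_def)
  define \<alpha> \<beta> :: complex where "\<alpha> = of_rat (a $ 1)" and "\<beta> = of_rat (a $ 2)"
  have f1: "q_pow (of_nat n + a $ 1) \<tau> * exp (2 * of_real pi * \<i> * of_rat (a $ 2)) = e2pi z * q ^ n" for n
  proof -
    have "q_pow (of_nat n + a $ 1) \<tau> * exp (2 * of_real pi * \<i> * of_rat (a $ 2)) = e2pi ((of_nat n + \<alpha>) * \<tau> + \<beta>)"
      unfolding q_pow_def e2pi_def \<alpha>_def \<beta>_def exp_add[symmetric]
      by (rule arg_cong[of _ _ exp]) (simp add: of_rat_add of_rat_diff algebra_simps)
    also have "(of_nat n + \<alpha>) * \<tau> + \<beta> = z + of_nat n * \<tau>" by (simp add: z \<alpha>_def \<beta>_def algebra_simps)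
    finally show ?thesis by (simp add: e2pi_add e2pi_of_nat_mult q_def)
  qed
  have f2: "q_pow (of_nat n + 1 - a $ 1) \<tau> * exp (- 2 * of_real pi * \<i> * of_rat (a $ 2)) = q / e2pi z * q ^ n" for n
  proof -
    have "q_pow (of_nat n + 1 - a $ 1) \<tau> * exp (- 2 * of_real pi * \<i> * of_rat (a $ 2)) = e2pi ((of_nat n + 1 - \<alpha>) * \<tau> - \<beta>)"
      unfolding q_pow_def e2pi_def \<alpha>_def \<beta>_def exp_add[symmetric]
      by (rule arg_cong[of _ _ exp]) (simp add: of_rat_add of_rat_diff algebra_simps)
    also have "(of_nat n + 1 - \<alpha>) * \<tau> - \<beta> = \<tau> - z + of_nat n * \<tau>" by (simp add: z \<alpha>_def \<beta>_def algebra_simps)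
    finally show ?thesis by (simp add: e2pi_add e2pi_diff e2pi_of_nat_mult q_def)
  qed
  have "(\<Prod>n. (1 - e2pi z * q ^ n) * (1 - q / e2pi z * q ^ n)) = qpoch q (e2pi z) * qpoch q (q / e2pi z)"
    unfolding qpoch_def by (intro prodinf_mult[symmetric] qpoch_convergent q)
  moreover have "q_pow (B2 (a $ 1) / 2) \<tau> * exp (of_real pi * \<i> * of_rat (a $ 2 * (a $ 1 - 1))) =
      e2pi ((\<alpha> * z - z + \<tau> / 6) / 2)"
  proof -
    have "q_pow (B2 (a $ 1) / 2) \<tau> * exp (of_real pi * \<i> * of_rat (a $ 2 * (a $ 1 - 1))) =
       e2pi ((\<alpha>\<^sup>2 - \<alpha> + 1 / 6) / 2 * \<tau> + \<beta> * (\<alpha> - 1) / 2)"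
    proof -
      define U V where "U = \<alpha>\<^sup>2 - \<alpha> + 1 / 6" and "V = \<beta> * (\<alpha> - 1)"
      have "of_rat (B2 (a $ 1) / 2) = U / 2" "of_rat (a $ 2 * (a $ 1 - 1)) = V"
        by (simp_all add: B2_def U_def V_def \<alpha>_def \<beta>_def of_rat_add of_rat_diff of_rat_mult of_rat_divide of_rat_power)
      thus ?thesis
        unfolding q_pow_def e2pi_def exp_add[symmetric] U_def[symmetric] V_def[symmetric]
        by (simp add: algebra_simps)
    qed
    also have "(\<alpha>\<^sup>2 - \<alpha> + 1 / 6) / 2 * \<tau> + \<beta> * (\<alpha> - 1) / 2 = (\<alpha> * z - z + \<tau> / 6) / 2"
    proof -
      have "z = \<alpha> * \<tau> + \<beta>" by (simp add: z \<alpha>_def \<beta>_def)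
      thus ?thesis by (simp add: power2_eq_square algebra_simps add_divide_distrib diff_divide_distrib)
    qed
    finally show ?thesis .
  qed
  ultimately show ?thesis
    unfolding siegel_def f1 f2 theta_kernel_def theta_def q_def[symmetric] \<alpha>_def by simp
qed

lemma siegel_square_eq_theta_kernel:
  fixes a :: "rat ^ 2"
  assumes \<tau>: "\<tau> \<in> \<H>" and z: "z = of_rat (a $ 1) * \<tau> + of_rat (a $ 2)"
  shows "siegel a \<tau> ^ 2 = e2pi (of_rat (a $ 1) * z - z + \<tau> / 6) * theta_kernel \<tau> z ^ 2"
proof -
  have "e2pi (w / 2) ^ 2 = e2pi w" for w using e2pi_of_nat_mult[of 2 "w / 2"] by simp
  thus ?thesis unfolding siegel_eq_theta_kernel[OF assms] power_mult_distrib power2_minus by simp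
qed

lemma siegel_holomorphic: "siegel a holomorphic_on \<H>"
proof -
  have "(\<lambda>\<tau>. - e2pi ((of_rat (a $ 1) * (of_rat (a $ 1) * \<tau> + of_rat (a $ 2)) - (of_rat (a $ 1) * \<tau> + of_rat (a $ 2)) + \<tau> / 6) / 2) *
      theta_kernel \<tau> (of_rat (a $ 1) * \<tau> + of_rat (a $ 2))) holomorphic_on \<H>"
    by (intro holomorphic_intros theta_kernel_holomorphic open_upper_half_plane) auto
  thus ?thesis by (rule holomorphic_transform) (simp add: siegel_eq_theta_kernel)
qed

lemma lattice_coordinates_unique:
  assumes "\<tau> \<in> \<H>" "of_real x * \<tau> + of_real y = of_real x' * \<tau> + of_real y'"
  shows "x = x' \<and> y = y'"
proof -
  have "Im (of_real x * \<tau> + of_real y) = Im (of_real x' * \<tau> + of_real y')" using assms by simp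
  hence "x * Im \<tau> = x' * Im \<tau>" by simp
  hence "x = x'" using assms by (simp add: upper_half_plane_def)
  with assms show ?thesis by (metis add_left_cancel of_real_eq_iff)
qed

lemma of_real_of_rat: "of_real (of_rat r) = (of_rat r :: complex)"
  by (cases r) (simp add: Fract_of_int_quotient of_rat_divide)

lemma siegel_nonzero:
  fixes a :: "rat ^ 2"
  assumes \<tau>: "\<tau> \<in> \<H>" and a: "\<not> (a $ 1 \<in> \<int> \<and> a $ 2 \<in> \<int>)"
  shows "siegel a \<tau> \<noteq> 0"
proof
  assume "siegel a \<tau> = 0"
  hence "theta_kernel \<tau> (of_rat (a $ 1) * \<tau> + of_rat (a $ 2)) = 0"
    by (simp add: siegel_eq_theta_kernel[OF \<tau> refl])
  then obtain m n :: int where "of_rat (a $ 1) * \<tau> + of_rat (a $ 2) = of_int m * \<tau> + of_int n"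
    using theta_kernel_eq_0D[OF \<tau>] by blast
  hence "of_real (of_rat (a $ 1)) * \<tau> + of_real (of_rat (a $ 2)) = of_real (of_int m) * \<tau> + of_real (of_int n)"
    by (simp add: of_real_of_rat)
  from lattice_coordinates_unique[OF \<tau> this] have "(of_rat (a $ 1) :: real) = of_rat (of_int m)" "(of_rat (a $ 2) :: real) = of_rat (of_int n)"
    by simp_all
  thus False using a unfolding of_rat_eq_iff by simp
qed

text \<open>
  Squares are taken because the Siegel function itself also picks up a sign.  A step of \<open>a\<^sub>2\<close> by 1
  leaves the theta product unchanged, and a step of \<open>a\<^sub>1\<close> by 1 is the quasi-period \<open>\<tau>\<close>; an
  induction over the integers in each direction gives the general case.
\<close>
lemma siegel_square_shift:
  fixes a b :: "rat ^ 2"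
  assumes \<tau>: "\<tau> \<in> \<H>" and b: "b $ 1 = a $ 1 + of_int m" "b $ 2 = a $ 2 + of_int n"
  shows "siegel b \<tau> ^ 2 = e2pi (of_rat (of_int n * a $ 1 - of_int m * a $ 2)) * siegel a \<tau> ^ 2"
proof -
  define K where "K x y = e2pi (x * (x * \<tau> + y) - (x * \<tau> + y) + \<tau> / 6) * theta_kernel \<tau> (x * \<tau> + y) ^ 2" for x y
  have sq: "siegel c \<tau> ^ 2 = K (of_rat (c $ 1)) (of_rat (c $ 2))" for c
    unfolding K_def by (rule siegel_square_eq_theta_kernel[OF \<tau> refl])
  note K = K_def
  have K2: "K x (y + 1) = e2pi x * K x y" for x y
  proof -
    have "x * \<tau> + (y + 1) = (x * \<tau> + y) + 1" by simp
    hence "K x (y + 1) = e2pi (x * (x * \<tau> + y) - (x * \<tau> + y) + \<tau> / 6 + x - 1) * theta_kernel \<tau> (x * \<tau> + y) ^ 2"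
      unfolding K theta_kernel_add_1 by (simp only: theta_kernel_add_1) (simp add: algebra_simps)
    thus ?thesis unfolding K by (simp add: e2pi_add e2pi_diff)
  qed
  have K1: "K (x + 1) y = e2pi (- y) * K x y" for x y
  proof -
    define z where "z = x * \<tau> + y"
    have "(x + 1) * \<tau> + y = z + \<tau>" by (simp add: z_def algebra_simps)
    hence "K (x + 1) y = e2pi ((x + 1) * (z + \<tau>) - (z + \<tau>) + \<tau> / 6) * (- e2pi (- z) * theta_kernel \<tau> z) ^ 2"
      unfolding K[of "x + 1" y] by (simp only: theta_kernel_add_tau[OF \<tau>])
    also have "\<dots> = e2pi ((x + 1) * (z + \<tau>) - (z + \<tau>) + \<tau> / 6 - z - z) * theta_kernel \<tau> z ^ 2"
      unfolding e2pi_diff[of _ z] by (simp add: power2_eq_square e2pi_minus field_simps)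
    also have "(x + 1) * (z + \<tau>) - (z + \<tau>) + \<tau> / 6 - z - z = - y + (x * z - z + \<tau> / 6)"
      by (simp add: z_def algebra_simps)
    finally show ?thesis unfolding K[of x y] z_def[symmetric] e2pi_add by simp
  qed
  have K2n: "K x (y + of_int n) = e2pi (of_int n * x) * K x y" for x y n
  proof (induction n rule: int_induct[where k = 0])
    case (step1 i)
    have "K x (y + of_int (i + 1)) = e2pi x * K x (y + of_int i)"
      using K2[of x "y + of_int i"] by (simp add: add_ac)
    also have "\<dots> = e2pi (x + of_int i * x) * K x y" unfolding e2pi_add step1.IH by simp
    also have "x + of_int i * x = of_int (i + 1) * x" by (simp add: algebra_simps)
    finally show ?case .
  next
    case (step2 i)
    have "K x (y + of_int i) = e2pi x * K x (y + of_int (i - 1))"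
      using K2[of x "y + of_int (i - 1)"] by (simp add: add_ac)
    hence "K x (y + of_int (i - 1)) = e2pi (- x) * K x (y + of_int i)"
      by (simp add: e2pi_minus)
    also have "\<dots> = e2pi (- x + of_int i * x) * K x y" unfolding e2pi_add step2.IH by simp
    also have "- x + of_int i * x = of_int (i - 1) * x" by (simp add: algebra_simps)
    finally show ?case .
  qed simp
  have K1m: "K (x + of_int m) y = e2pi (- of_int m * y) * K x y" for x y m
  proof (induction m rule: int_induct[where k = 0])
    case (step1 i)
    have "K (x + of_int (i + 1)) y = e2pi (- y) * K (x + of_int i) y"
      using K1[of "x + of_int i" y] by (simp add: add_ac)
    also have "\<dots> = e2pi (- y + - of_int i * y) * K x y" unfolding e2pi_add step1.IH by simp
    also have "- y + - of_int i * y = - of_int (i + 1) * y" by (simp add: algebra_simps)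
    finally show ?case .
  next
    case (step2 i)
    have "K (x + of_int i) y = e2pi (- y) * K (x + of_int (i - 1)) y"
      using K1[of "x + of_int (i - 1)" y] by (simp add: add_ac)
    hence "K (x + of_int (i - 1)) y = e2pi y * K (x + of_int i) y"
      by (simp add: e2pi_minus)
    also have "\<dots> = e2pi (y + - of_int i * y) * K x y" unfolding e2pi_add step2.IH by simp
    also have "y + - of_int i * y = - of_int (i - 1) * y" by (simp add: algebra_simps)
    finally show ?case .
  qed simp
  have "siegel b \<tau> ^ 2 = K (of_rat (a $ 1) + of_int m) (of_rat (a $ 2) + of_int n)"
    by (simp add: sq b of_rat_add)
  also have "\<dots> = e2pi (of_int n * (of_rat (a $ 1) + of_int m) + (- of_int m * of_rat (a $ 2))) * siegel a \<tau> ^ 2"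
    unfolding K2n K1m sq e2pi_add by simp
  also have "of_int n * (of_rat (a $ 1) + of_int m) + (- of_int m * of_rat (a $ 2)) =
      of_rat (of_int n * a $ 1 - of_int m * a $ 2) + (of_int (n * m) :: complex)"
    by (simp add: of_rat_diff of_rat_mult algebra_simps)
  finally show ?thesis unfolding e2pi_add[of _ "of_int (n * m)"] e2pi_of_int by simp
qed

section \<open>Transformation under the modular group\<close>

lemma lattice_periodic:
  fixes P :: "complex \<Rightarrow> 'a"
  assumes 1: "\<And>z. P (z + 1) = P z" and \<tau>: "\<And>z. P (z + \<tau>) = P z"
  shows "P (z + of_int m * \<tau> + of_int n) = P z"
proof -
  have n: "P (z + of_int n) = P z" for z n
  proof (induction n rule: int_induct[where k = 0])
    case (step1 i)
    thus ?case using 1[of "z + of_int i"] by (simp add: add_ac)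
  next
    case (step2 i)
    thus ?case using 1[of "z + of_int (i - 1)"] by (simp add: add_ac)
  qed simp
  have m: "P (z + of_int m * \<tau>) = P z" for z m
  proof (induction m rule: int_induct[where k = 0])
    case (step1 i)
    thus ?case using \<tau>[of "z + of_int i * \<tau>"] by (simp add: algebra_simps)
  next
    case (step2 i)
    thus ?case using \<tau>[of "z + of_int (i - 1) * \<tau>"] by (simp add: algebra_simps)
  qed simp
  show ?thesis by (simp add: m n)
qed

text \<open>
  Liouville: the quotient of \<open>A\<close> and \<open>B\<close> is doubly periodic, and its only possible singularities are
  the lattice points, where it is removable because \<open>B\<close> has simple zeros and \<open>A\<close> vanishes.  By
  periodicity it suffices to remove the singularity at the origin.
\<close>
lemma quasi_periodic_proportional:
  fixes A B M :: "complex \<Rightarrow> complex"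
  assumes \<tau>: "\<tau> \<in> \<H>"
    and hol: "A holomorphic_on UNIV" "B holomorphic_on UNIV"
    and A: "\<And>z. A (z + 1) = A z" "\<And>z. A (z + \<tau>) = M z * A z" "A 0 = 0"
    and B: "\<And>z. B (z + 1) = B z" "\<And>z. B (z + \<tau>) = M z * B z" "B 0 = 0" "deriv B 0 \<noteq> 0"
    and zeros: "\<And>z. B z = 0 \<Longrightarrow> \<exists>m n::int. z = of_int m * \<tau> + of_int n"
    and M: "\<And>z. M z \<noteq> 0"
  shows "\<exists>c. \<forall>z. A z = c * B z"
proof -
  \<comment> \<open>the value of the quotient at the lattice points, by de l'Hospital's rule\<close>
  define c where "c = deriv A 0 / deriv B 0"
  define R where "R z = (if B z = 0 then c else A z / B z)" for z
  have R1: "R (z + 1) = R z" for z by (simp add: R_def A B)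
  have R\<tau>: "R (z + \<tau>) = R z" for z by (simp add: R_def A B M)
  have R_per: "R (z + of_int m * \<tau> + of_int n) = R z" for z m n
    by (rule lattice_periodic[of R, OF R1 R\<tau>])
  have R0: "R field_differentiable (at 0)"
  proof -
    define a where "a z = (if z = 0 then deriv A 0 else (A z - A 0) / (z - 0))" for z
    define b where "b z = (if z = 0 then deriv B 0 else (B z - B 0) / (z - 0))" for z
    have ab: "a holomorphic_on UNIV" "b holomorphic_on UNIV"
      unfolding a_def b_def using pole_lemma[OF hol(1), of 0] pole_lemma[OF hol(2), of 0] by simp_all
    have "isCont b 0"
      using holomorphic_on_imp_continuous_on[OF ab(2)] continuous_on_eq_continuous_at[OF open_UNIV] by blast
    have b0: "b 0 \<noteq> 0" using B(4) by (simp add: b_def)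
    with \<open>isCont b 0\<close> have "eventually (\<lambda>z. b z \<noteq> 0) (at 0)"
      by (intro tendsto_imp_eventually_ne[of b "b 0"]) (auto simp: isCont_def)
    hence "eventually (\<lambda>z. b z \<noteq> 0) (nhds 0)"
      using b0 by (simp add: eventually_nhds_conv_at)
    hence "eventually (\<lambda>z. a z / b z = R z) (nhds 0)"
      by eventually_elim (auto simp: a_def b_def R_def c_def A(3) B(3) split: if_splits)
    then obtain U where U: "open U" "0 \<in> U" "\<And>z. z \<in> U \<Longrightarrow> a z / b z = R z"
      unfolding eventually_nhds by blast
    have "a field_differentiable (at 0)" "b field_differentiable (at 0)"
      using ab by (simp_all add: holomorphic_on_def)
    hence "(\<lambda>z. a z / b z) field_differentiable (at 0)"
      using b0 by (intro field_differentiable_divide) auto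
    thus ?thesis
      using U unfolding field_differentiable_def by (metis (no_types, lifting) has_field_derivative_transform_within_open)
  qed
  have "R field_differentiable (at z)" for z
  proof (cases "B z = 0")
    case True
    then obtain m n :: int where mn: "z = of_int m * \<tau> + of_int n" using zeros by blast
    have "R = (\<lambda>w. R (w - z))"
    proof
      fix w show "R w = R (w - z)"
        using R_per[of "w - z" m n] mn by (simp add: algebra_simps)
    qed
    moreover have "(R \<circ> (\<lambda>w. w - z)) field_differentiable (at z)"
      by (rule field_differentiable_compose) (auto intro!: derivative_intros R0 field_differentiable_diff)
    ultimately show ?thesis by (simp add: o_def)
  next
    case False
    have U: "open (B -` (- {0}))"
      using hol(2) by (intro open_vimage) (auto simp: holomorphic_on_imp_continuous_on)
    have "(\<lambda>z. A z / B z) field_differentiable (at z)"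
      using hol False by (intro field_differentiable_divide) (auto simp: holomorphic_on_def)
    thus ?thesis
      using False U unfolding field_differentiable_def
      by (elim exE, intro exI) (erule has_field_derivative_transform_within_open, auto simp: R_def)
  qed
  hence R_hol: "R holomorphic_on UNIV" by (simp add: holomorphic_on_def)
  \<comment> \<open>a compact fundamental cell on which the periodic quotient attains all its values\<close>
  define cell where "cell = (\<lambda>(x::real, y::real). of_real x * \<tau> + of_real y) ` ({0..1} \<times> {0..1})"
  have "compact cell" unfolding cell_def
    by (intro compact_continuous_image compact_Times compact_Icc)
       (auto simp: case_prod_unfold intro!: continuous_intros)
  hence "bounded (R ` cell)"
    using R_hol by (meson compact_continuous_image compact_imp_bounded
        continuous_on_subset holomorphic_on_imp_continuous_on subset_UNIV)
  moreover have "range R \<subseteq> R ` cell"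
  proof safe
    fix z
    define x where "x = Im z / Im \<tau>"
    define y where "y = Re z - x * Re \<tau>"
    have "Im \<tau> > 0" using \<tau> by (simp add: upper_half_plane_def)
    hence z: "z = of_real x * \<tau> + of_real y" by (simp add: complex_eq_iff x_def y_def)
    have "R z = R (of_real (frac x) * \<tau> + of_real (frac y) + of_int \<lfloor>x\<rfloor> * \<tau> + of_int \<lfloor>y\<rfloor>)"
      unfolding z by (rule arg_cong[of _ _ R]) (simp add: frac_def algebra_simps)
    also have "\<dots> = R (of_real (frac x) * \<tau> + of_real (frac y))" by (rule R_per)
    also have "\<dots> \<in> R ` cell"
      unfolding cell_def using frac_ge_0[of x] frac_lt_1[of x] frac_ge_0[of y] frac_lt_1[of y]
      by (intro imageI image_eqI[of _ _ "(frac x, frac y)"]) auto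
    finally show "R z \<in> R ` cell" .
  qed
  ultimately have "bounded (range R)" using bounded_subset by blast
  then obtain k where k: "\<And>z. R z = k"
    using Liouville_theorem[OF R_hol] unfolding constant_on_def by auto
  have A_zero: "A z = 0" if Bz: "B z = 0" for z
  proof -
    obtain m n :: int where "z = of_int m * \<tau> + of_int n" using zeros[OF Bz] by blast
    thus ?thesis
      using lattice_periodic[of "\<lambda>z. A z = 0" \<tau> 0 m n] by (simp add: A M)
  qed
  have "A z = k * B z" for z
    using k[of z] A_zero[of z] by (auto simp: R_def split: if_splits)
  thus ?thesis by blast
qed

lemma inversion_in_upper_half_plane: "\<tau> \<in> \<H> \<Longrightarrow> - 1 / \<tau> \<in> \<H>"
  by (auto simp: upper_half_plane_def Im_divide zero_less_divide_iff complex_eq_iff sum_power2_gt_zero_iff)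

lemma e2pi_half: "e2pi (1 / 2) = -1"
  by (simp add: e2pi_def)

text \<open>
  The Gaussian factor turns the quasi-periods of \<open>z \<mapsto> theta_kernel (-1/\<tau>) (z/\<tau>)\<close> into those of
  \<open>theta_kernel \<tau>\<close>, so that the two functions are proportional.  The factor \<open>c\<close> is identified
  only afterwards, from the points of order 2.
\<close>
lemma theta_kernel_inversion:
  assumes \<tau>: "\<tau> \<in> \<H>"
  shows "\<exists>c. \<forall>z. e2pi ((- z / \<tau> - 1 / (6 * \<tau>) - z\<^sup>2 / \<tau> + z - \<tau> / 6) / 2) * theta_kernel (- 1 / \<tau>) (z / \<tau>) = c * theta_kernel \<tau> z"
proof -
  define E where "E z = (- z / \<tau> - 1 / (6 * \<tau>) - z\<^sup>2 / \<tau> + z - \<tau> / 6) / 2" for z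
  define A where "A z = e2pi (E z) * theta_kernel (- 1 / \<tau>) (z / \<tau>)" for z
  have \<tau>': "- 1 / \<tau> \<in> \<H>" and \<tau>0: "\<tau> \<noteq> 0"
    using inversion_in_upper_half_plane[OF \<tau>] \<tau> by (auto simp: upper_half_plane_def)
  have "\<exists>c. \<forall>z. A z = c * theta_kernel \<tau> z"
  proof (rule quasi_periodic_proportional[OF \<tau>, where M = "\<lambda>z. - e2pi (- z)"])
    show "A holomorphic_on UNIV" unfolding A_def E_def
      using \<tau>' \<tau>0 by (intro holomorphic_intros theta_kernel_holomorphic) auto
    show "theta_kernel \<tau> holomorphic_on UNIV"
      using theta_kernel_holomorphic[of "\<lambda>_. \<tau>" UNIV "\<lambda>z. z"] \<tau> by auto
    show "A 0 = 0" using theta_kernel_0[OF \<tau>'] by (simp add: A_def)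
    show "A (z + 1) = A z" for z
    proof -
      have "z / \<tau> = (z + 1) / \<tau> + - 1 / \<tau>" using \<tau>0 by (simp add: field_simps)
      hence "theta_kernel (- 1 / \<tau>) (z / \<tau>) = - e2pi (- ((z + 1) / \<tau>)) * theta_kernel (- 1 / \<tau>) ((z + 1) / \<tau>)"
        by (metis theta_kernel_add_tau[OF \<tau>'])
      hence k: "theta_kernel (- 1 / \<tau>) ((z + 1) / \<tau>) = - e2pi ((z + 1) / \<tau>) * theta_kernel (- 1 / \<tau>) (z / \<tau>)"
        by (simp add: e2pi_minus)
      have "(z + 1)\<^sup>2 / \<tau> = z\<^sup>2 / \<tau> + 2 * (z / \<tau>) + 1 / \<tau>" "(z + 1) / \<tau> = z / \<tau> + 1 / \<tau>"
        by (simp_all add: power2_eq_square add_divide_distrib algebra_simps)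
      moreover have "(- (P + Q) - S - (R + 2 * P + Q) + (z + 1) - T) / 2 = (- P - S - R + z - T) / 2 + (- (P + Q) + 1 / 2)"
        for P Q R S T :: complex by (simp add: field_simps)
      ultimately have "E (z + 1) = E z + (- ((z + 1) / \<tau>) + 1 / 2)"
        unfolding E_def minus_divide_left[symmetric] by (simp only:)
      hence "e2pi (E (z + 1)) = e2pi (E z) * (e2pi (- ((z + 1) / \<tau>)) * - 1)"
        by (simp only: e2pi_add e2pi_half)
      thus ?thesis unfolding A_def k by (simp add: e2pi_minus)
    qed
    show "A (z + \<tau>) = - e2pi (- z) * A z" for z
    proof -
      have "(z + \<tau>) / \<tau> = z / \<tau> + 1" using \<tau>0 by (simp add: field_simps)
      hence k: "theta_kernel (- 1 / \<tau>) ((z + \<tau>) / \<tau>) = theta_kernel (- 1 / \<tau>) (z / \<tau>)"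
        by (metis theta_kernel_add_1)
      have "(z + \<tau>)\<^sup>2 / \<tau> = z\<^sup>2 / \<tau> + 2 * z + \<tau>" "(z + \<tau>) / \<tau> = z / \<tau> + 1"
        using \<tau>0 by (simp_all add: power2_eq_square add_divide_distrib algebra_simps)
      moreover have "(- (P + 1) - S - (R + 2 * z + \<tau>) + (z + \<tau>) - T) / 2 = (- P - S - R + z - T) / 2 + (- z + 1 / 2 - 1)"
        for P R S T :: complex by (simp add: field_simps)
      ultimately have "E (z + \<tau>) = E z + (- z + 1 / 2 - 1)"
        unfolding E_def minus_divide_left[symmetric] by (simp only:)
      hence "e2pi (E (z + \<tau>)) = e2pi (E z) * (e2pi (- z) * - 1 / 1)"
        by (simp only: e2pi_add e2pi_diff e2pi_half e2pi_1)
      thus ?thesis unfolding A_def k by simp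
    qed
  qed (use \<tau> theta_kernel_add_1 theta_kernel_add_tau theta_kernel_0 deriv_theta_kernel_0_nonzero theta_kernel_eq_0D in auto)
  thus ?thesis unfolding A_def E_def .
qed

text \<open>
  For \<open>Z = a\<^sub>2\<tau> - a\<^sub>1\<close>, the point attached to \<open>a\<close> and \<open>-1/\<tau>\<close> is \<open>Z/\<tau>\<close>, and the point attached to
  \<open>(a\<^sub>2, -a\<^sub>1)\<close> and \<open>\<tau>\<close> is \<open>Z\<close>.  The exponential factors of the Siegel functions differ exactly by the
  Gaussian factor of \<open>theta_kernel_inversion\<close>; this is why \<open>C\<close> does not depend on \<open>a\<close>.
\<close>
lemma siegel_inversion_aux:
  assumes \<tau>: "\<tau> \<in> \<H>"
  shows "\<exists>C. \<forall>a b :: rat ^ 2. b $ 1 = a $ 2 \<longrightarrow> b $ 2 = - a $ 1 \<longrightarrow> siegel a (- 1 / \<tau>) = C * siegel b \<tau>"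
proof -
  define E where "E z = (- z / \<tau> - 1 / (6 * \<tau>) - z\<^sup>2 / \<tau> + z - \<tau> / 6) / 2" for z
  obtain c where c: "\<And>z. e2pi (E z) * theta_kernel (- 1 / \<tau>) (z / \<tau>) = c * theta_kernel \<tau> z"
    unfolding E_def using theta_kernel_inversion[OF \<tau>] by blast
  have \<tau>': "- 1 / \<tau> \<in> \<H>" and \<tau>0: "\<tau> \<noteq> 0"
    using inversion_in_upper_half_plane[OF \<tau>] \<tau> by (auto simp: upper_half_plane_def)
  have "siegel a (- 1 / \<tau>) = c * siegel b \<tau>" if b: "b $ 1 = a $ 2" "b $ 2 = - a $ 1" for a b :: "rat ^ 2"
  proof -
    define \<alpha> \<beta> Z :: complex where "\<alpha> = of_rat (a $ 1)" and "\<beta> = of_rat (a $ 2)" and "Z = \<beta> * \<tau> - \<alpha>"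
    have 1: "Z / \<tau> = \<alpha> * (- 1 / \<tau>) + \<beta>" using \<tau>0 by (simp add: Z_def field_simps)
    have 2: "Z = of_rat (b $ 1) * \<tau> + of_rat (b $ 2)" by (simp add: Z_def b \<alpha>_def \<beta>_def of_rat_minus)
    have exponents: "(\<alpha> * (Z / \<tau>) - Z / \<tau> + (- 1 / \<tau>) / 6) / 2 = (\<beta> * Z - Z + \<tau> / 6) / 2 + E Z"
    proof -
      have "\<alpha> = \<beta> * \<tau> - Z" by (simp add: Z_def)
      thus ?thesis unfolding E_def using \<tau>0 by (simp only:) (simp add: field_simps power2_eq_square)
    qed
    have "siegel a (- 1 / \<tau>) = - e2pi ((\<alpha> * (Z / \<tau>) - Z / \<tau> + (- 1 / \<tau>) / 6) / 2) * theta_kernel (- 1 / \<tau>) (Z / \<tau>)"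
      unfolding \<alpha>_def by (rule siegel_eq_theta_kernel[OF \<tau>']) (use 1 in \<open>simp add: \<alpha>_def \<beta>_def\<close>)
    also have "\<dots> = - e2pi ((\<beta> * Z - Z + \<tau> / 6) / 2) * (e2pi (E Z) * theta_kernel (- 1 / \<tau>) (Z / \<tau>))"
      unfolding exponents e2pi_add by simp
    also have "\<dots> = c * (- e2pi ((\<beta> * Z - Z + \<tau> / 6) / 2) * theta_kernel \<tau> Z)"
      unfolding c by simp
    also have "- e2pi ((\<beta> * Z - Z + \<tau> / 6) / 2) * theta_kernel \<tau> Z = siegel b \<tau>"
      using siegel_eq_theta_kernel[OF \<tau> 2] by (simp add: b \<beta>_def)
    finally show ?thesis .
  qed
  thus ?thesis by blast
qed

lemma qpoch_mult_neg:
  assumes q: "norm q < 1"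
  shows "qpoch q w * qpoch q (- w) = qpoch (q\<^sup>2) (w\<^sup>2)"
proof -
  have "norm (q\<^sup>2) < 1" using q by (simp add: norm_power abs_square_less_1)
  hence "(\<lambda>N. \<Prod>n<N. 1 - w\<^sup>2 * (q\<^sup>2) ^ n) \<longlonglongrightarrow> qpoch (q\<^sup>2) (w\<^sup>2)" by (rule qpoch_LIMSEQ)
  moreover have "(\<Prod>n<N. 1 - w\<^sup>2 * (q\<^sup>2) ^ n) = (\<Prod>n<N. 1 - w * q ^ n) * (\<Prod>n<N. 1 - (- w) * q ^ n)" for N
    unfolding prod.distrib[symmetric]
    by (intro prod.cong refl) (simp add: power2_eq_square power_mult_distrib algebra_simps)
  moreover have "(\<lambda>N. (\<Prod>n<N. 1 - w * q ^ n) * (\<Prod>n<N. 1 - (- w) * q ^ n)) \<longlonglongrightarrow> qpoch q w * qpoch q (- w)"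
    by (intro tendsto_mult qpoch_LIMSEQ q)
  ultimately show ?thesis using LIMSEQ_unique by simp
qed

lemma qpoch_even_odd:
  assumes q: "norm q < 1"
  shows "qpoch q w = qpoch (q\<^sup>2) w * qpoch (q\<^sup>2) (w * q)"
proof -
  have q2: "norm (q\<^sup>2) < 1" using q by (simp add: norm_power abs_square_less_1)
  have "(\<lambda>N. \<Prod>n<2 * N. 1 - w * q ^ n) \<longlonglongrightarrow> qpoch q w"
    using LIMSEQ_subseq_LIMSEQ[OF qpoch_LIMSEQ[OF q], of "\<lambda>N. 2 * N" w] by (simp add: strict_mono_def o_def)
  moreover have "(\<Prod>n<2 * N. 1 - w * q ^ n) = (\<Prod>n<N. 1 - w * (q\<^sup>2) ^ n) * (\<Prod>n<N. 1 - (w * q) * (q\<^sup>2) ^ n)" for N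
    by (induction N) (simp_all add: power_mult[symmetric] mult_ac)
  moreover have "(\<lambda>N. (\<Prod>n<N. 1 - w * (q\<^sup>2) ^ n) * (\<Prod>n<N. 1 - (w * q) * (q\<^sup>2) ^ n)) \<longlonglongrightarrow> qpoch (q\<^sup>2) w * qpoch (q\<^sup>2) (w * q)"
    by (intro tendsto_mult qpoch_LIMSEQ q2)
  ultimately show ?thesis using LIMSEQ_unique by simp
qed

text \<open>
  With \<open>q = h\<^sup>2\<close>, this is Euler's identity \<open>\<Prod>(1 + q\<^sup>n)(1 - q\<^bsup>2n-1\<^esup>) = 1\<close>: both \<open>(q; q) (-q; q)\<close> and the even
  part of \<open>(q; q)\<close> are equal to \<open>(q\<^sup>2; q\<^sup>2)\<close>.
\<close>
lemma weber_product:
  assumes h: "norm (h\<^sup>2) < 1"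
  shows "qpoch (h\<^sup>2) h * qpoch (h\<^sup>2) (- h) * qpoch (h\<^sup>2) (- (h\<^sup>2)) = 1"
proof -
  define q where "q = h\<^sup>2"
  have q: "norm q < 1" using h by (simp add: q_def)
  have q2: "norm (q\<^sup>2) < 1" using q by (simp add: norm_power abs_square_less_1)
  have nz: "qpoch (q\<^sup>2) (q\<^sup>2) \<noteq> 0"
  proof
    assume "qpoch (q\<^sup>2) (q\<^sup>2) = 0"
    then obtain n where "(q\<^sup>2) * (q\<^sup>2) ^ n = 1" using qpoch_eq_0_iff[OF q2] by blast
    hence "norm (q\<^sup>2) ^ Suc n = 1" by (metis norm_one norm_power power_Suc)
    thus False using q2 by (metis norm_ge_zero order_less_irrefl power_Suc_less_one power_0_Suc
         less_eq_real_def zero_neq_one)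
  qed
  have "qpoch (q\<^sup>2) q * qpoch (q\<^sup>2) (q\<^sup>2) * qpoch q (- q) = qpoch (q\<^sup>2) (q\<^sup>2)"
    using qpoch_mult_neg[OF q, of q] qpoch_even_odd[OF q, of q] by (simp add: power2_eq_square)
  hence "qpoch (q\<^sup>2) q * qpoch q (- q) = 1" using nz by (simp add: mult_ac)
  thus ?thesis using qpoch_mult_neg[OF q, of h] by (simp add: q_def)
qed

text \<open>
  The powers of \<open>q\<close> cancel, and the products combine to the product in \<open>weber_product\<close>.  That
  the value does not depend on \<open>\<tau>\<close> is what determines the constant of the inversion formula.
\<close>
lemma two_torsion_product:
  assumes \<tau>: "\<tau> \<in> \<H>"
  shows "(siegel (vector [1/2, 0]) \<tau>)\<^sup>2 * (siegel (vector [0, 1/2]) \<tau>)\<^sup>2 *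
    (siegel (vector [1/2, 1/2]) \<tau>)\<^sup>2 = 4 * e2pi (- 3 / 4)"
proof -
  define h where "h = e2pi (\<tau> / 2)"
  have h2: "h\<^sup>2 = e2pi \<tau>" using e2pi_of_nat_mult[of 2 "\<tau> / 2"] by (simp add: h_def)
  have q: "norm (h\<^sup>2) < 1" using norm_e2pi_less_1[OF \<tau>] h2 by simp
  have h0: "h \<noteq> 0" by (simp add: h_def)
  have sq: "e2pi (w / 2) ^ 2 = e2pi w" for w using e2pi_of_nat_mult[of 2 "w / 2"] by simp
  have half: "(of_rat (1 / 2) :: complex) = 1 / 2" by (simp add: of_rat_divide)
  have hh: "h * h = e2pi \<tau>" using h2 by (simp add: power2_eq_square)
  have k1: "theta_kernel \<tau> (\<tau> / 2) = (qpoch (h\<^sup>2) h)\<^sup>2"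
    unfolding theta_kernel_def theta_def h_def[symmetric] h2[symmetric] using h0 by (simp add: power2_eq_square)
  have k2: "theta_kernel \<tau> (1 / 2) = 2 * (qpoch (h\<^sup>2) (- (h\<^sup>2)))\<^sup>2"
    unfolding theta_kernel_def theta_def e2pi_half h2[symmetric] using qpoch_step[OF q, of "- 1"] by (simp add: power2_eq_square)
  have k3: "theta_kernel \<tau> (\<tau> / 2 + 1 / 2) = (qpoch (h\<^sup>2) (- h))\<^sup>2"
    unfolding theta_kernel_def theta_def h2[symmetric] e2pi_add h_def[symmetric] e2pi_half using h0 by (simp add: power2_eq_square)
  have s1: "(siegel (vector [1/2, 0]) \<tau>)\<^sup>2 = e2pi (- \<tau> / 4 + \<tau> / 6) * (qpoch (h\<^sup>2) h) ^ 4"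
    unfolding siegel_eq_theta_kernel[OF \<tau> refl] power_mult_distrib power2_minus sq
    by (simp add: half k1 field_simps flip: power_mult)
  have s2: "(siegel (vector [0, 1/2]) \<tau>)\<^sup>2 = e2pi (- 1 / 2 + \<tau> / 6) * (4 * (qpoch (h\<^sup>2) (- (h\<^sup>2))) ^ 4)"
    unfolding siegel_eq_theta_kernel[OF \<tau> refl] power_mult_distrib power2_minus sq
    by (simp add: half k2 power_mult_distrib flip: power_mult)
  have s3: "(siegel (vector [1/2, 1/2]) \<tau>)\<^sup>2 = e2pi (- \<tau> / 4 - 1 / 4 + \<tau> / 6) * (qpoch (h\<^sup>2) (- h)) ^ 4"
  proof -
    have "1 / 2 * (\<tau> / 2 + 1 / 2) - (\<tau> / 2 + 1 / 2) + \<tau> / 6 = - \<tau> / 4 - 1 / 4 + \<tau> / 6" by (simp add: field_simps)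
    thus ?thesis
      unfolding siegel_eq_theta_kernel[OF \<tau> refl] power_mult_distrib power2_minus sq
      by (simp add: half k3 flip: power_mult)
  qed
  have "(siegel (vector [1/2, 0]) \<tau>)\<^sup>2 * (siegel (vector [0, 1/2]) \<tau>)\<^sup>2 * (siegel (vector [1/2, 1/2]) \<tau>)\<^sup>2 =
    4 * (e2pi (- \<tau> / 4 + \<tau> / 6) * e2pi (- 1 / 2 + \<tau> / 6) * e2pi (- \<tau> / 4 - 1 / 4 + \<tau> / 6)) *
    (qpoch (h\<^sup>2) h * qpoch (h\<^sup>2) (- h) * qpoch (h\<^sup>2) (- (h\<^sup>2))) ^ 4"
    unfolding s1 s2 s3 power_mult_distrib by (simp only: mult_ac)
  also have "\<dots> = 4 * e2pi (- 3 / 4)"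
    unfolding weber_product[OF q] e2pi_add[symmetric] by (simp add: field_simps)
  finally show ?thesis .
qed

text \<open>
  Inversion permutes the three points of order 2 up to integral shifts.  Comparing the constant
  value of \<open>two_torsion_product\<close> at \<open>-1/\<tau>\<close> and at \<open>\<tau>\<close> gives \<open>C\<^sup>6 = -1\<close>.
\<close>
lemma siegel_inversion:
  assumes \<tau>: "\<tau> \<in> \<H>"
  shows "\<exists>C. C ^ 12 = 1 \<and> (\<forall>a b :: rat ^ 2. b $ 1 = a $ 2 \<longrightarrow> b $ 2 = - a $ 1 \<longrightarrow> siegel a (- 1 / \<tau>) = C * siegel b \<tau>)"
proof -
  from siegel_inversion_aux[OF \<tau>] obtain C where
    C: "\<And>a b :: rat ^ 2. b $ 1 = a $ 2 \<Longrightarrow> b $ 2 = - a $ 1 \<Longrightarrow> siegel a (- 1 / \<tau>) = C * siegel b \<tau>" by blast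
  have 1: "siegel (vector [1/2, 0]) (- 1 / \<tau>) = C * siegel (vector [0, -1/2]) \<tau>"
    and 2: "siegel (vector [0, 1/2]) (- 1 / \<tau>) = C * siegel (vector [1/2, 0]) \<tau>"
    and 3: "siegel (vector [1/2, 1/2]) (- 1 / \<tau>) = C * siegel (vector [1/2, -1/2]) \<tau>"
    by (intro C; simp)+
  have s1: "(siegel (vector [0, -1/2]) \<tau>)\<^sup>2 = (siegel (vector [0, 1/2]) \<tau>)\<^sup>2"
    using siegel_square_shift[OF \<tau>, of "vector [0, -1/2]" "vector [0, 1/2]" 0 "-1"] by simp
  have "e2pi (- (1 / 2)) = -1" by (simp add: e2pi_minus e2pi_half)
  hence s2: "(siegel (vector [1/2, -1/2]) \<tau>)\<^sup>2 = - (siegel (vector [1/2, 1/2]) \<tau>)\<^sup>2"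
    using siegel_square_shift[OF \<tau>, of "vector [1/2, -1/2]" "vector [1/2, 1/2]" 0 "-1"]
    by (simp add: of_rat_minus of_rat_divide)
  define w where "w = 4 * e2pi (- 3 / 4)"
  have "w = C ^ 6 * - ((siegel (vector [1/2, 0]) \<tau>)\<^sup>2 * (siegel (vector [0, 1/2]) \<tau>)\<^sup>2 * (siegel (vector [1/2, 1/2]) \<tau>)\<^sup>2)"
  proof -
    have "w = (C * siegel (vector [0, -1/2]) \<tau>)\<^sup>2 * (C * siegel (vector [1/2, 0]) \<tau>)\<^sup>2 * (C * siegel (vector [1/2, -1/2]) \<tau>)\<^sup>2"
      using two_torsion_product[OF inversion_in_upper_half_plane[OF \<tau>]] unfolding w_def 1 2 3 by (rule sym)
    also have "(C * x)\<^sup>2 * (C * y)\<^sup>2 * (C * z)\<^sup>2 = C ^ 6 * (x\<^sup>2 * y\<^sup>2 * z\<^sup>2)" for x y z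
      by (simp add: power_mult_distrib mult_ac flip: power_add)
    finally show ?thesis unfolding s1 s2 by (simp only: mult_minus_left mult_minus_right mult_ac)
  qed
  hence "w = - (C ^ 6) * w" unfolding two_torsion_product[OF \<tau>] w_def[symmetric] by simp
  moreover have "w \<noteq> 0" by (simp add: w_def)
  ultimately have "C ^ 6 = -1" by (metis minus_equation_iff mult_cancel_right1)
  hence "(C ^ 6) ^ 2 = 1" by simp
  hence "C ^ 12 = 1" by (simp flip: power_mult)
  with C show ?thesis by blast
qed

text \<open>
  The point \<open>z\<close> is the same on both sides; only the term \<open>\<tau>/12\<close> in the exponent changes.
\<close>
lemma siegel_translation:
  fixes a b :: "rat ^ 2"
  assumes \<tau>: "\<tau> \<in> \<H>" and b: "b $ 1 = a $ 1" "b $ 2 = a $ 2 + of_int j * a $ 1"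
  shows "siegel a (\<tau> + of_int j) = e2pi (of_int j / 12) * siegel b \<tau>"
proof -
  define z where "z = of_rat (a $ 1) * (\<tau> + of_int j) + of_rat (a $ 2)"
  have z: "z = of_rat (b $ 1) * \<tau> + of_rat (b $ 2)"
    by (simp add: z_def b of_rat_add of_rat_mult algebra_simps)
  have "\<tau> + of_int j \<in> \<H>" using \<tau> by (simp add: upper_half_plane_def)
  hence "siegel a (\<tau> + of_int j) = - e2pi ((of_rat (a $ 1) * z - z + (\<tau> + of_int j) / 6) / 2) * theta_kernel (\<tau> + of_int j) z"
    using siegel_eq_theta_kernel z_def by blast
  also have "(of_rat (a $ 1) * z - z + (\<tau> + of_int j) / 6) / 2 = of_int j / 12 + (of_rat (b $ 1) * z - z + \<tau> / 6) / 2"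
    by (simp add: b add_divide_distrib)
  also have "theta_kernel (\<tau> + of_int j) z = theta_kernel \<tau> z" by (simp add: theta_kernel_def e2pi_add)
  finally show ?thesis unfolding siegel_eq_theta_kernel[OF \<tau> z] e2pi_add by simp
qed

definition moebius_mat :: "int ^ 2 ^ 2 \<Rightarrow> complex \<Rightarrow> complex" where
  "moebius_mat A \<tau> = moebius (of_int (A $ 1 $ 1)) (of_int (A $ 1 $ 2)) (of_int (A $ 2 $ 1)) (of_int (A $ 2 $ 2)) \<tau>"

abbreviation mat2 :: "'a \<Rightarrow> 'a \<Rightarrow> 'a \<Rightarrow> 'a \<Rightarrow> 'a::zero ^ 2 ^ 2" where
  "mat2 a b c d \<equiv> vector [vector [a, b], vector [c, d]]"

lemma mat2_eta: "A = mat2 (A $ 1 $ 1) (A $ 1 $ 2) (A $ 2 $ 1) (A $ 2 $ 2)"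
  by (simp add: vec_eq_iff forall_2)

lemma mat2_mult: "mat2 a b c d ** mat2 a' b' c' d' =
    mat2 (a * a' + b * c') (a * b' + b * d') (c * a' + d * c') (c * b' + d * d' :: 'a :: semiring_1)"
  by (simp add: vec_eq_iff forall_2 matrix_matrix_mult_def sum_2)

lemma mult_2x2_nth:
  fixes A B :: "'a::semiring_1 ^ 2 ^ 2"
  shows "(A ** B) $ i $ j = A $ i $ 1 * B $ 1 $ j + A $ i $ 2 * B $ 2 $ j"
  by (simp add: matrix_matrix_mult_def sum_2)

lemma vec_mult_2x2_nth:
  fixes x :: "'a::comm_semiring_1 ^ 2"
  shows "(x v* A) $ j = x $ 1 * A $ 1 $ j + x $ 2 * A $ 2 $ j"
  by (simp add: vector_matrix_mult_def sum_2 mult.commute)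

lemma map_matrix_of_int_mult:
  "map_matrix of_int (A ** B) = (map_matrix of_int A ** map_matrix of_int B :: 'a::ring_1 ^ 2 ^ 2)"
  for A B :: "int ^ 2 ^ 2"
  by (simp add: vec_eq_iff mult_2x2_nth)

lemma denominator_nonzero:
  fixes A :: "int ^ 2 ^ 2"
  assumes "\<tau> \<in> \<H>" "A \<in> SL2Z"
  shows "of_int (A $ 2 $ 1) * \<tau> + of_int (A $ 2 $ 2) \<noteq> 0"
proof
  assume 0: "of_int (A $ 2 $ 1) * \<tau> + of_int (A $ 2 $ 2) = 0"
  have "of_real (of_int (A $ 2 $ 1)) * \<tau> + of_real (of_int (A $ 2 $ 2)) = of_real 0 * \<tau> + of_real 0"
    using 0 by simp
  from lattice_coordinates_unique[OF assms(1) this] have "A $ 2 $ 1 = 0" "A $ 2 $ 2 = 0" by simp_all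
  with assms(2) show False by (simp add: SL2Z_def det_2)
qed

lemma SL2Z_mult: "A \<in> SL2Z \<Longrightarrow> B \<in> SL2Z \<Longrightarrow> A ** B \<in> SL2Z"
  by (simp add: SL2Z_def det_mul)

text \<open>
  The same \<open>C\<close> must serve all \<open>a\<close> simultaneously: it is its total power in a product over many
  \<open>a\<close> that is equal to 1.
\<close>
definition siegel_equivariant :: "int ^ 2 ^ 2 \<Rightarrow> bool" where
  "siegel_equivariant A \<longleftrightarrow> A \<in> SL2Z \<and> (\<forall>\<tau>\<in>\<H>. moebius_mat A \<tau> \<in> \<H> \<and> (\<exists>C. C ^ 12 = 1 \<and>
     (\<forall>a. siegel a (moebius_mat A \<tau>) = C * siegel (a v* map_matrix of_int A) \<tau>)))"

lemma siegel_equivariant_mult: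
  assumes A: "siegel_equivariant A" and B: "siegel_equivariant B"
  shows "siegel_equivariant (A ** B)"
  unfolding siegel_equivariant_def
proof (intro conjI ballI)
  show "A ** B \<in> SL2Z" using A B by (simp add: siegel_equivariant_def SL2Z_mult)
  fix \<tau> assume \<tau>: "\<tau> \<in> \<H>"
  have B\<tau>: "moebius_mat B \<tau> \<in> \<H>" using B \<tau> by (simp add: siegel_equivariant_def)
  have dB: "of_int (B $ 2 $ 1) * \<tau> + of_int (B $ 2 $ 2) \<noteq> 0"
    using B \<tau> denominator_nonzero by (simp add: siegel_equivariant_def)
  have dA: "of_int (A $ 2 $ 1) * moebius_mat B \<tau> + of_int (A $ 2 $ 2) \<noteq> 0"
    using A B\<tau> denominator_nonzero by (simp add: siegel_equivariant_def)
  have AB: "moebius_mat (A ** B) \<tau> = moebius_mat A (moebius_mat B \<tau>)"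
  proof -
    define N D where "N = of_int (B $ 1 $ 1) * \<tau> + of_int (B $ 1 $ 2)"
      and "D = of_int (B $ 2 $ 1) * \<tau> + of_int (B $ 2 $ 2)"
    have mB: "moebius_mat B \<tau> = N / D" by (simp add: moebius_mat_def moebius_def N_def D_def)
    have D: "D \<noteq> 0" using dB by (simp add: D_def)
    have "moebius_mat (A ** B) \<tau> = (of_int (A $ 1 $ 1) * N + of_int (A $ 1 $ 2) * D) / (of_int (A $ 2 $ 1) * N + of_int (A $ 2 $ 2) * D)"
      by (simp add: moebius_mat_def moebius_def mult_2x2_nth N_def D_def algebra_simps)
    also have "\<dots> = (of_int (A $ 1 $ 1) * (N / D) + of_int (A $ 1 $ 2)) / (of_int (A $ 2 $ 1) * (N / D) + of_int (A $ 2 $ 2))"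
    proof -
      have *: "x * (N / D) + y = (x * N + y * D) / D" for x y using D by (simp add: add_divide_distrib)
      have "u / v = (u / D) / (v / D)" for u v using D by simp
      thus ?thesis unfolding * .
    qed
    finally show ?thesis by (simp add: mB moebius_mat_def[of A] moebius_def)
  qed
  show "moebius_mat (A ** B) \<tau> \<in> \<H>" using A B\<tau> by (simp add: AB siegel_equivariant_def)
  obtain CA where CA: "CA ^ 12 = 1" "\<And>a. siegel a (moebius_mat A (moebius_mat B \<tau>)) = CA * siegel (a v* map_matrix of_int A) (moebius_mat B \<tau>)"
    using A B\<tau> unfolding siegel_equivariant_def by blast
  obtain CB where CB: "CB ^ 12 = 1" "\<And>a. siegel a (moebius_mat B \<tau>) = CB * siegel (a v* map_matrix of_int B) \<tau>"
    using B \<tau> unfolding siegel_equivariant_def by blast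
  have "siegel a (moebius_mat (A ** B) \<tau>) = (CA * CB) * siegel (a v* map_matrix of_int (A ** B)) \<tau>" for a
    by (simp add: AB CA CB vector_matrix_mul_assoc map_matrix_of_int_mult)
  moreover have "(CA * CB) ^ 12 = 1" by (simp add: power_mult_distrib CA CB)
  ultimately show "\<exists>C. C ^ 12 = 1 \<and> (\<forall>a. siegel a (moebius_mat (A ** B) \<tau>) = C * siegel (a v* map_matrix of_int (A ** B)) \<tau>)"
    by blast
qed

lemma siegel_equivariant_S: "siegel_equivariant (mat2 0 (-1) 1 0)"
  unfolding siegel_equivariant_def
proof (intro conjI ballI)
  fix \<tau> assume \<tau>: "\<tau> \<in> \<H>"
  have m: "moebius_mat (mat2 0 (-1) 1 0) \<tau> = - 1 / \<tau>" by (simp add: moebius_mat_def moebius_def)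
  show "moebius_mat (mat2 0 (-1) 1 0) \<tau> \<in> \<H>" using inversion_in_upper_half_plane[OF \<tau>] m by simp
  show "\<exists>C. C ^ 12 = 1 \<and> (\<forall>a. siegel a (moebius_mat (mat2 0 (-1) 1 0) \<tau>) = C * siegel (a v* map_matrix of_int (mat2 0 (-1) 1 0)) \<tau>)"
    using siegel_inversion[OF \<tau>] unfolding m by (force simp: vec_mult_2x2_nth)
qed (simp add: SL2Z_def det_2)

lemma siegel_equivariant_T: "siegel_equivariant (mat2 1 j 0 1)"
  unfolding siegel_equivariant_def
proof (intro conjI ballI)
  fix \<tau> assume \<tau>: "\<tau> \<in> \<H>"
  have m: "moebius_mat (mat2 1 j 0 1) \<tau> = \<tau> + of_int j" by (simp add: moebius_mat_def moebius_def)
  show "moebius_mat (mat2 1 j 0 1) \<tau> \<in> \<H>" using \<tau> m by (simp add: upper_half_plane_def)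
  have "siegel a (moebius_mat (mat2 1 j 0 1) \<tau>) = e2pi (of_int j / 12) * siegel (a v* map_matrix of_int (mat2 1 j 0 1)) \<tau>" for a
    unfolding m by (rule siegel_translation[OF \<tau>]) (simp_all add: vec_mult_2x2_nth)
  moreover have "e2pi (of_int j / 12) ^ 12 = 1" using e2pi_of_nat_mult[of 12 "of_int j / 12"] by simp
  ultimately show "\<exists>C. C ^ 12 = 1 \<and> (\<forall>a. siegel a (moebius_mat (mat2 1 j 0 1) \<tau>) = C * siegel (a v* map_matrix of_int (mat2 1 j 0 1)) \<tau>)"
    by blast
qed (simp add: SL2Z_def det_2)

text \<open>
  The modular group is generated by inversion and translations: the Euclidean algorithm reduces
  the lower left entry to 0.
\<close>
lemma siegel_equivariant_SL2Z: "A \<in> SL2Z \<Longrightarrow> siegel_equivariant A"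
proof (induction "nat \<bar>A $ 2 $ 1\<bar>" arbitrary: A rule: less_induct)
  case less
  define a b c d where abcd: "a = A $ 1 $ 1" "b = A $ 1 $ 2" "c = A $ 2 $ 1" "d = A $ 2 $ 2"
  have A: "A = mat2 a b c d" using mat2_eta[of A] by (simp add: abcd)
  have det: "a * d - b * c = 1" using less.prems by (simp add: SL2Z_def det_2 abcd)
  show ?case
  proof (cases "c = 0")
    case True
    hence "a * d = 1" using det by simp
    then consider "a = 1" "d = 1" | "a = -1" "d = -1" using zmult_eq_1_iff by auto
    thus ?thesis
    proof cases
      case 1
      thus ?thesis using siegel_equivariant_T[of b] A True by simp
    next
      case 2
      \<comment> \<open>the square of the inversion matrix is the negative identity\<close>
      have "A = mat2 0 (-1) 1 0 ** mat2 0 (-1) 1 0 ** mat2 1 (- b) 0 1"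
        by (simp add: A True 2 mat2_mult)
      thus ?thesis using siegel_equivariant_mult siegel_equivariant_S siegel_equivariant_T by simp
    qed
  next
    case False
    \<comment> \<open>one Euclidean step: a translation and an inversion replace the lower left entry \<open>c\<close> by \<open>a mod c\<close>\<close>
    define k where "k = a div c"
    define B where "B = mat2 (- c) (- d) (a - k * c) (b - k * d)"
    have "a - k * c = a mod c" by (simp add: k_def minus_div_mult_eq_mod)
    hence "\<bar>a - k * c\<bar> < \<bar>c\<bar>" using False abs_mod_less by simp
    moreover have "B \<in> SL2Z" using det by (simp add: SL2Z_def det_2 B_def algebra_simps)
    ultimately have "siegel_equivariant B" using less.hyps[of B] by (simp add: B_def abcd)
    moreover have "A = mat2 1 k 0 1 ** (mat2 0 (-1) 1 0 ** (mat2 0 (-1) 1 0 ** mat2 0 (-1) 1 0)) ** B"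
      by (simp add: A B_def mat2_mult)
    ultimately show ?thesis using siegel_equivariant_mult siegel_equivariant_S siegel_equivariant_T by simp
  qed
qed

section \<open>Cyclotomic fields of prime order and their automorphisms\<close>

definition cyclo_poly :: "nat \<Rightarrow> int poly" where
  "cyclo_poly p = (\<Sum>i<p. monom 1 i)"

lemma cyclo_poly_times_linear: "[:-1, 1:] * cyclo_poly p = monom 1 p - 1"
proof -
  have X: "monom (1::int) i = [:0, 1:] ^ i" for i
    by (simp add: monom_altdef)
  have "([:0, 1:] - 1) * (\<Sum>i<p. [:0, 1:] ^ i) = [:0, 1::int:] ^ p - 1"
    by (metis power_diff_1_eq)
  moreover have "[:0, 1::int:] - 1 = [:-1, 1:]"
    by (simp add: one_pCons)
  ultimately show ?thesis
    by (simp add: cyclo_poly_def X)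
qed

lemma lead_coeff_cyclo_poly:
  assumes p: "p > 0"
  shows "lead_coeff (cyclo_poly p) = 1"
proof -
  have c: "coeff (cyclo_poly p) i = (if i < p then 1 else 0)" for i
    by (simp add: cyclo_poly_def coeff_sum)
  have d: "degree (cyclo_poly p) = p - 1"
    using p by (intro antisym degree_le le_degree) (auto simp: c)
  show ?thesis using p by (simp add: d c)
qed

text \<open>
  Eisenstein's argument without a substitution: modulo \<open>p\<close> the polynomial times \<open>x - 1\<close> is
  \<open>(x - 1)\<^sup>p\<close>, so that both factors vanish at 1 modulo \<open>p\<close> if they are not constant.  Then \<open>p\<^sup>2\<close>
  would divide the value at 1, which is \<open>p\<close>.
\<close>
lemma no_proper_factor_cyclo_poly:
  fixes g h :: "int poly"
  assumes gh: "cyclo_poly CARD('p::prime_card) = g * h"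
  shows "degree g = 0 \<or> degree h = 0"
proof (rule ccontr)
  assume "\<not> ?thesis"
  hence dg: "degree g > 0" and dh: "degree h > 0" by auto
  let ?r = "of_int_poly :: int poly \<Rightarrow> 'p mod_ring poly"
  have p: "prime CARD('p)" by (rule prime_card)
  have ppos: "CARD('p) > 0" by simp
  have ch: "CHAR('p mod_ring poly) = CARD('p)"
    by simp
  have "(monom 1 1 + (-1)) ^ CARD('p) = (monom 1 1 :: 'p mod_ring poly) ^ CARD('p) + (-1) ^ CARD('p)"
    by (rule freshmans_dream) (use p in simp_all)
  \<comment> \<open>for the prime 2, this holds because \<open>-1 = 1\<close>\<close>
  moreover have "(-1 :: 'p mod_ring poly) ^ CARD('p) = -1"
  proof (cases "CARD('p) = 2")
    case True
    have "(2 :: 'p mod_ring poly) = of_nat CARD('p)" by (simp only: True) simp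
    also have "\<dots> = 0" by (metis ch of_nat_CHAR)
    finally show ?thesis using True
      by (simp add: eq_neg_iff_add_eq_0)
  next
    case False
    with p have "odd CARD('p)" using prime_odd_nat prime_ge_2_nat by (metis le_neq_implies_less)
    thus ?thesis by simp
  qed
  ultimately have fr: "[:-1, 1::'p mod_ring:] ^ CARD('p) = monom 1 CARD('p) - 1"
    by (simp add: monom_altdef one_pCons)
  have "?r ([:-1, 1:] * cyclo_poly CARD('p)) = monom 1 CARD('p) - 1"
    by (subst cyclo_poly_times_linear) (simp add: hom_distribs)
  hence prodeq: "[:-1, 1:] * (?r g * ?r h) = [:-1, 1:] ^ CARD('p)"
    by (simp add: gh fr hom_distribs)
  have "lead_coeff g * lead_coeff h = 1"
    using gh lead_coeff_cyclo_poly[OF ppos] by (metis lead_coeff_mult)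
  hence "(of_int (lead_coeff g) :: 'p mod_ring) * of_int (lead_coeff h) = 1"
    by (metis of_int_1 of_int_mult)
  hence "of_int (lead_coeff g) \<noteq> (0::'p mod_ring)" "of_int (lead_coeff h) \<noteq> (0::'p mod_ring)"
    by auto
  moreover have nz: "g \<noteq> 0" "h \<noteq> 0" using dg dh by auto
  ultimately have deg: "degree (?r g) > 0" "degree (?r h) > 0"
    using dg dh nz degree_map_poly[of "of_int :: int \<Rightarrow> 'p mod_ring" g]
      degree_map_poly[of "of_int :: int \<Rightarrow> 'p mod_ring" h] by simp_all
  have root: "poly (?r f) 1 = 0" if "degree (?r f) > 0" "?r f dvd [:-1, 1:] ^ CARD('p)" for f
  proof (rule ccontr)
    assume "poly (?r f) 1 \<noteq> 0"
    hence "\<not> [:-1, 1:] dvd ?r f" by (metis poly_eq_0_iff_dvd)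
    moreover have "prime_elem [:-1, 1::'p mod_ring:]"
      using prime_elem_linear_field_poly[of 1 "-1::'p mod_ring"] by simp
    ultimately have "coprime [:-1, 1:] (?r f)"
      by (simp add: prime_elem_imp_coprime)
    hence "coprime ([:-1, 1:] ^ CARD('p)) (?r f)"
      by simp
    with that(2) have "is_unit (?r f)"
      by (meson coprime_common_divisor dvd_refl)
    with that(1) show False
      by (simp add: poly_dvd_1)
  qed
  have "?r g dvd [:-1, 1:] ^ CARD('p)" "?r h dvd [:-1, 1:] ^ CARD('p)"
    unfolding prodeq[symmetric] by (rule dvd_mult, simp)+
  with deg root have "poly (?r g) 1 = 0" "poly (?r h) 1 = 0" by blast+
  moreover have ev: "poly (?r f) 1 = of_int (poly f 1)" for f
    by (metis of_int_1 of_int_hom.poly_map_poly)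
  ultimately have "(of_int (poly g 1) :: 'p mod_ring) = 0" "(of_int (poly h 1) :: 'p mod_ring) = 0"
    by simp_all
  hence "int CARD('p) dvd poly g 1" "int CARD('p) dvd poly h 1"
    using of_int_eq_0_iff_char_dvd[where ?'a = "'p mod_ring"] by auto
  hence "int CARD('p) * int CARD('p) dvd poly g 1 * poly h 1"
    by (rule mult_dvd_mono)
  also have "poly g 1 * poly h 1 = poly (cyclo_poly CARD('p)) 1" by (simp add: gh)
  also have "\<dots> = int CARD('p)"
    by (simp add: cyclo_poly_def poly_sum poly_monom)
  finally have "int CARD('p) dvd 1"
    by (metis dvd_times_left_cancel_iff mult.right_neutral of_nat_eq_0_iff ppos less_numeral_extra(3))
  thus False using prime_gt_1_nat[OF p] by (simp add: zdvd1_eq)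
qed

text \<open>
  Gauss's lemma, in the form in which it replaces division over the rationals.
\<close>
lemma primitive_dvd_smult_int:
  fixes f g :: "int poly"
  assumes "content g = 1" "g dvd smult c f" "c \<noteq> 0"
  shows "g dvd f"
proof -
  obtain q where q: "smult c f = g * q" using assms(2) by blast
  have "content q = \<bar>c\<bar> * content f"
    using arg_cong[OF q, of content] assms(1) by (simp add: content_mult)
  hence "[:c:] dvd q" by (simp add: const_poly_dvd_iff_dvd_content)
  then obtain q' where "q = [:c:] * q'" by blast
  hence "smult c f = smult c (g * q')" using q by simp
  hence "f = g * q'" using assms(3) by (metis smult_cancel)
  thus ?thesis by simp
qed

text \<open>
  Irreducibility over the rationals, expressed over the integers.  The primitive part of an element
  of minimal degree in the ideal generated by \<open>f\<close> and the cyclotomic polynomial divides both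
  generators, so that it is either constant or associated to the cyclotomic polynomial.
\<close>
lemma cyclo_poly_dvd_or_coprime:
  fixes f :: "int poly"
  shows "cyclo_poly CARD('p::prime_card) dvd f \<or>
    (\<exists>a b c. c \<noteq> 0 \<and> a * f + b * cyclo_poly CARD('p) = [:c:])"
proof -
  let ?\<Phi> = "cyclo_poly CARD('p)"
  define I where "I = {a * f + b * ?\<Phi> | a b. True}"
  have \<Phi>0: "?\<Phi> \<noteq> 0" using lead_coeff_cyclo_poly[of "CARD('p)"] by auto
  have I_diff: "smult k x - q * y \<in> I" if xy: "x \<in> I" "y \<in> I" for x y q k
  proof -
    obtain a b a' b' where "x = a * f + b * ?\<Phi>" "y = a' * f + b' * ?\<Phi>"
      using xy unfolding I_def by blast
    hence "smult k x - q * y = (smult k a - q * a') * f + (smult k b - q * b') * ?\<Phi>"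
      by (simp add: algebra_simps smult_add_right)
    thus ?thesis unfolding I_def by blast
  qed
  have \<Phi>I: "?\<Phi> \<in> I" and fI: "f \<in> I"
    unfolding I_def by (force intro: exI[of _ 0] exI[of _ 1])+
  obtain r where r: "r \<in> I" "r \<noteq> 0" and rmin: "\<And>s. s \<in> I \<Longrightarrow> s \<noteq> 0 \<Longrightarrow> degree r \<le> degree s"
    using arg_min_nat_lemma[of "\<lambda>s. s \<in> I \<and> s \<noteq> 0" ?\<Phi> degree] \<Phi>I \<Phi>0 by blast
  define g where "g = primitive_part r"
  have g: "content g = 1" using r by (simp add: g_def)
  have gd: "degree g = degree r" by (simp add: g_def)
  have dvd: "g dvd x" if x: "x \<in> I" for x
  proof -
    obtain a q where aq: "a \<noteq> 0" "smult a x = r * q + pseudo_mod x r"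
      using pseudo_mod(1)[OF r(2), of x] by blast
    have "pseudo_mod x r = smult a x - q * r" using aq by (simp add: mult.commute)
    hence "pseudo_mod x r \<in> I" using I_diff[OF x r(1)] by simp
    hence "pseudo_mod x r = 0"
      using rmin pseudo_mod(2)[OF r(2), of x] by (meson leD)
    hence "r dvd smult a x" using aq by simp
    moreover have "g dvd r" unfolding g_def
      by (metis content_times_primitive_part dvd_refl dvd_smult)
    ultimately show ?thesis
      using primitive_dvd_smult_int[OF g _ aq(1)] dvd_trans by blast
  qed
  obtain h where h: "?\<Phi> = g * h" using dvd[OF \<Phi>I] by blast
  show ?thesis
  proof (cases "degree g = 0")
    case True
    then obtain c where "r = [:c:]" using gd by (metis degree_eq_zeroE)
    with r obtain a b where "c \<noteq> 0" "a * f + b * ?\<Phi> = [:c:]" unfolding I_def by auto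
    thus ?thesis by blast
  next
    case False
    hence "degree h = 0" using no_proper_factor_cyclo_poly[OF h] by simp
    then obtain c where c: "h = [:c:]" by (metis degree_eq_zeroE)
    have "lead_coeff g * lead_coeff h = 1"
      using h lead_coeff_cyclo_poly[of "CARD('p)"] by (metis lead_coeff_mult zero_less_card_finite)
    hence "is_unit c" using c by (metis degree_pCons_0 dvdI coeff_pCons_0 mult.commute)
    hence "is_unit h" using c by (simp add: is_unit_const_poly_iff)
    hence "?\<Phi> dvd g" using h by (simp add: mult_unit_dvd_iff)
    thus ?thesis using dvd[OF fI] dvd_trans by blast
  qed
qed

abbreviation ev :: "int poly \<Rightarrow> complex \<Rightarrow> complex" where
  "ev f z \<equiv> poly (of_int_poly f) z"

lemma ev_cyclo_poly:
  assumes "z ^ p = 1" "z \<noteq> 1"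
  shows "ev (cyclo_poly p) z = 0"
proof -
  have "ev ([:-1, 1:] * cyclo_poly p) z = z ^ p - 1"
    by (subst cyclo_poly_times_linear) (simp add: hom_distribs poly_monom)
  hence "(z - 1) * ev (cyclo_poly p) z = 0"
    using assms by (simp add: hom_distribs)
  thus ?thesis using assms by simp
qed

lemma ev_eq_0_iff_cyclo_poly_dvd:
  assumes "z ^ CARD('p::prime_card) = 1" "z \<noteq> 1"
  shows "ev f z = 0 \<longleftrightarrow> cyclo_poly CARD('p) dvd f"
proof
  assume "cyclo_poly CARD('p) dvd f"
  then obtain g where "f = cyclo_poly CARD('p) * g" by blast
  thus "ev f z = 0" using ev_cyclo_poly[OF assms] by (simp add: hom_distribs)
next
  assume f: "ev f z = 0"
  show "cyclo_poly CARD('p) dvd f"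
  proof (rule ccontr)
    assume "\<not> ?thesis"
    then obtain a b c where c: "c \<noteq> 0" "a * f + b * cyclo_poly CARD('p) = [:c:]"
      using cyclo_poly_dvd_or_coprime[where ?'p = 'p, of f] by blast
    have "ev (a * f + b * cyclo_poly CARD('p)) z = 0"
      using f ev_cyclo_poly[OF assms] by (simp add: hom_distribs)
    thus False using c by simp
  qed
qed

text \<open>
  Fractions with an integral denominator allow all computations to be made with integral
  polynomials.
\<close>
definition cyclotomic_field :: "complex \<Rightarrow> complex set" where
  "cyclotomic_field z = {ev f z / of_int c | f c. c \<noteq> 0}"

lemma cyclotomic_fieldE:
  assumes "x \<in> cyclotomic_field z"
  obtains f c where "c \<noteq> 0" "x = ev f z / of_int c"
  using assms unfolding cyclotomic_field_def by blast

lemma cyclotomic_fieldI: "c \<noteq> 0 \<Longrightarrow> ev f z / of_int c \<in> cyclotomic_field z"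
  unfolding cyclotomic_field_def by blast

lemma cyclotomic_field_inverse:
  assumes z: "z ^ CARD('p::prime_card) = 1" "z \<noteq> 1" and x: "x \<in> cyclotomic_field z" "x \<noteq> 0"
  shows "inverse x \<in> cyclotomic_field z"
proof -
  obtain f c where f: "c \<noteq> 0" "x = ev f z / of_int c" using x(1) by (rule cyclotomic_fieldE)
  hence "\<not> cyclo_poly CARD('p) dvd f" using ev_eq_0_iff_cyclo_poly_dvd[OF z, of f] x(2) by auto
  then obtain a b k where k: "k \<noteq> 0" "a * f + b * cyclo_poly CARD('p) = [:k:]"
    using cyclo_poly_dvd_or_coprime[where ?'p = 'p, of f] by blast
  have "ev (a * f + b * cyclo_poly CARD('p)) z = ev a z * ev f z"
    using ev_cyclo_poly[OF z] by (simp add: hom_distribs)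
  hence "ev a z * ev f z = of_int k" using k by simp
  hence "x * (of_int c * ev a z) = of_int k"
    using f by (simp add: mult_ac)
  hence "inverse x = ev (smult c a) z / of_int k"
    using k(1) x(2) by (simp add: field_simps hom_distribs)
  thus ?thesis using k(1) cyclotomic_fieldI by metis
qed

lemma cyclotomic_field_add: "x \<in> cyclotomic_field z \<Longrightarrow> y \<in> cyclotomic_field z \<Longrightarrow> x + y \<in> cyclotomic_field z"
  and cyclotomic_field_mult: "x \<in> cyclotomic_field z \<Longrightarrow> y \<in> cyclotomic_field z \<Longrightarrow> x * y \<in> cyclotomic_field z"
proof -
  assume "x \<in> cyclotomic_field z" "y \<in> cyclotomic_field z"
  then obtain f c g d where *: "c \<noteq> 0" "x = ev f z / of_int c" "d \<noteq> 0" "y = ev g z / of_int d"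
    by (metis cyclotomic_fieldE)
  have "x + y = ev (smult d f + smult c g) z / of_int (c * d)"
    using * by (simp add: field_simps hom_distribs)
  thus "x + y \<in> cyclotomic_field z"
    using * by (metis cyclotomic_fieldI mult_eq_0_iff)
  have "x * y = ev (f * g) z / of_int (c * d)"
    using * by (simp add: field_simps hom_distribs)
  thus "x * y \<in> cyclotomic_field z"
    using * by (metis cyclotomic_fieldI mult_eq_0_iff)
qed

lemma ev_in_cyclotomic_field: "ev f z \<in> cyclotomic_field z"
  using cyclotomic_fieldI[of 1 f z] by simp

lemma of_int_in_cyclotomic_field: "of_int n \<in> cyclotomic_field z"
proof -
  have "ev [:n:] z = of_int n" by (simp add: hom_distribs)
  thus ?thesis by (metis ev_in_cyclotomic_field)
qed

lemma cyclotomic_field_self: "z \<in> cyclotomic_field z"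
  using ev_in_cyclotomic_field[of "[:0, 1:]" z] by simp

lemma complex_ring_of_type_simps:
  "carrier (ring_of_type_algebra :: complex ring) = UNIV"
  "x \<otimes>\<^bsub>(ring_of_type_algebra :: complex ring)\<^esub> y = x * y"
  "x \<oplus>\<^bsub>(ring_of_type_algebra :: complex ring)\<^esub> y = x + y"
  "\<one>\<^bsub>(ring_of_type_algebra :: complex ring)\<^esub> = 1"
  "\<zero>\<^bsub>(ring_of_type_algebra :: complex ring)\<^esub> = 0"
  by (simp_all add: ring_of_type_algebra_def)

lemma complex_ring_of_type_inv:
  "\<ominus>\<^bsub>(ring_of_type_algebra :: complex ring)\<^esub> x = - x"
  "x \<noteq> 0 \<Longrightarrow> inv\<^bsub>(ring_of_type_algebra :: complex ring)\<^esub> x = inverse x"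
proof -
  interpret R: field "ring_of_type_algebra :: complex ring" by (rule field_from_type_algebra)
  show "\<ominus>\<^bsub>(ring_of_type_algebra :: complex ring)\<^esub> x = - x"
    by (rule R.minus_equality) (simp_all add: complex_ring_of_type_simps)
  assume "x \<noteq> 0"
  thus "inv\<^bsub>(ring_of_type_algebra :: complex ring)\<^esub> x = inverse x"
    by (intro R.comm_inv_char) (simp_all add: complex_ring_of_type_simps)
qed

lemma Q_adjoin_closed:
  shows Q_adjoin_self: "\<zeta> \<in> Q_adjoin \<zeta>"
    and Q_adjoin_1: "1 \<in> Q_adjoin \<zeta>"
    and Q_adjoin_0: "0 \<in> Q_adjoin \<zeta>"
    and Q_adjoin_add: "x \<in> Q_adjoin \<zeta> \<Longrightarrow> y \<in> Q_adjoin \<zeta> \<Longrightarrow> x + y \<in> Q_adjoin \<zeta>"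
    and Q_adjoin_mult: "x \<in> Q_adjoin \<zeta> \<Longrightarrow> y \<in> Q_adjoin \<zeta> \<Longrightarrow> x * y \<in> Q_adjoin \<zeta>"
    and Q_adjoin_uminus: "x \<in> Q_adjoin \<zeta> \<Longrightarrow> - x \<in> Q_adjoin \<zeta>"
    and Q_adjoin_inverse: "x \<in> Q_adjoin \<zeta> \<Longrightarrow> inverse x \<in> Q_adjoin \<zeta>"
proof -
  note simps = complex_ring_of_type_simps complex_ring_of_type_inv
  let ?F = "generate_field (ring_of_type_algebra :: complex ring) {\<zeta>}"
  have add: "x + y \<in> ?F" if "x \<in> ?F" "y \<in> ?F" for x y
    using generate_field.eng_add[OF that] by (simp add: simps)
  have mult: "x * y \<in> ?F" if "x \<in> ?F" "y \<in> ?F" for x y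
    using generate_field.eng_mult[OF that] by (simp add: simps)
  have uminus: "- x \<in> ?F" if "x \<in> ?F" for x
    using generate_field.a_inv[OF that] by (simp add: simps)
  have one: "1 \<in> ?F"
    using generate_field.one[of "ring_of_type_algebra :: complex ring" "{\<zeta>}"] by (simp add: simps)
  have zero: "0 \<in> ?F" using add[OF one uminus[OF one]] by simp
  have inv: "inverse x \<in> ?F" if "x \<in> ?F" for x
    using generate_field.m_inv[OF that] zero by (cases "x = 0") (simp_all add: simps)
  have self: "\<zeta> \<in> ?F" by (rule generate_field.incl) simp
  show "\<zeta> \<in> Q_adjoin \<zeta>" "1 \<in> Q_adjoin \<zeta>" "0 \<in> Q_adjoin \<zeta>"
    "x \<in> Q_adjoin \<zeta> \<Longrightarrow> y \<in> Q_adjoin \<zeta> \<Longrightarrow> x + y \<in> Q_adjoin \<zeta>"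
    "x \<in> Q_adjoin \<zeta> \<Longrightarrow> y \<in> Q_adjoin \<zeta> \<Longrightarrow> x * y \<in> Q_adjoin \<zeta>"
    "x \<in> Q_adjoin \<zeta> \<Longrightarrow> - x \<in> Q_adjoin \<zeta>" "x \<in> Q_adjoin \<zeta> \<Longrightarrow> inverse x \<in> Q_adjoin \<zeta>"
    unfolding Q_adjoin_def by (rule self one zero add mult uminus inv; assumption)+
qed

lemma Q_adjoin_eq_cyclotomic_field:
  assumes z: "z ^ CARD('p::prime_card) = 1" "z \<noteq> 1"
  shows "Q_adjoin z = cyclotomic_field z"
proof
  let ?R = "ring_of_type_algebra :: complex ring"
  note simps = complex_ring_of_type_simps complex_ring_of_type_inv
  show "Q_adjoin z \<subseteq> cyclotomic_field z"
  proof
    fix x assume "x \<in> Q_adjoin z"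
    hence "x \<in> generate_field ?R {z}" by (simp add: Q_adjoin_def)
    thus "x \<in> cyclotomic_field z"
    proof induction
      case one
      show ?case using of_int_in_cyclotomic_field[of 1] by (simp add: simps)
    next
      case (a_inv h)
      show ?case using cyclotomic_field_mult[OF of_int_in_cyclotomic_field[of "-1"] a_inv.IH]
        by (simp add: simps)
    next
      case (m_inv h)
      show ?case using cyclotomic_field_inverse[OF z m_inv.IH] m_inv.hyps by (simp add: simps)
    qed (simp_all add: simps cyclotomic_field_self cyclotomic_field_add cyclotomic_field_mult)
  qed
  have nat: "of_nat n \<in> Q_adjoin z" for n
    by (induction n) (auto intro: Q_adjoin_0 Q_adjoin_1 Q_adjoin_add)
  have int: "of_int n \<in> Q_adjoin z" for n
    by (cases n) (use nat Q_adjoin_uminus in \<open>auto simp del: of_nat_Suc\<close>)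
  have ev: "ev f z \<in> Q_adjoin z" for f
    by (induction f) (auto simp: Q_adjoin_0 hom_distribs intro!: Q_adjoin_add Q_adjoin_mult int Q_adjoin_self)
  show "cyclotomic_field z \<subseteq> Q_adjoin z"
    unfolding cyclotomic_field_def
    by (auto simp: divide_inverse intro!: Q_adjoin_mult ev Q_adjoin_inverse int)
qed

text \<open>
  If \<open>w = z\<^sup>d\<close>, then an integral polynomial vanishes at \<open>z\<close> if and only if it vanishes at \<open>w\<close>, because
  both conditions mean divisibility by the cyclotomic polynomial.  Hence \<open>f(z)/c \<mapsto> f(w)/c\<close> is well
  defined and injective; it is surjective because \<open>z\<close> is in turn a power of \<open>w\<close>.
\<close>
lemma cyclotomic_aut_exists:
  fixes d :: "nat"
  assumes z: "z ^ CARD('p::prime_card) = 1" "z \<noteq> 1" and d: "coprime d CARD('p)"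
  shows "\<exists>s. s \<in> ring_iso ((ring_of_type_algebra :: complex ring)\<lparr>carrier := Q_adjoin z\<rparr>)
                          ((ring_of_type_algebra :: complex ring)\<lparr>carrier := Q_adjoin z\<rparr>) \<and> s z = z ^ d"
proof -
  define p where "p = CARD('p)"
  note simps = complex_ring_of_type_simps complex_ring_of_type_inv
  obtain e where e: "[d * e = 1] (mod p)"
    using d unfolding p_def by (metis cong_solve_coprime_nat One_nat_def)
  define w where "w = z ^ d"
  have zmod: "z ^ i = z ^ j" if "[i = j] (mod p)" for i j
  proof -
    have "z ^ i = z ^ (i mod p)" for i
      by (metis z(1) p_def mult.left_neutral power_add power_mult power_one mult_div_mod_eq)
    thus ?thesis using that by (metis cong_def)
  qed
  have we: "w ^ e = z" unfolding w_def power_mult[symmetric] using zmod[OF e] by simp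
  have w: "w ^ p = 1" "w \<noteq> 1"
  proof -
    have "w ^ p = (z ^ p) ^ d" by (simp add: w_def mult.commute flip: power_mult)
    thus "w ^ p = 1" using z by (simp add: p_def)
    show "w \<noteq> 1" using we z(2) by auto
  qed
  define rel where "rel x y \<longleftrightarrow> (\<exists>f c. c \<noteq> 0 \<and> x = ev f z / of_int c \<and> y = ev f w / of_int c)" for x y
  have rel_unique: "(x = x') \<longleftrightarrow> (y = y')" if xy: "rel x y" "rel x' y'" for x y x' y'
  proof -
    obtain f c where f: "c \<noteq> 0" "x = ev f z / of_int c" "y = ev f w / of_int c"
      using xy(1) unfolding rel_def by blast
    obtain f' c' where f': "c' \<noteq> 0" "x' = ev f' z / of_int c'" "y' = ev f' w / of_int c'"
      using xy(2) unfolding rel_def by blast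
    note * = f f'
    have "x = x' \<longleftrightarrow> ev (smult c' f - smult c f') z = 0"
      using *(1,4) unfolding *(2,5) by (auto simp: field_simps hom_distribs)
    also have "\<dots> \<longleftrightarrow> ev (smult c' f - smult c f') w = 0"
      using ev_eq_0_iff_cyclo_poly_dvd[where ?'p='p, of z] ev_eq_0_iff_cyclo_poly_dvd[where ?'p='p, of w] z w
      by (simp add: p_def)
    also have "\<dots> \<longleftrightarrow> y = y'"
      using *(1,4) unfolding *(3,6) by (auto simp: field_simps hom_distribs)
    finally show ?thesis .
  qed
  have rel_ex: "\<exists>y. rel x y" if "x \<in> cyclotomic_field z" for x
    using that unfolding rel_def cyclotomic_field_def by blast
  define s where "s x = (THE y. rel x y)" for x
  have s: "rel x (s x)" if "x \<in> cyclotomic_field z" for x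
    using rel_ex[OF that] rel_unique unfolding s_def by (metis the_equality)
  have s_eq: "s x = y" if "rel x y" for x y
    using that rel_unique unfolding s_def by (metis the_equality)
  have ww: "ev f w \<in> cyclotomic_field z" for f
  proof -
    have "ev f w = ev (pcompose f (monom 1 d)) z"
      by (simp add: w_def of_int_hom.map_poly_pcompose poly_pcompose poly_monom hom_distribs)
    thus ?thesis using ev_in_cyclotomic_field by metis
  qed
  have s_in: "s x \<in> cyclotomic_field z" if x: "x \<in> cyclotomic_field z" for x
  proof -
    obtain f c where "c \<noteq> 0" "s x = ev f w / of_int c"
      using s[OF x] unfolding rel_def by blast
    moreover have "1 / of_int c \<in> cyclotomic_field z"
      using cyclotomic_fieldI[of c 1 z] \<open>c \<noteq> 0\<close> by simp
    ultimately show ?thesis using cyclotomic_field_mult[OF ww[of f], of "1 / of_int c"] by simp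
  qed
  have rel_ops: "rel (x + x') (y + y')" "rel (x * x') (y * y')" if xy: "rel x y" "rel x' y'" for x x' y y'
  proof -
    obtain f c where f: "c \<noteq> 0" "x = ev f z / of_int c" "y = ev f w / of_int c"
      using xy(1) unfolding rel_def by blast
    obtain f' c' where f': "c' \<noteq> 0" "x' = ev f' z / of_int c'" "y' = ev f' w / of_int c'"
      using xy(2) unfolding rel_def by blast
    note * = f f'
    show "rel (x + x') (y + y')" unfolding rel_def
      by (rule exI[of _ "smult c' f + smult c f'"], rule exI[of _ "c * c'"])
         (use * in \<open>simp add: field_simps hom_distribs\<close>)
    show "rel (x * x') (y * y')" unfolding rel_def
      by (rule exI[of _ "f * f'"], rule exI[of _ "c * c'"])
         (use * in \<open>simp add: field_simps hom_distribs\<close>)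
  qed
  have rel1: "rel 1 1" unfolding rel_def by (rule exI[of _ 1], rule exI[of _ 1]) simp
  have relz: "rel z w" unfolding rel_def by (rule exI[of _ "[:0,1:]"], rule exI[of _ 1]) simp
  have inj: "inj_on s (cyclotomic_field z)"
    by (rule inj_onI) (metis rel_unique s)
  have surj: "y \<in> s ` cyclotomic_field z" if y: "y \<in> cyclotomic_field z" for y
  proof -
    obtain f c where f: "c \<noteq> 0" "y = ev f z / of_int c" using y by (rule cyclotomic_fieldE)
    define g where "g = pcompose f (monom 1 e)"
    have "ev g w = ev f z"
      by (simp add: g_def of_int_hom.map_poly_pcompose poly_pcompose poly_monom hom_distribs we)
    hence "rel (ev g z / of_int c) y" using f unfolding rel_def by (metis)
    hence "s (ev g z / of_int c) = y" by (rule s_eq)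
    thus ?thesis using cyclotomic_fieldI[OF f(1)] by blast
  qed
  have "s \<in> ring_iso ((ring_of_type_algebra :: complex ring)\<lparr>carrier := Q_adjoin z\<rparr>)
                          ((ring_of_type_algebra :: complex ring)\<lparr>carrier := Q_adjoin z\<rparr>)"
    unfolding Q_adjoin_eq_cyclotomic_field[OF z]
  proof (rule ring_iso_memI)
    have "s ` cyclotomic_field z = cyclotomic_field z"
      using s_in surj by (intro antisym subsetI) auto
    with inj have "bij_betw s (cyclotomic_field z) (cyclotomic_field z)"
      by (simp add: bij_betw_def)
    thus "bij_betw s (carrier ((ring_of_type_algebra :: complex ring)\<lparr>carrier := cyclotomic_field z\<rparr>))
      (carrier ((ring_of_type_algebra :: complex ring)\<lparr>carrier := cyclotomic_field z\<rparr>))" by simp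
  qed (auto simp: simps intro!: s_in s_eq rel1 rel_ops s)
  thus ?thesis using s_eq[OF relz] unfolding w_def by blast
qed

section \<open>Expansions with coefficients in a subfield\<close>

text \<open>
  A subfield \<open>K\<close> of the complex numbers and a field homomorphism on it; the values of \<open>s\<close> outside
  \<open>K\<close> are arbitrary.
\<close>
locale subfield_hom =
  fixes K :: "complex set" and s :: "complex \<Rightarrow> complex"
  assumes one_closed: "1 \<in> K"
    and diff_closed: "x \<in> K \<Longrightarrow> y \<in> K \<Longrightarrow> x - y \<in> K"
    and mult_closed: "x \<in> K \<Longrightarrow> y \<in> K \<Longrightarrow> x * y \<in> K"
    and inverse_closed: "x \<in> K \<Longrightarrow> inverse x \<in> K"
    and hom_one: "s 1 = 1"
    and hom_add: "x \<in> K \<Longrightarrow> y \<in> K \<Longrightarrow> s (x + y) = s x + s y"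
    and hom_mult: "x \<in> K \<Longrightarrow> y \<in> K \<Longrightarrow> s (x * y) = s x * s y"
begin

lemma zero_closed: "0 \<in> K" using diff_closed[OF one_closed one_closed] by simp
lemma uminus_closed: "x \<in> K \<Longrightarrow> - x \<in> K" using diff_closed[OF zero_closed] by fastforce
lemma add_closed: "x \<in> K \<Longrightarrow> y \<in> K \<Longrightarrow> x + y \<in> K"
  using diff_closed[of x "- y"] uminus_closed by simp
lemma sum_closed: "(\<And>i. i \<in> I \<Longrightarrow> f i \<in> K) \<Longrightarrow> sum f I \<in> K"
  by (induction I rule: infinite_finite_induct) (auto intro: add_closed zero_closed)

lemma hom_zero: "s 0 = 0" using hom_add[OF zero_closed zero_closed] by simp
lemma hom_uminus: "x \<in> K \<Longrightarrow> s (- x) = - s x"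
  using hom_add[of x "- x"] uminus_closed hom_zero by (simp add: eq_neg_iff_add_eq_0 add.commute)
lemma hom_diff: "x \<in> K \<Longrightarrow> y \<in> K \<Longrightarrow> s (x - y) = s x - s y"
  using hom_add[of x "- y"] uminus_closed hom_uminus by simp
lemma hom_sum: "(\<And>i. i \<in> I \<Longrightarrow> f i \<in> K) \<Longrightarrow> s (sum f I) = (\<Sum>i\<in>I. s (f i))"
  by (induction I rule: infinite_finite_induct) (auto simp: hom_zero hom_add sum_closed)
lemma hom_inverse: "x \<in> K \<Longrightarrow> s (inverse x) = inverse (s x)"
proof (cases "x = 0")
  case False
  assume "x \<in> K"
  hence "s x * s (inverse x) = 1" using hom_mult[of x "inverse x"] inverse_closed False hom_one by simp
  thus ?thesis by (metis inverse_unique)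
qed (simp add: hom_zero)
lemma power_closed: "x \<in> K \<Longrightarrow> x ^ n \<in> K"
  by (induction n) (auto intro: one_closed mult_closed)
lemma hom_power: "x \<in> K \<Longrightarrow> s (x ^ n) = s x ^ n"
  by (induction n) (auto simp: hom_one hom_mult power_closed)
lemma power_int_closed: "x \<in> K \<Longrightarrow> x powi n \<in> K"
  by (simp add: power_int_def power_closed inverse_closed)
lemma hom_power_int: "x \<in> K \<Longrightarrow> s (x powi n) = s x powi n"
  by (simp add: power_int_def hom_power hom_inverse inverse_closed)

text \<open>
  The relation is closed under the operations that build the expansion of a product of
  Siegel functions; it records at the same time that the coefficients lie in \<open>K\<close> and what the
  homomorphism does to them.
\<close>
definition conj_fps :: "complex fps \<Rightarrow> complex fps \<Rightarrow> bool" where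
  "conj_fps F F' \<longleftrightarrow> (\<forall>n. fps_nth F n \<in> K \<and> fps_nth F' n = s (fps_nth F n))"

lemma conj_fps_const: "c \<in> K \<Longrightarrow> conj_fps (fps_const c) (fps_const (s c))"
  by (simp add: conj_fps_def zero_closed hom_zero)

lemma conj_fps_one: "conj_fps 1 1"
  using conj_fps_const[OF one_closed] by (simp add: hom_one)

lemma conj_fps_mult: "conj_fps F F' \<Longrightarrow> conj_fps G G' \<Longrightarrow> conj_fps (F * G) (F' * G')"
  by (auto simp: conj_fps_def fps_mult_nth hom_sum hom_mult mult_closed intro!: sum_closed sum.cong)

lemma conj_fps_diff: "conj_fps F F' \<Longrightarrow> conj_fps G G' \<Longrightarrow> conj_fps (F - G) (F' - G')"
  by (simp add: conj_fps_def hom_diff diff_closed)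

lemma conj_fps_X_power: "conj_fps (fps_X ^ n) (fps_X ^ n)"
  by (simp add: conj_fps_def one_closed zero_closed hom_one hom_zero)

lemma conj_fps_prod: "(\<And>i. i \<in> I \<Longrightarrow> conj_fps (F i) (F' i)) \<Longrightarrow> conj_fps (\<Prod>i\<in>I. F i) (\<Prod>i\<in>I. F' i)"
  by (induction I rule: infinite_finite_induct) (auto intro: conj_fps_one conj_fps_mult)

lemma conj_fps_power: "conj_fps F F' \<Longrightarrow> conj_fps (F ^ n) (F' ^ n)"
  by (induction n) (auto intro: conj_fps_one conj_fps_mult)

text \<open>
  The coefficients of the inverse lie in \<open>K\<close> by recursion.  That the homomorphism commutes with
  inversion then follows from the multiplicativity of the relation and the uniqueness of inverses.
\<close>
lemma conj_fps_inverse: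
  assumes F: "conj_fps F F'" and F0: "fps_nth F 0 \<noteq> 0"
  shows "conj_fps (inverse F) (inverse F')"
proof -
  define G where "G = inverse F"
  have FG: "F * G = 1" using F0 unfolding G_def by (metis inverse_mult_eq_1 mult.commute)
  have F_nth: "fps_nth F n \<in> K" for n using F by (simp add: conj_fps_def)
  have G_nth: "fps_nth G n \<in> K" for n
  proof (induction n rule: less_induct)
    case (less n)
    show ?case
    proof (cases n)
      case 0
      have "fps_nth G 0 = inverse (fps_nth F 0)" by (simp add: G_def)
      thus ?thesis using 0 inverse_closed[OF F_nth] by simp
    next
      case (Suc k)
      have "0 = fps_nth (F * G) n" by (simp add: FG Suc)
      also have "\<dots> = fps_nth F 0 * fps_nth G n + (\<Sum>i=1..n. fps_nth F i * fps_nth G (n - i))"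
        unfolding fps_mult_nth by (subst sum.atLeast_Suc_atMost) auto
      finally have "fps_nth G n = - (\<Sum>i=1..n. fps_nth F i * fps_nth G (n - i)) * inverse (fps_nth F 0)"
        using F0 by (simp add: field_simps eq_neg_iff_add_eq_0)
      moreover have "(\<Sum>i=1..n. fps_nth F i * fps_nth G (n - i)) \<in> K"
        by (intro sum_closed mult_closed F_nth less.IH) auto
      ultimately show ?thesis
        by (simp add: mult_closed uminus_closed inverse_closed F_nth)
    qed
  qed
  define G' where "G' = Abs_fps (\<lambda>n. s (fps_nth G n))"
  have GG': "conj_fps G G'" by (simp add: conj_fps_def G'_def G_nth)
  have "conj_fps 1 (F' * G')" using conj_fps_mult[OF F GG'] by (simp add: FG)
  hence "F' * G' = 1" using conj_fps_one by (simp add: conj_fps_def fps_eq_iff)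
  hence "G' = inverse F'" by (metis fps_inverse_unique)
  with GG' show ?thesis by (simp add: G_def)
qed

lemma conj_fps_power_int:
  assumes "conj_fps F F'" "fps_nth F 0 \<noteq> 0"
  shows "conj_fps (F powi n) (F' powi n)"
  using assms by (simp add: power_int_def conj_fps_power conj_fps_inverse)

end

definition qpoch_fps_partial :: "nat \<Rightarrow> nat \<Rightarrow> complex \<Rightarrow> nat \<Rightarrow> complex fps" where
  "qpoch_fps_partial p r c N = (\<Prod>n<N. 1 - fps_const c * fps_X ^ (r + p * n))"

text \<open>
  The expansion of \<open>(c x\<^sup>r; x\<^sup>p)\<^sub>\<infinity>\<close> in \<open>x\<close>.  The factors with \<open>n > k\<close> do not affect the coefficient of
  \<open>x\<^sup>k\<close>, so that it can be read off from a partial product.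
\<close>
definition qpoch_fps :: "nat \<Rightarrow> nat \<Rightarrow> complex \<Rightarrow> complex fps" where
  "qpoch_fps p r c = Abs_fps (\<lambda>k. fps_nth (qpoch_fps_partial p r c (Suc k)) k)"

lemma qpoch_fps_partial_stable:
  assumes "p > 0" "N > k"
  shows "fps_nth (qpoch_fps_partial p r c N) k = fps_nth (qpoch_fps p r c) k"
proof -
  have step: "fps_nth (qpoch_fps_partial p r c (Suc M)) k = fps_nth (qpoch_fps_partial p r c M) k" if "k < M" for M
  proof -
    have "M \<le> p * M" using assms(1) by simp
    hence "k < r + p * M" using that by linarith
    moreover have "qpoch_fps_partial p r c (Suc M) = qpoch_fps_partial p r c M -
        fps_X ^ (r + p * M) * (qpoch_fps_partial p r c M * fps_const c)"
      by (simp add: qpoch_fps_partial_def algebra_simps)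
    ultimately show ?thesis by (simp add: fps_X_power_mult_nth)
  qed
  have "fps_nth (qpoch_fps_partial p r c (Suc k + j)) k = fps_nth (qpoch_fps_partial p r c (Suc k)) k" for j
    by (induction j) (simp_all add: step)
  from this[of "N - Suc k"] have "fps_nth (qpoch_fps_partial p r c N) k = fps_nth (qpoch_fps_partial p r c (Suc k)) k"
    using assms(2) by simp
  thus ?thesis by (simp add: qpoch_fps_def)
qed

text \<open>
  The derivatives at 0 of the partial products converge to those of the limit, and they are
  eventually constant.
\<close>
lemma qpoch_fps_has_expansion:
  assumes p: "p > 0"
  shows "(\<lambda>x. qpoch (x ^ p) (c * x ^ r)) has_fps_expansion qpoch_fps p r c"
proof -
  define W where "W = (\<lambda>x. qpoch (x ^ p) (c * x ^ r))"
  define P where "P N = (\<lambda>x. \<Prod>n<N. 1 - c * x ^ r * (x ^ p) ^ n)" for N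
  have lt: "norm (x ^ p) < 1" if "norm x < 1" for x :: complex
    using that p by (simp add: norm_power power_less_one_iff)
  have W: "W has_fps_expansion fps_expansion W 0"
  proof (rule has_fps_expansion_fps_expansion)
    show "W holomorphic_on ball 0 1" unfolding W_def
      by (intro qpoch_holomorphic holomorphic_intros lt) auto
  qed auto
  have PN: "P N has_fps_expansion qpoch_fps_partial p r c N" for N
  proof -
    have "(\<lambda>x. \<Prod>n<N. 1 - c * x ^ (r + p * n)) has_fps_expansion qpoch_fps_partial p r c N"
      unfolding qpoch_fps_partial_def by (intro fps_expansion_intros)
    thus ?thesis by (simp add: P_def power_add power_mult mult.assoc)
  qed
  have "uniform_limit (cball 0 (1/2)) P W sequentially" unfolding P_def W_def
    by (intro qpoch_uniform_limit continuous_intros lt) auto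
  hence ulim: "uniform_limit (ball 0 (1/2)) P W sequentially"
    by (rule uniform_limit_on_subset) auto
  have "fps_nth (fps_expansion W 0) k = fps_nth (qpoch_fps p r c) k" for k
  proof -
    have "(\<lambda>N. (deriv ^^ k) (P N) 0) \<longlonglongrightarrow> (deriv ^^ k) W 0"
      by (rule higher_deriv_complex_uniform_limit[OF ulim])
         (auto simp: P_def intro!: always_eventually holomorphic_intros)
    hence "(\<lambda>N. (deriv ^^ k) (P N) 0 / fact k) \<longlonglongrightarrow> (deriv ^^ k) W 0 / fact k"
      by (intro tendsto_intros) auto
    moreover have "(deriv ^^ k) (P N) 0 / fact k = fps_nth (qpoch_fps_partial p r c N) k" for N
      using fps_nth_fps_expansion[OF PN] by simp
    moreover have "(deriv ^^ k) W 0 / fact k = fps_nth (fps_expansion W 0) k"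
      using fps_nth_fps_expansion[OF W] by simp
    ultimately have "(\<lambda>N. fps_nth (qpoch_fps_partial p r c N) k) \<longlonglongrightarrow> fps_nth (fps_expansion W 0) k"
      by simp
    moreover have "eventually (\<lambda>N. fps_nth (qpoch_fps_partial p r c N) k = fps_nth (qpoch_fps p r c) k) sequentially"
      using eventually_gt_at_top[of k] by eventually_elim (rule qpoch_fps_partial_stable[OF p])
    hence "(\<lambda>N. fps_nth (qpoch_fps_partial p r c N) k) \<longlonglongrightarrow> fps_nth (qpoch_fps p r c) k"
      by (rule tendsto_eventually)
    ultimately show ?thesis by (rule LIMSEQ_unique)
  qed
  hence "fps_expansion W 0 = qpoch_fps p r c" by (simp add: fps_eq_iff)
  thus ?thesis using W by (simp add: W_def)
qed

lemma (in subfield_hom) conj_qpoch_fps: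
  assumes "c \<in> K"
  shows "conj_fps (qpoch_fps p r c) (qpoch_fps p r (s c))"
proof -
  have "conj_fps (qpoch_fps_partial p r c N) (qpoch_fps_partial p r (s c) N)" for N
    unfolding qpoch_fps_partial_def using assms
    by (intro conj_fps_prod conj_fps_diff conj_fps_one conj_fps_mult conj_fps_const conj_fps_X_power)
  thus ?thesis by (simp add: conj_fps_def qpoch_fps_def)
qed

lemma qpoch_fps_nth_0: "fps_nth (qpoch_fps p r c) 0 = (if r = 0 then 1 - c else 1)"
  by (simp add: qpoch_fps_def qpoch_fps_partial_def)

lemma has_q_expansionI:
  assumes F: "g has_laurent_expansion F" and p: "p > 0"
    and f: "\<And>\<tau>. \<tau> \<in> \<H> \<Longrightarrow> Im \<tau> > B0 \<Longrightarrow> f \<tau> = g (e2pi (\<tau> / of_nat p))"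
  shows "has_q_expansion p f F"
proof -
  have "eventually (\<lambda>z. eval_fls F z = g z) (at 0)" using F by (simp add: has_laurent_expansion_def)
  then obtain r where r: "r > 0" "\<And>z. z \<noteq> 0 \<Longrightarrow> norm z < r \<Longrightarrow> eval_fls F z = g z"
    unfolding eventually_at by (auto simp: dist_norm)
  \<comment> \<open>the height above which \<open>norm (e(\<tau>/p)) < r\<close>\<close>
  define B where "B = max B0 (- (real p * ln r / (2 * pi)))"
  have "f \<tau> = eval_fls F (exp (2 * of_real pi * \<i> * \<tau> / of_nat p))" if \<tau>: "\<tau> \<in> \<H>" "Im \<tau> > B" for \<tau>
  proof -
    have "2 * pi * Im \<tau> / real p > - ln r"
      using \<tau>(2) p by (simp add: B_def field_simps)
    hence "norm (e2pi (\<tau> / of_nat p)) < exp (ln r)"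
      unfolding norm_e2pi by (simp add: Im_divide_of_nat)
    hence "norm (e2pi (\<tau> / of_nat p)) < r" using r(1) by simp
    hence "f \<tau> = eval_fls F (e2pi (\<tau> / of_nat p))" using r(2) f[OF \<tau>(1)] \<tau>(2) by (simp add: B_def)
    thus ?thesis by (simp add: e2pi_def)
  qed
  thus ?thesis using F unfolding has_q_expansion_def has_laurent_expansion_def by blast
qed

text \<open>
  Every small nonzero complex number is of the form \<open>exp(2\<pi>\<i>\<tau>/p)\<close> with \<open>\<tau>\<close> high in the half-plane, and a
  Laurent series is determined by its values near 0.
\<close>
lemma has_q_expansion_unique:
  assumes p: "p > 0" and F: "has_q_expansion p f F" and G: "has_q_expansion p f G"
  shows "F = G"
proof -
  obtain B where B: "\<And>\<tau>. \<tau> \<in> \<H> \<Longrightarrow> Im \<tau> > B \<Longrightarrow> f \<tau> = eval_fls F (exp (2 * of_real pi * \<i> * \<tau> / of_nat p))"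
    using F unfolding has_q_expansion_def by blast
  obtain B' where B': "\<And>\<tau>. \<tau> \<in> \<H> \<Longrightarrow> Im \<tau> > B' \<Longrightarrow> f \<tau> = eval_fls G (exp (2 * of_real pi * \<i> * \<tau> / of_nat p))"
    using G unfolding has_q_expansion_def by blast
  define M where "M = max 0 (max B B')"
  define r where "r = exp (- (2 * pi * M / real p))"
  have "eval_fls F z = eval_fls G z" if z: "z \<noteq> 0" "norm z < r" for z
  proof -
    define \<tau> where "\<tau> = of_nat p * Ln z / (2 * of_real pi * \<i>)"
    have e: "exp (2 * of_real pi * \<i> * \<tau> / of_nat p) = z" using z p by (simp add: \<tau>_def)
    have "norm z = exp (- (2 * pi * Im \<tau> / real p))"
      unfolding e[symmetric] norm_exp_eq_Re by (simp add: Re_divide_of_nat)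
    hence "M < Im \<tau>" using z(2) p by (simp add: r_def divide_less_cancel)
    hence "\<tau> \<in> \<H>" "Im \<tau> > B" "Im \<tau> > B'" by (auto simp: M_def upper_half_plane_def)
    thus ?thesis using B B' e by metis
  qed
  hence "eventually (\<lambda>z. eval_fls F z = eval_fls G z) (at 0)"
    unfolding eventually_at by (intro exI[of _ r]) (auto simp: r_def dist_norm)
  moreover have "eval_fls G has_laurent_expansion G"
    using G by (auto simp: has_q_expansion_def intro: eval_fls_has_laurent_expansion)
  ultimately have "eval_fls G has_laurent_expansion F"
    using F by (auto simp: has_q_expansion_def has_laurent_expansion_def)
  thus ?thesis using \<open>eval_fls G has_laurent_expansion G\<close> has_laurent_expansion_unique by blast
qed

abbreviation frac_vec :: "nat \<Rightarrow> int \<Rightarrow> int \<Rightarrow> rat ^ 2" where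
  "frac_vec p x y \<equiv> vector [of_int x / of_nat p, of_int y / of_nat p]"

text \<open>
  The first coordinate \<open>p b + r\<close> is reduced to \<open>r\<close> by an integral shift, so that only non-negative
  powers of \<open>x = e(\<tau>/p)\<close> occur in the products.
\<close>
lemma siegel_square_q:
  fixes r p :: nat and b t :: int
  assumes \<tau>: "\<tau> \<in> \<H>" and p: "p > 0" and r: "r \<le> p"
  defines "x \<equiv> e2pi (\<tau> / of_nat p)" and "c \<equiv> unity_root p t"
  shows "siegel (frac_vec p (int p * b + int r) t) \<tau> ^ 2 =
    e2pi ((of_nat r ^ 2 / of_nat p - of_nat r + of_nat p / 6) * (\<tau> / of_nat p) +
        (of_int t * (of_nat r - of_nat p) / of_nat p - of_int b * of_int t) / of_nat p) *
    (qpoch (x ^ p) (c * x ^ r) * qpoch (x ^ p) (inverse c * x ^ (p - r))) ^ 2"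
proof -
  define z where "z = of_nat r / of_nat p * \<tau> + of_int t / of_nat p"
  have x0: "x \<noteq> 0" by (simp add: x_def)
  have q: "e2pi \<tau> = x ^ p" unfolding x_def e2pi_of_nat_mult[symmetric] using p by simp
  have w: "e2pi z = c * x ^ r"
    unfolding z_def e2pi_add c_def x_def e2pi_of_nat_mult[symmetric] by (simp add: mult.commute)
  have qw: "x ^ p / (c * x ^ r) = inverse c * x ^ (p - r)"
    using r x0 by (simp add: power_diff field_simps c_def)
  have k: "theta_kernel \<tau> z = qpoch (x ^ p) (c * x ^ r) * qpoch (x ^ p) (inverse c * x ^ (p - r))"
    by (simp add: theta_kernel_def theta_def q w qw)
  have "siegel (frac_vec p (int r) t) \<tau> ^ 2 = e2pi (of_nat r / of_nat p * z - z + \<tau> / 6) * theta_kernel \<tau> z ^ 2"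
    using siegel_square_eq_theta_kernel[OF \<tau>, of z "frac_vec p (int r) t"] by (simp add: z_def of_rat_divide)
  moreover have "siegel (frac_vec p (int p * b + int r) t) \<tau> ^ 2 =
      e2pi (of_rat (of_int 0 * (frac_vec p (int r) t) $ 1 - of_int b * (frac_vec p (int r) t) $ 2)) * siegel (frac_vec p (int r) t) \<tau> ^ 2"
    by (rule siegel_square_shift[OF \<tau>]) (use p in \<open>simp_all add: add_divide_distrib\<close>)
  ultimately have "siegel (frac_vec p (int p * b + int r) t) \<tau> ^ 2 =
      e2pi (- (of_int b * of_int t / of_nat p)) * (e2pi (of_nat r / of_nat p * z - z + \<tau> / 6) * theta_kernel \<tau> z ^ 2)"
    by (simp add: of_rat_minus of_rat_divide of_rat_mult)
  also have "\<dots> = e2pi (- (of_int b * of_int t / of_nat p) + (of_nat r / of_nat p * z - z + \<tau> / 6)) * theta_kernel \<tau> z ^ 2"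
    by (simp only: e2pi_add mult.assoc)
  also have "- (of_int b * of_int t / of_nat p) + (of_nat r / of_nat p * z - z + \<tau> / 6) =
     (of_nat r ^ 2 / of_nat p - of_nat r + of_nat p / 6) * (\<tau> / of_nat p) +
        (of_int t * (of_nat r - of_nat p) / of_nat p - of_int b * of_int t) / of_nat p"
  proof -
    have "- (B * T / P) + (R / P * Z - Z + \<tau> / 6) = (R ^ 2 / P - R + P / 6) * (\<tau> / P) + (T * (R - P) / P - B * T) / P"
      if "Z = R / P * \<tau> + T / P" "P \<noteq> 0" for B T P R Z :: complex
      using that(2) unfolding that(1) by (simp add: field_simps power2_eq_square)
    thus ?thesis using z_def p by simp
  qed
  finally show ?thesis unfolding k .
qed

definition siegel_prod :: "nat \<Rightarrow> int \<Rightarrow> 'i set \<Rightarrow> ('i \<Rightarrow> int) \<Rightarrow> ('i \<Rightarrow> int) \<Rightarrow> complex \<Rightarrow> complex" where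
  "siegel_prod p m I x y \<tau> = (\<Prod>i\<in>I. siegel (frac_vec p (x i) (y i)) \<tau> powi m)"

text \<open>
  Here \<open>r\<close> is the reduced first coordinate and \<open>t\<close> the second one.  The integers \<open>J\<close> and \<open>N\<close> are
  the total exponent of \<open>x\<close> and of the constant factor; that they are integers is where
  the quadratic relations are used.  Only \<open>t\<close> and \<open>N\<close> are affected by the Galois action.
\<close>
definition qlaurent :: "nat \<Rightarrow> int \<Rightarrow> int \<Rightarrow> int \<Rightarrow> 'i set \<Rightarrow> ('i \<Rightarrow> nat) \<Rightarrow> ('i \<Rightarrow> int) \<Rightarrow> complex fls" where
  "qlaurent p m' J N I r t = fls_shift (- J) (fps_to_fls (fps_const (unity_root p (m' * N)) *
     (\<Prod>i\<in>I. ((qpoch_fps p (r i) (unity_root p (t i)) *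
        qpoch_fps p (p - r i) (inverse (unity_root p (t i)))) ^ 2) powi m')))"

lemma e2pi_eq_1_iff: "e2pi z = 1 \<longleftrightarrow> z \<in> \<int>"
  using e2pi_eq_iff[of z 0] by (auto simp: Ints_def)

lemma e2pi_frac_ne_1:
  assumes "p > 0" "\<not> int p dvd t"
  shows "unity_root p t \<noteq> 1"
proof
  assume "unity_root p t = 1"
  then obtain k :: int where "(of_int t :: complex) / of_nat p = of_int k" unfolding e2pi_eq_1_iff by (auto elim: Ints_cases)
  hence "(of_int t :: complex) = of_int (k * int p)" using assms(1) by (simp add: field_simps)
  hence "t = k * int p" unfolding of_int_eq_iff .
  with assms(2) show False by simp
qed

text \<open>
  The assumption \<open>nz\<close> makes the constant terms of the power series nonzero, so that negative
  exponents \<open>m'\<close> can be treated by inversion of power series.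
\<close>
lemma siegel_prod_q_expansion:
  fixes r :: "'i \<Rightarrow> nat" and b t :: "'i \<Rightarrow> int"
  assumes I: "finite I" and p: "p > 0" and r: "\<And>i. i \<in> I \<Longrightarrow> r i < p"
    and nz: "\<And>i. i \<in> I \<Longrightarrow> r i = 0 \<Longrightarrow> \<not> int p dvd t i"
    and J: "of_int J = (of_int m' :: complex) * (\<Sum>i\<in>I. of_nat (r i) ^ 2 / of_nat p - of_nat (r i) + of_nat p / 6)"
    and N: "of_int N = (\<Sum>i\<in>I. of_int (t i) * (of_nat (r i) - of_nat p) / of_nat p - of_int (b i) * of_int (t i) :: complex)"
  shows "has_q_expansion p (siegel_prod p (2 * m') I (\<lambda>i. int p * b i + int (r i)) t) (qlaurent p m' J N I r t)"
proof -
  define c where "c i = unity_root p (t i)" for i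
  define Q where "Q i x = qpoch (x ^ p) (c i * x ^ r i) * qpoch (x ^ p) (inverse (c i) * x ^ (p - r i))" for i x
  define g where "g x = (unity_root p (m' * N) * (\<Prod>i\<in>I. (Q i x ^ 2) powi m')) * x powi J" for x
  have "g has_laurent_expansion qlaurent p m' J N I r t"
    unfolding qlaurent_def g_def
  proof (intro has_laurent_expansion_shift has_laurent_expansion_fps has_fps_expansion_mult
      has_fps_expansion_const has_fps_expansion_prod)
    fix i assume i: "i \<in> I"
    define F where "F = (qpoch_fps p (r i) (c i) * qpoch_fps p (p - r i) (inverse (c i))) ^ 2"
    have F: "(\<lambda>x. Q i x ^ 2) has_fps_expansion F"
      unfolding F_def Q_def by (intro fps_expansion_intros qpoch_fps_has_expansion p)
    have "c i \<noteq> 1" if "r i = 0" using e2pi_frac_ne_1[OF p nz[OF i that]] by (simp add: c_def)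
    hence "fps_nth F 0 \<noteq> 0" using r[OF i] by (auto simp: F_def qpoch_fps_nth_0 power2_eq_square)
    hence "(\<lambda>x. (Q i x ^ 2) powi m') has_fps_expansion F powi m'"
      using F by (auto simp: power_int_def intro!: has_fps_expansion_power has_fps_expansion_inverse)
    thus "(\<lambda>x. (Q i x ^ 2) powi m') has_fps_expansion
      ((qpoch_fps p (r i) (unity_root p (t i)) *
        qpoch_fps p (p - r i) (inverse (unity_root p (t i)))) ^ 2) powi m'"
      by (simp add: F_def c_def)
  qed
  moreover have "siegel_prod p (2 * m') I (\<lambda>i. int p * b i + int (r i)) t \<tau> = g (e2pi (\<tau> / of_nat p))" if \<tau>: "\<tau> \<in> \<H>" for \<tau>
  proof -
    define x where "x = e2pi (\<tau> / of_nat p)"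
    define A where "A i = (of_nat (r i) ^ 2 / of_nat p - of_nat (r i) + of_nat p / 6 :: complex)" for i
    define B where "B i = (of_int (t i) * (of_nat (r i) - of_nat p) / of_nat p - of_int (b i) * of_int (t i) :: complex)" for i
    have "siegel_prod p (2 * m') I (\<lambda>i. int p * b i + int (r i)) t \<tau> =
        (\<Prod>i\<in>I. (siegel (frac_vec p (int p * b i + int (r i)) (t i)) \<tau> ^ 2) powi m')"
      by (simp add: siegel_prod_def power_int_mult)
    also have "\<dots> = (\<Prod>i\<in>I. e2pi (of_int m' * (A i * (\<tau> / of_nat p) + B i / of_nat p)) * (Q i x ^ 2) powi m')"
    proof (rule prod.cong[OF refl])
      fix i assume i: "i \<in> I"
      have "siegel (frac_vec p (int p * b i + int (r i)) (t i)) \<tau> ^ 2 = e2pi (A i * (\<tau> / of_nat p) + B i / of_nat p) * Q i x ^ 2"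
        using siegel_square_q[OF \<tau> p less_imp_le[OF r[OF i]], of "b i" "t i"]
        by (simp only: A_def B_def Q_def x_def c_def)
      thus "(siegel (frac_vec p (int p * b i + int (r i)) (t i)) \<tau> ^ 2) powi m' =
        e2pi (of_int m' * (A i * (\<tau> / of_nat p) + B i / of_nat p)) * (Q i x ^ 2) powi m'"
        by (simp add: power_int_mult_distrib e2pi_of_int_mult)
    qed
    also have "\<dots> = e2pi (\<Sum>i\<in>I. of_int m' * (A i * (\<tau> / of_nat p) + B i / of_nat p)) * (\<Prod>i\<in>I. (Q i x ^ 2) powi m')"
      by (simp add: prod.distrib e2pi_sum)
    also have "(\<Sum>i\<in>I. of_int m' * (A i * (\<tau> / of_nat p) + B i / of_nat p)) =
      of_int J * (\<tau> / of_nat p) + of_int (m' * N) / of_nat p"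
      unfolding J of_int_mult N A_def[symmetric] B_def[symmetric]
      by (simp add: sum.distrib sum_distrib_left sum_distrib_right sum_divide_distrib ring_distribs mult_ac)
    also have "e2pi (of_int J * (\<tau> / of_nat p) + of_int (m' * N) / of_nat p) = unity_root p (m' * N) * x powi J"
      by (simp only: e2pi_add e2pi_of_int_mult x_def mult.commute)
    finally show ?thesis by (simp add: g_def x_def mult_ac)
  qed
  ultimately show ?thesis using has_q_expansionI[OF _ p, where ?B0.0 = 0] by blast
qed

lemma (in subfield_hom) conj_qlaurent:
  assumes p: "p > 0" and z: "e2pi (1 / of_nat p) \<in> K" "s (e2pi (1 / of_nat p)) = unity_root p d"
    and nz: "\<And>i. i \<in> I \<Longrightarrow> r i = 0 \<Longrightarrow> \<not> int p dvd t i" and r: "\<And>i. i \<in> I \<Longrightarrow> r i < p"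
  shows "fls_nth (qlaurent p m' J N I r t) n \<in> K"
    and "fls_nth (qlaurent p m' J (d * N) I r (\<lambda>i. d * t i)) n = s (fls_nth (qlaurent p m' J N I r t) n)"
proof -
  have e: "unity_root p k \<in> K" "s (unity_root p k) = unity_root p (d * k)" for k :: int
  proof -
    have k: "unity_root p k = e2pi (1 / of_nat p) powi k"
      using e2pi_of_int_mult[of k "1 / of_nat p"] by simp
    show "unity_root p k \<in> K" unfolding k using z power_int_closed by simp
    show "s (unity_root p k) = unity_root p (d * k)"
    proof -
      have "s (unity_root p k) = unity_root p d powi k"
        by (simp only: k hom_power_int[OF z(1)] z(2))
      also have "\<dots> = e2pi (of_int k * (of_int d / of_nat p))" by (rule e2pi_of_int_mult[symmetric])
      finally show ?thesis by (simp add: mult.commute)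
    qed
  qed
  have "conj_fps (fps_const (unity_root p (m' * N)) *
     (\<Prod>i\<in>I. ((qpoch_fps p (r i) (unity_root p (t i)) *
        qpoch_fps p (p - r i) (inverse (unity_root p (t i)))) ^ 2) powi m'))
     (fps_const (unity_root p (m' * (d * N))) *
     (\<Prod>i\<in>I. ((qpoch_fps p (r i) (unity_root p (d * t i)) *
        qpoch_fps p (p - r i) (inverse (unity_root p (d * t i)))) ^ 2) powi m'))"
  proof (intro conj_fps_mult conj_fps_prod conj_fps_power_int conj_fps_power)
    show "conj_fps (fps_const (unity_root p (m' * N))) (fps_const (unity_root p (m' * (d * N))))"
      using conj_fps_const[OF e(1)[of "m' * N"]] unfolding e(2) by (simp add: mult.left_commute)
    fix i assume i: "i \<in> I"
    show "conj_fps (qpoch_fps p (r i) (unity_root p (t i))) (qpoch_fps p (r i) (unity_root p (d * t i)))"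
      using conj_qpoch_fps[OF e(1)[of "t i"]] unfolding e(2) .
    show "conj_fps (qpoch_fps p (p - r i) (inverse (unity_root p (t i))))
      (qpoch_fps p (p - r i) (inverse (unity_root p (d * t i))))"
      using conj_qpoch_fps[OF inverse_closed[OF e(1)[of "t i"]]] unfolding hom_inverse[OF e(1)] e(2) .
    have "unity_root p (t i) \<noteq> 1" if "r i = 0" using e2pi_frac_ne_1[OF p nz[OF i that]] .
    thus "fps_nth ((qpoch_fps p (r i) (unity_root p (t i)) *
        qpoch_fps p (p - r i) (inverse (unity_root p (t i)))) ^ 2) 0 \<noteq> 0"
      using r[OF i] by (auto simp: qpoch_fps_nth_0 power2_eq_square)
  qed
  thus "fls_nth (qlaurent p m' J N I r t) n \<in> K"
    and "fls_nth (qlaurent p m' J (d * N) I r (\<lambda>i. d * t i)) n = s (fls_nth (qlaurent p m' J N I r t) n)"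
    unfolding qlaurent_def conj_fps_def by (auto simp: zero_closed hom_zero)
qed

section \<open>The cocycle of a lifting\<close>

definition red :: "int ^ 2 \<Rightarrow> 'p::prime_card mod_ring ^ 2" where
  "red v = (\<chi> i. of_int (v $ i))"

abbreviation redmat :: "int ^ 2 ^ 2 \<Rightarrow> 'p::prime_card mod_ring ^ 2 ^ 2" where
  "redmat \<equiv> map_matrix of_int"

definition smul :: "int \<Rightarrow> int ^ 2 \<Rightarrow> int ^ 2" (infixr \<open>\<odot>\<close> 75) where
  "c \<odot> v = (\<chi> i. c * v $ i)"

text \<open>
  The symplectic form.  For vectors \<open>u\<close> and \<open>v\<close> that are congruent modulo \<open>p\<close>, the exponent
  in \<open>siegel_square_shift\<close> for the points \<open>u/p\<close> and \<open>v/p\<close> is \<open>symp u v / p\<^sup>2\<close>.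
\<close>
definition symp :: "int ^ 2 \<Rightarrow> int ^ 2 \<Rightarrow> int" where
  "symp u v = u $ 1 * v $ 2 - u $ 2 * v $ 1"

lemma of_int_mod_ring_eq_0_iff: "(of_int x :: 'p::prime_card mod_ring) = 0 \<longleftrightarrow> int CARD('p) dvd x"
  using of_int_eq_0_iff_char_dvd[where ?'a = "'p mod_ring"] by simp

lemma of_int_mod_ring_eq_iff: "(of_int x :: 'p::prime_card mod_ring) = of_int y \<longleftrightarrow> int CARD('p) dvd x - y"
  using of_int_mod_ring_eq_0_iff[of "x - y", where ?'p = 'p] by simp

lemma red_vec_mult: "red (v v* M) = red v v* redmat M"
  by (simp add: red_def vec_eq_iff vec_mult_2x2_nth)

lemma red_eq_iff: "(red u :: 'p::prime_card mod_ring ^ 2) = red v \<longleftrightarrow>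
    int CARD('p) dvd u $ 1 - v $ 1 \<and> int CARD('p) dvd u $ 2 - v $ 2"
  by (simp add: red_def vec_eq_iff forall_2 of_int_mod_ring_eq_iff)

lemma red_eq_shift:
  assumes "(red u :: 'p::prime_card mod_ring ^ 2) = red v"
  obtains b where "v = u + int CARD('p) \<odot> b"
proof -
  from assms have "int CARD('p) dvd v $ 1 - u $ 1" "int CARD('p) dvd v $ 2 - u $ 2"
    unfolding red_eq_iff by (metis dvd_minus_iff minus_diff_eq)+
  then obtain b1 b2 where "v $ 1 - u $ 1 = int CARD('p) * b1" "v $ 2 - u $ 2 = int CARD('p) * b2"
    by (auto elim!: dvdE)
  hence "v = u + int CARD('p) \<odot> vector [b1, b2]"
    by (simp add: vec_eq_iff forall_2 smul_def)
  thus ?thesis using that by blast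
qed

lemma symp_add_right: "symp u (v + w) = symp u v + symp u w"
  and symp_add_left: "symp (u + v) w = symp u w + symp v w"
  and symp_smult_right: "symp u (c \<odot> v) = c * symp u v"
  and symp_smult_left: "symp (c \<odot> u) v = c * symp u v"
  and symp_self: "symp u u = 0"
  by (simp_all add: symp_def smul_def algebra_simps)

lemma symp_vec_mult: "symp (u v* M) (v v* M) = det M * symp u v"
  by (simp add: symp_def vec_mult_2x2_nth det_2 algebra_simps)

lemma symp_vec_mult_sum:
  fixes f :: "'b \<Rightarrow> int ^ 2" and M N :: "int ^ 2 ^ 2"
  shows
  "(\<Sum>a\<in>A. symp (f a v* M) (f a v* N)) =
    (M $ 1 $ 1 * N $ 1 $ 2 - M $ 1 $ 2 * N $ 1 $ 1) * (\<Sum>a\<in>A. (f a $ 1)\<^sup>2) +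
    (M $ 1 $ 1 * N $ 2 $ 2 + M $ 2 $ 1 * N $ 1 $ 2 - M $ 1 $ 2 * N $ 2 $ 1 - M $ 2 $ 2 * N $ 1 $ 1) * (\<Sum>a\<in>A. f a $ 1 * f a $ 2) +
    (M $ 2 $ 1 * N $ 2 $ 2 - M $ 2 $ 2 * N $ 2 $ 1) * (\<Sum>a\<in>A. (f a $ 2)\<^sup>2)"
  unfolding sum_distrib_left sum.distrib[symmetric]
  by (intro sum.cong refl) (simp add: symp_def vec_mult_2x2_nth power2_eq_square algebra_simps)

lemma of_int_to_int_mod_ring: "of_int (to_int_mod_ring x) = (x :: 'p::prime_card mod_ring)"
  by (simp add: of_int_of_int_mod_ring)

lemma redmat_to_int: "redmat (map_matrix to_int_mod_ring g) = g"
  by (simp add: vec_eq_iff of_int_to_int_mod_ring)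

lemma vec_mult_right_cancel:
  fixes g :: "'p::prime_card mod_ring ^ 2 ^ 2"
  assumes "det g \<noteq> 0" "a v* g = b v* g"
  shows "a = b"
proof -
  obtain h where "g ** h = mat 1"
    using assms(1) invertible_det_nz[of g] by (auto simp: invertible_def)
  moreover have "(a v* g) v* h = (b v* g) v* h" using assms(2) by simp
  ultimately show ?thesis by (simp add: vector_matrix_mul_assoc)
qed

lemma matrix_mult_right_cancel:
  fixes g :: "'p::prime_card mod_ring ^ 2 ^ 2"
  assumes "det g \<noteq> 0" "a ** g = b ** g"
  shows "a = b"
proof -
  obtain h where "g ** h = mat 1"
    using assms(1) invertible_det_nz[of g] by (auto simp: invertible_def)
  moreover have "(a ** g) ** h = (b ** g) ** h" using assms(2) by simp
  ultimately show ?thesis by (simp flip: matrix_mul_assoc)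
qed

text \<open>
  In the application, \<open>\<Gamma>\<close> is the group \<open>G\<^sub>H\<close>, the vector \<open>\<nu> a\<close> is \<open>p\<close> times the lifting of \<open>a\<close>, and
  \<open>m\<close> is half of the exponent of the Siegel functions.
\<close>
locale siegel_orbit =
  fixes \<Gamma> :: "('p::prime_card mod_ring ^ 2 ^ 2) set"
    and Orb :: "('p mod_ring ^ 2) set"
    and \<nu> :: "'p mod_ring ^ 2 \<Rightarrow> int ^ 2" and m p :: int
  assumes p_eq: "p = int CARD('p)"
    and invariant: "g \<in> \<Gamma> \<Longrightarrow> a \<in> Orb \<Longrightarrow> a v* g \<in> Orb"
    and det_nz: "g \<in> \<Gamma> \<Longrightarrow> det g \<noteq> 0"
    and mult_closed: "g \<in> \<Gamma> \<Longrightarrow> h \<in> \<Gamma> \<Longrightarrow> g ** h \<in> \<Gamma>"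
    and order: "\<not> CARD('p) dvd card \<Gamma>"
    and lifting: "a \<in> Orb \<Longrightarrow> red (\<nu> a) = a"
    and quadratic: "(\<Sum>a\<in>Orb. (a $ 1) ^ 2) = 0" "(\<Sum>a\<in>Orb. a $ 1 * a $ 2) = 0"
      "(\<Sum>a\<in>Orb. (a $ 2) ^ 2) = 0"
begin

lemma lifting_nth: "a \<in> Orb \<Longrightarrow> of_int (\<nu> a $ i) = a $ i"
  using lifting by (metis red_def vec_lambda_beta)

lemma quadratic_dvd:
  "p dvd (\<Sum>a\<in>Orb. (\<nu> a $ 1)\<^sup>2)" "p dvd (\<Sum>a\<in>Orb. \<nu> a $ 1 * \<nu> a $ 2)" "p dvd (\<Sum>a\<in>Orb. (\<nu> a $ 2)\<^sup>2)"
  unfolding p_eq of_int_mod_ring_eq_0_iff[symmetric]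
  using quadratic by (simp_all add: lifting_nth cong: sum.cong)

lemma bij_betw_orbit: "g \<in> \<Gamma> \<Longrightarrow> bij_betw (\<lambda>a. a v* g) Orb Orb"
  unfolding bij_betw_def
proof
  assume g: "g \<in> \<Gamma>"
  show inj: "inj_on (\<lambda>a. a v* g) Orb"
    using vec_mult_right_cancel[OF det_nz[OF g]] by (auto intro: inj_onI)
  have "(\<lambda>a. a v* g) ` Orb \<subseteq> Orb" using invariant g by auto
  thus "(\<lambda>a. a v* g) ` Orb = Orb" using inj by (simp add: endo_inj_surj)
qed

lemma bij_betw_group: "g \<in> \<Gamma> \<Longrightarrow> bij_betw (\<lambda>h. h ** g) \<Gamma> \<Gamma>"
  unfolding bij_betw_def
proof
  assume g: "g \<in> \<Gamma>"
  show inj: "inj_on (\<lambda>h. h ** g) \<Gamma>"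
    using matrix_mult_right_cancel[OF det_nz[OF g]] by (auto intro: inj_onI)
  have "(\<lambda>h. h ** g) ` \<Gamma> \<subseteq> \<Gamma>" using mult_closed g by auto
  thus "(\<lambda>h. h ** g) ` \<Gamma> = \<Gamma>" using inj by (simp add: endo_inj_surj)
qed

text \<open>
  Two liftings of \<open>Orb\<close> are compared: the transform by \<open>M\<close> of the given one, and the given one at
  the permuted points.  The resulting root of unity is \<open>e(cocycle M / p\<^sup>2)\<close>.  All relations for it
  are therefore stated modulo \<open>p\<^sup>2\<close>; as the values are multiples of \<open>p\<close>, they amount to
  relations modulo \<open>p\<close> for the quotients.
\<close>
definition cocycle :: "int ^ 2 ^ 2 \<Rightarrow> int" where
  "cocycle M = m * (\<Sum>a\<in>Orb. symp (\<nu> (a v* redmat M)) (\<nu> a v* M))"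

lemma shift_exists:
  assumes "redmat M \<in> \<Gamma>" "a \<in> Orb"
  shows "\<exists>b. \<nu> a v* M = \<nu> (a v* redmat M) + p \<odot> b"
proof -
  have "(red (\<nu> (a v* redmat M)) :: 'p mod_ring ^ 2) = red (\<nu> a v* M)"
    using assms invariant lifting by (simp add: red_vec_mult)
  thus ?thesis unfolding p_eq by (metis red_eq_shift)
qed

lemma cocycle_dvd: "redmat M \<in> \<Gamma> \<Longrightarrow> p dvd cocycle M"
  unfolding cocycle_def
proof (intro dvd_mult dvd_sum)
  fix a assume "redmat M \<in> \<Gamma>" "a \<in> Orb"
  then obtain b where "\<nu> a v* M = \<nu> (a v* redmat M) + p \<odot> b" using shift_exists by blast
  thus "p dvd symp (\<nu> (a v* redmat M)) (\<nu> a v* M)"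
    by (simp add: symp_add_right symp_smult_right symp_self)
qed

text \<open>
  If \<open>M' = M + pN\<close>, then the difference is \<open>p\<close> times a sum that is congruent modulo \<open>p\<close> to a sum of
  values of an integral quadratic form at the vectors \<open>\<nu> a\<close>, and the quadratic relations make
  that sum divisible by \<open>p\<close>.
\<close>
lemma cocycle_cong:
  assumes M: "redmat M \<in> \<Gamma>" and eq: "(redmat M' :: 'p mod_ring ^ 2 ^ 2) = redmat M"
  shows "p\<^sup>2 dvd cocycle M' - cocycle M"
proof -
  define N :: "int ^ 2 ^ 2" where "N = (\<chi> i j. (M' $ i $ j - M $ i $ j) div p)"
  have N: "M' $ i $ j - M $ i $ j = p * N $ i $ j" for i j
  proof -
    have "(of_int (M' $ i $ j) :: 'p mod_ring) = of_int (M $ i $ j)"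
      using eq by (metis nth_map_matrix)
    thus ?thesis by (simp add: N_def of_int_mod_ring_eq_iff p_eq)
  qed
  have M': "v v* M' = v v* M + p \<odot> (v v* N)" for v
  proof -
    have "M' $ i $ j = M $ i $ j + p * N $ i $ j" for i j using N[of i j] by simp
    thus ?thesis by (simp add: vec_eq_iff vec_mult_2x2_nth smul_def algebra_simps)
  qed
  have "cocycle M' - cocycle M = m * (\<Sum>a\<in>Orb. p * symp (\<nu> (a v* redmat M)) (\<nu> a v* N))"
    unfolding cocycle_def eq M' by (simp add: symp_add_right symp_smult_right sum.distrib ring_distribs)
  also have "(\<Sum>a\<in>Orb. p * symp (\<nu> (a v* redmat M)) (\<nu> a v* N)) = p * (\<Sum>a\<in>Orb. symp (\<nu> (a v* redmat M)) (\<nu> a v* N))"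
    by (simp add: sum_distrib_left)
  finally have diff: "cocycle M' - cocycle M = m * (p * (\<Sum>a\<in>Orb. symp (\<nu> (a v* redmat M)) (\<nu> a v* N)))" .
  have "p dvd (\<Sum>a\<in>Orb. symp (\<nu> (a v* redmat M)) (\<nu> a v* N)) - (\<Sum>a\<in>Orb. symp (\<nu> a v* M) (\<nu> a v* N))"
    unfolding sum_subtractf[symmetric]
  proof (rule dvd_sum)
    fix a assume "a \<in> Orb"
    then obtain b where "\<nu> a v* M = \<nu> (a v* redmat M) + p \<odot> b" using shift_exists M by blast
    thus "p dvd symp (\<nu> (a v* redmat M)) (\<nu> a v* N) - symp (\<nu> a v* M) (\<nu> a v* N)"
      by (simp add: symp_add_left symp_smult_left)
  qed
  moreover have "p dvd (\<Sum>a\<in>Orb. symp (\<nu> a v* M) (\<nu> a v* N))"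
    unfolding symp_vec_mult_sum by (intro dvd_add dvd_mult quadratic_dvd)
  ultimately have "p dvd ((\<Sum>a\<in>Orb. symp (\<nu> (a v* redmat M)) (\<nu> a v* N)) - (\<Sum>a\<in>Orb. symp (\<nu> a v* M) (\<nu> a v* N)))
      + (\<Sum>a\<in>Orb. symp (\<nu> a v* M) (\<nu> a v* N))"
    by (rule dvd_add)
  hence "p dvd (\<Sum>a\<in>Orb. symp (\<nu> (a v* redmat M)) (\<nu> a v* N))"
    by (simp only: diff_add_cancel)
  hence "p * p dvd p * (\<Sum>a\<in>Orb. symp (\<nu> (a v* redmat M)) (\<nu> a v* N))"
    by (rule mult_dvd_mono[OF dvd_refl])
  thus ?thesis unfolding diff power2_eq_square by (rule dvd_mult)
qed

text \<open>
  The twist by the determinant appears because a matrix multiplies the symplectic form by its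
  determinant.
\<close>
lemma cocycle_mult:
  assumes M: "redmat M \<in> \<Gamma>" and M': "redmat M' \<in> \<Gamma>"
  shows "p\<^sup>2 dvd cocycle (M ** M') - (det M' * cocycle M + cocycle M')"
proof -
  define f where "f a = \<nu> (a v* redmat M)" for a :: "'p mod_ring ^ 2"
  define f' where "f' a = \<nu> ((a v* redmat M) v* redmat M')" for a :: "'p mod_ring ^ 2"
  have "p\<^sup>2 dvd symp (f' a) (\<nu> a v* (M ** M')) - (det M' * symp (f a) (\<nu> a v* M) + symp (f' a) (f a v* M'))"
    if a: "a \<in> Orb" for a
  proof -
    obtain b where b: "\<nu> a v* M = f a + p \<odot> b" using shift_exists M a unfolding f_def by blast
    obtain b' where b': "f a v* M' = f' a + p \<odot> b'"
      using shift_exists[OF M', of "a v* redmat M"] invariant[OF M a] unfolding f_def f'_def by blast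
    have "\<nu> a v* (M ** M') = (\<nu> a v* M) v* M'" by (simp add: vector_matrix_mul_assoc)
    also have "\<dots> = f a v* M' + p \<odot> (b v* M')"
      unfolding b by (simp add: vec_eq_iff vec_mult_2x2_nth smul_def algebra_simps)
    finally have "symp (f' a) (\<nu> a v* (M ** M')) = symp (f' a) (f a v* M') + p * symp (f' a) (b v* M')"
      by (simp add: symp_add_right symp_smult_right)
    moreover have "det M' * symp (f a) (\<nu> a v* M) = p * symp (f a v* M') (b v* M')"
      unfolding b by (simp add: symp_add_right symp_smult_right symp_self symp_vec_mult mult_ac)
    moreover have "symp (f a v* M') (b v* M') = symp (f' a) (b v* M') + p * symp b' (b v* M')"
      unfolding b' by (simp add: symp_add_left symp_smult_left)
    ultimately have "symp (f' a) (\<nu> a v* (M ** M')) - (det M' * symp (f a) (\<nu> a v* M) + symp (f' a) (f a v* M')) =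
        - (p\<^sup>2 * symp b' (b v* M'))"
      by (simp add: power2_eq_square algebra_simps)
    thus ?thesis by simp
  qed
  hence "p\<^sup>2 dvd m * (\<Sum>a\<in>Orb. symp (f' a) (\<nu> a v* (M ** M')) - (det M' * symp (f a) (\<nu> a v* M) + symp (f' a) (f a v* M')))"
    by (intro dvd_mult dvd_sum)
  also have "m * (\<Sum>a\<in>Orb. symp (f' a) (\<nu> a v* (M ** M')) - (det M' * symp (f a) (\<nu> a v* M) + symp (f' a) (f a v* M'))) =
    cocycle (M ** M') - (det M' * cocycle M + m * (\<Sum>a\<in>Orb. symp (f' a) (f a v* M')))"
    unfolding cocycle_def map_matrix_of_int_mult
    by (simp add: f_def f'_def vector_matrix_mul_assoc sum_subtractf sum.distrib sum_distrib_left algebra_simps)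
  also have "(\<Sum>a\<in>Orb. symp (f' a) (f a v* M')) = (\<Sum>a\<in>Orb. symp (\<nu> (a v* redmat M')) (\<nu> a v* M'))"
    unfolding f_def f'_def by (rule sum.reindex_bij_betw[OF bij_betw_orbit[OF M]])
  finally show ?thesis by (simp add: cocycle_def)
qed

text \<open>
  Averaging, as in the proof that the cohomology of a group with values in a module of coprime
  order vanishes: summing the cocycle relation over \<open>\<Gamma>\<close> gives \<open>S = det M S + |\<Gamma>| cocycle M\<close> modulo
  \<open>p\<^sup>2\<close>, and \<open>|\<Gamma>|\<close> is invertible.
\<close>
lemma cocycle_is_coboundary:
  "\<exists>k. \<forall>M. redmat M \<in> \<Gamma> \<longrightarrow> p\<^sup>2 dvd cocycle M - p * k * (1 - det M)"
proof -
  define L :: "'p mod_ring ^ 2 ^ 2 \<Rightarrow> int ^ 2 ^ 2" where "L = map_matrix to_int_mod_ring"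
  have L: "redmat (L g) = g" for g unfolding L_def by (rule redmat_to_int)
  define S where "S = (\<Sum>g\<in>\<Gamma>. cocycle (L g))"
  define n where "n = int (card \<Gamma>)"
  have "p dvd S" unfolding S_def by (intro dvd_sum cocycle_dvd) (simp add: L)
  then obtain S0 where S0: "S = p * S0" by blast
  have pr: "prime p" unfolding p_eq by (rule prime_card_int)
  have "coprime p n" using order pr unfolding n_def by (simp add: prime_imp_coprime p_eq)
  hence "coprime n (p\<^sup>2)" by (simp add: coprime_commute)
  then obtain n' where "[n * n' = 1] (mod p\<^sup>2)" using cong_solve_coprime_int by blast
  hence n': "p\<^sup>2 dvd n * n' - 1" by (simp add: cong_iff_dvd_diff)
  have "p\<^sup>2 dvd cocycle M - p * (n' * S0) * (1 - det M)" if M: "redmat M \<in> \<Gamma>" for M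
  proof -
    have "p\<^sup>2 dvd (\<Sum>g\<in>\<Gamma>. cocycle (L (g ** redmat M)) - (det M * cocycle (L g) + cocycle M))"
    proof (rule dvd_sum)
      fix g assume g: "g \<in> \<Gamma>"
      have "p\<^sup>2 dvd cocycle (L (g ** redmat M)) - cocycle (L g ** M)"
        by (rule cocycle_cong) (simp_all add: map_matrix_of_int_mult L g M mult_closed)
      moreover have "p\<^sup>2 dvd cocycle (L g ** M) - (det M * cocycle (L g) + cocycle M)"
        by (rule cocycle_mult) (simp_all add: L g M)
      ultimately show "p\<^sup>2 dvd cocycle (L (g ** redmat M)) - (det M * cocycle (L g) + cocycle M)"
        by (metis dvd_add diff_add_cancel add_diff_eq)
    qed
    also have "(\<Sum>g\<in>\<Gamma>. cocycle (L (g ** redmat M)) - (det M * cocycle (L g) + cocycle M)) =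
      S - (det M * S + n * cocycle M)"
    proof -
      have "(\<Sum>g\<in>\<Gamma>. cocycle (L (g ** redmat M))) = S"
        unfolding S_def by (rule sum.reindex_bij_betw[OF bij_betw_group[OF M]])
      thus ?thesis by (simp add: S_def n_def sum_subtractf sum.distrib sum_distrib_left)
    qed
    finally obtain y where y: "S - (det M * S + n * cocycle M) = p\<^sup>2 * y" by blast
    obtain z where "n * n' - 1 = p\<^sup>2 * z" using n' by (rule dvdE)
    hence z: "n * n' = 1 + p\<^sup>2 * z" by simp
    have "cocycle M - p * (n' * S0) * (1 - det M) = p\<^sup>2 * (- (z * cocycle M) - n' * y)"
    proof -
      have "n' * S * (1 - det M) - (n * n') * cocycle M = n' * (S - (det M * S + n * cocycle M))"
        by (simp add: algebra_simps)
      also have "\<dots> = n' * (p\<^sup>2 * y)" by (simp add: y)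
      finally have "n' * (p * S0) * (1 - det M) - (1 + p\<^sup>2 * z) * cocycle M = n' * (p\<^sup>2 * y)"
        unfolding z S0 .
      hence "p * (n' * S0) * t = n' * (p\<^sup>2 * y) + cocycle M + p\<^sup>2 * z * cocycle M" if "t = 1 - det M" for t
        unfolding that[symmetric] by (simp add: algebra_simps)
      from this[OF refl]
      have "cocycle M - p * (n' * S0) * (1 - det M) = - (n' * (p\<^sup>2 * y)) - p\<^sup>2 * z * cocycle M" by linarith
      also have "\<dots> = p\<^sup>2 * (- (z * cocycle M) - n' * y)" by (simp add: algebra_simps)
      finally show ?thesis .
    qed
    thus ?thesis by simp
  qed
  thus ?thesis by blast
qed

end

text \<open>
  Elementary matrices lift, and a matrix of determinant 1 with nonzero lower left entry is a product
  of three elementary matrices.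
\<close>
lemma SL2_reduction_surj:
  fixes \<sigma> :: "'p::prime_card mod_ring ^ 2 ^ 2"
  assumes "det \<sigma> = 1"
  shows "\<exists>A. A \<in> SL2Z \<and> redmat A = \<sigma>"
proof -
  define R where "R = {redmat A :: 'p mod_ring ^ 2 ^ 2 | A. A \<in> SL2Z}"
  have R_mult: "g ** h \<in> R" if gh: "g \<in> R" "h \<in> R" for g h
  proof -
    obtain A where "g = redmat A" "A \<in> SL2Z" using gh(1) unfolding R_def by blast
    moreover obtain B where "h = redmat B" "B \<in> SL2Z" using gh(2) unfolding R_def by blast
    ultimately have "g ** h = redmat (A ** B)" "A ** B \<in> SL2Z" by (simp_all add: map_matrix_of_int_mult SL2Z_mult)
    thus ?thesis unfolding R_def by blast
  qed
  have U: "mat2 1 x 0 1 \<in> R" and Lo: "mat2 1 0 x 1 \<in> R" for x :: "'p mod_ring"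
  proof -
    define k where "k = to_int_mod_ring x"
    have x: "of_int k = x" by (simp add: k_def of_int_of_int_mod_ring)
    have "redmat (mat2 1 k 0 1) = (mat2 1 x 0 1 :: 'p mod_ring ^ 2 ^ 2)" "redmat (mat2 1 0 k 1) = (mat2 1 0 x 1 :: 'p mod_ring ^ 2 ^ 2)"
      by (simp_all add: vec_eq_iff forall_2 x)
    moreover have "mat2 1 k 0 1 \<in> SL2Z" "mat2 1 0 k 1 \<in> SL2Z" by (simp_all add: SL2Z_def det_2)
    ultimately show "mat2 1 x 0 1 \<in> R" "mat2 1 0 x 1 \<in> R" unfolding R_def by (metis (mono_tags, lifting) mem_Collect_eq)+
  qed
  \<comment> \<open>if the lower left entry is nonzero, the matrix is upper times lower times upper triangular\<close>
  have nz: "mat2 a b c d \<in> R" if "a * d - b * c = 1" "c \<noteq> 0" for a b c d :: "'p mod_ring"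
  proof -
    have "mat2 a b c d = mat2 1 ((a - 1) / c) 0 1 ** mat2 1 0 c 1 ** mat2 1 ((d - 1) / c) 0 1"
    proof -
      have b: "b = (a * d - 1) / c" using that by (simp add: field_simps)
      show ?thesis using that(2) unfolding mat2_mult b by (simp add: field_simps)
    qed
    thus ?thesis using R_mult U Lo by metis
  qed
  define a b c d where abcd: "a = \<sigma> $ 1 $ 1" "b = \<sigma> $ 1 $ 2" "c = \<sigma> $ 2 $ 1" "d = \<sigma> $ 2 $ 2"
  have \<sigma>: "\<sigma> = mat2 a b c d" using mat2_eta[of \<sigma>] by (simp add: abcd)
  have det: "a * d - b * c = 1" using assms by (simp add: det_2 abcd)
  have "mat2 a b c d \<in> R"
  proof (cases "c = 0")
    case True
    hence "a \<noteq> 0" using det by auto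
    moreover have "a * d = 1" using det True by simp
    ultimately have "mat2 a b a (b + d) \<in> R" by (intro nz) (simp_all add: algebra_simps)
    hence "mat2 1 0 (-1) 1 ** mat2 a b a (b + d) \<in> R" by (intro R_mult Lo)
    thus ?thesis by (simp add: mat2_mult True)
  qed (use det nz in blast)
  then obtain A where "A \<in> SL2Z" "mat2 a b c d = redmat A" unfolding R_def by auto
  thus ?thesis using \<sigma> by metis
qed

lemma SL2_lift:
  fixes \<sigma> :: "'p::prime_card mod_ring ^ 2 ^ 2"
  assumes "det \<sigma> = 1"
  shows "SL2_lift \<sigma> \<in> SL2Z" "redmat (SL2_lift \<sigma>) = \<sigma>"
  using someI_ex[OF SL2_reduction_surj[OF assms]] unfolding SL2_lift_def by auto

section \<open>Products of Siegel functions of prime level\<close>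

lemma frac_vec_integral_iff:
  assumes "p > 0"
  shows "(frac_vec p x y $ 1 \<in> \<int> \<and> frac_vec p x y $ 2 \<in> \<int>) \<longleftrightarrow> int p dvd x \<and> int p dvd y"
proof -
  have "(of_int x / of_nat p :: rat) \<in> \<int> \<longleftrightarrow> int p dvd x" for x
  proof
    assume "(of_int x / of_nat p :: rat) \<in> \<int>"
    then obtain k where "(of_int x / of_nat p :: rat) = of_int k" by (auto elim: Ints_cases)
    hence "(of_int x :: rat) = of_int (k * int p)" using assms by (simp add: field_simps)
    hence "x = k * int p" unfolding of_int_eq_iff .
    thus "int p dvd x" by simp
  next
    assume "int p dvd x"
    then obtain k where "x = int p * k" by blast
    thus "(of_int x / of_nat p :: rat) \<in> \<int>" using assms by simp
  qed
  thus ?thesis by simp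
qed

lemma siegel_frac_vec_nonzero:
  assumes "\<tau> \<in> \<H>" "p > 0" "\<not> (int p dvd x \<and> int p dvd y)"
  shows "siegel (frac_vec p x y) \<tau> \<noteq> 0"
  using siegel_nonzero[OF assms(1), of "frac_vec p x y"] frac_vec_integral_iff[OF assms(2)] assms(3) by blast

lemma siegel_prod_holomorphic:
  assumes "p > 0" "\<And>i. i \<in> I \<Longrightarrow> \<not> (int p dvd x i \<and> int p dvd y i)"
  shows "siegel_prod p m I x y holomorphic_on \<H>"
  unfolding siegel_prod_def using assms
  by (intro holomorphic_intros siegel_holomorphic disjI2) (use siegel_frac_vec_nonzero in blast)

lemma siegel_prod_nonzero:
  assumes "p > 0" "\<And>i. i \<in> I \<Longrightarrow> \<not> (int p dvd x i \<and> int p dvd y i)" "finite I" "\<tau> \<in> \<H>"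
  shows "siegel_prod p m I x y \<tau> \<noteq> 0"
  unfolding siegel_prod_def using siegel_frac_vec_nonzero[OF assms(4,1)] assms(2,3) by simp

lemma siegel_prod_shift:
  assumes \<tau>: "\<tau> \<in> \<H>" and p: "p > 0"
    and b: "\<And>i. i \<in> I \<Longrightarrow> int p dvd x' i - x i \<and> int p dvd y' i - y i"
  shows "siegel_prod p (2 * m) I x' y' \<tau> =
    e2pi (of_int (m * (\<Sum>i\<in>I. x i * y' i - y i * x' i)) / (of_nat p)\<^sup>2) * siegel_prod p (2 * m) I x y \<tau>"
proof -
  have "siegel_prod p (2 * m) I x' y' \<tau> = (\<Prod>i\<in>I. (siegel (frac_vec p (x' i) (y' i)) \<tau> ^ 2) powi m)"
    by (simp add: siegel_prod_def power_int_mult)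
  also have "\<dots> = (\<Prod>i\<in>I. e2pi (of_int m * (of_int (x i * y' i - y i * x' i) / (of_nat p)\<^sup>2)) * (siegel (frac_vec p (x i) (y i)) \<tau> ^ 2) powi m)"
  proof (rule prod.cong[OF refl])
    fix i assume "i \<in> I"
    then obtain k l where kl: "x' i = x i + int p * k" "y' i = y i + int p * l"
      using b[of i] by (metis add.commute diff_add_cancel dvdE)
    have "siegel (frac_vec p (x' i) (y' i)) \<tau> ^ 2 =
      e2pi (of_rat (of_int l * frac_vec p (x i) (y i) $ 1 - of_int k * frac_vec p (x i) (y i) $ 2)) * siegel (frac_vec p (x i) (y i)) \<tau> ^ 2"
      by (rule siegel_square_shift[OF \<tau>]) (use p in \<open>simp_all add: kl add_divide_distrib\<close>)
    also have "of_rat (of_int l * frac_vec p (x i) (y i) $ 1 - of_int k * frac_vec p (x i) (y i) $ 2) =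
        (of_int (x i * y' i - y i * x' i) / (of_nat p)\<^sup>2 :: complex)"
      using p unfolding kl by (simp add: of_rat_diff of_rat_mult of_rat_divide field_simps power2_eq_square)
    finally show "(siegel (frac_vec p (x' i) (y' i)) \<tau> ^ 2) powi m =
      e2pi (of_int m * (of_int (x i * y' i - y i * x' i) / (of_nat p)\<^sup>2)) * (siegel (frac_vec p (x i) (y i)) \<tau> ^ 2) powi m"
      by (simp only: power_int_mult_distrib e2pi_of_int_mult)
  qed
  also have "\<dots> = e2pi (\<Sum>i\<in>I. of_int m * (of_int (x i * y' i - y i * x' i) / (of_nat p)\<^sup>2)) * (\<Prod>i\<in>I. (siegel (frac_vec p (x i) (y i)) \<tau> ^ 2) powi m)"
    by (simp add: prod.distrib e2pi_sum)
  also have "(\<Sum>i\<in>I. of_int m * (of_int (x i * y' i - y i * x' i) / (of_nat p)\<^sup>2)) =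
      (of_int (m * (\<Sum>i\<in>I. x i * y' i - y i * x' i)) / (of_nat p)\<^sup>2 :: complex)"
    by (simp add: sum_distrib_left sum_divide_distrib)
  also have "(\<Prod>i\<in>I. (siegel (frac_vec p (x i) (y i)) \<tau> ^ 2) powi m) = siegel_prod p (2 * m) I x y \<tau>"
    by (simp add: siegel_prod_def power_int_mult)
  finally show ?thesis .
qed

definition mat_fst :: "int ^ 2 ^ 2 \<Rightarrow> ('i \<Rightarrow> int) \<Rightarrow> ('i \<Rightarrow> int) \<Rightarrow> 'i \<Rightarrow> int" where
  "mat_fst A x y i = x i * A $ 1 $ 1 + y i * A $ 2 $ 1"

definition mat_snd :: "int ^ 2 ^ 2 \<Rightarrow> ('i \<Rightarrow> int) \<Rightarrow> ('i \<Rightarrow> int) \<Rightarrow> 'i \<Rightarrow> int" where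
  "mat_snd A x y i = x i * A $ 1 $ 2 + y i * A $ 2 $ 2"

lemma moebius_mat_in_upper_half_plane: "A \<in> SL2Z \<Longrightarrow> \<tau> \<in> \<H> \<Longrightarrow> moebius_mat A \<tau> \<in> \<H>"
  using siegel_equivariant_SL2Z unfolding siegel_equivariant_def by blast

text \<open>
  The common 12th root of unity is raised to the power \<open>m |I|\<close>, which is a multiple of 12.
\<close>
lemma siegel_prod_moebius:
  assumes A: "A \<in> SL2Z" and \<tau>: "\<tau> \<in> \<H>" and m: "12 dvd m * int (card I)"
  shows "siegel_prod p m I x y (moebius_mat A \<tau>) = siegel_prod p m I (mat_fst A x y) (mat_snd A x y) \<tau>"
proof -
  obtain C where C: "C ^ 12 = 1" "\<And>a. siegel a (moebius_mat A \<tau>) = C * siegel (a v* map_matrix of_int A) \<tau>"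
    using siegel_equivariant_SL2Z[OF A] \<tau> unfolding siegel_equivariant_def by blast
  have frac_vec: "frac_vec p (x i) (y i) v* map_matrix of_int A = frac_vec p (mat_fst A x y i) (mat_snd A x y i)" for i
    by (simp add: vec_eq_iff forall_2 vec_mult_2x2_nth mat_fst_def mat_snd_def add_divide_distrib)
  obtain k where k: "m * int (card I) = 12 * k" using m by blast
  have "siegel_prod p m I x y (moebius_mat A \<tau>) = (\<Prod>i\<in>I. C powi m * siegel (frac_vec p (mat_fst A x y i) (mat_snd A x y i)) \<tau> powi m)"
    unfolding siegel_prod_def C(2) frac_vec power_int_mult_distrib ..
  also have "\<dots> = (C powi m) ^ card I * siegel_prod p m I (mat_fst A x y) (mat_snd A x y) \<tau>"
    by (simp add: prod.distrib siegel_prod_def)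
  also have "(C powi m) ^ card I = C powi (12 * k)"
    by (simp add: k[symmetric] power_int_mult)
  also have "\<dots> = 1" using C(1) by (simp add: power_int_mult)
  finally show ?thesis by simp
qed

text \<open>
  The conditions under which the product with exponent \<open>2m\<close> is a modular function of level \<open>p\<close> with
  coefficients in the cyclotomic field.  They are stable under matrices that are invertible modulo
  \<open>p\<close> (\<open>admissible_mat\<close>), so that they hold at all cusps at once.
\<close>
definition admissible :: "nat \<Rightarrow> int \<Rightarrow> 'i set \<Rightarrow> ('i \<Rightarrow> int) \<Rightarrow> ('i \<Rightarrow> int) \<Rightarrow> bool" where
  "admissible p m I x y \<longleftrightarrow> prime p \<and> finite I \<and> (\<forall>i\<in>I. \<not> (int p dvd x i \<and> int p dvd y i)) \<and>
     int p dvd (\<Sum>i\<in>I. (x i)\<^sup>2) \<and> int p dvd (\<Sum>i\<in>I. x i * y i) \<and> int p dvd (\<Sum>i\<in>I. (y i)\<^sup>2) \<and>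
     6 dvd m * int (card I)"

lemma admissible_mat:
  assumes g: "admissible p m I x y" and A: "\<not> int p dvd det A"
  shows "admissible p m I (mat_fst A x y) (mat_snd A x y)"
  unfolding admissible_def
proof (intro conjI ballI notI)
  have pr: "prime (int p)" using g by (simp add: admissible_def)
  note q = g[unfolded admissible_def]
  fix i assume i: "i \<in> I" and d: "int p dvd mat_fst A x y i \<and> int p dvd mat_snd A x y i"
  have "int p dvd mat_fst A x y i * A $ 2 $ 2 - mat_snd A x y i * A $ 2 $ 1"
    using d by (intro dvd_diff dvd_mult2) auto
  also have "\<dots> = x i * det A" by (simp add: mat_fst_def mat_snd_def det_2 algebra_simps)
  finally have "int p dvd x i" using A prime_dvd_mult_iff[OF pr] by blast
  moreover have "int p dvd mat_snd A x y i * A $ 1 $ 1 - mat_fst A x y i * A $ 1 $ 2"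
    using d by (intro dvd_diff dvd_mult2) auto
  hence "int p dvd y i * det A" by (simp add: mat_fst_def mat_snd_def det_2 algebra_simps)
  hence "int p dvd y i" using A prime_dvd_mult_iff[OF pr] by blast
  ultimately show False using q i by blast
next
  note q = g[unfolded admissible_def]
  have *: "int p dvd a * (\<Sum>i\<in>I. (x i)\<^sup>2) + b * (\<Sum>i\<in>I. x i * y i) + c * (\<Sum>i\<in>I. (y i)\<^sup>2)" for a b c
    using q by (intro dvd_add dvd_mult) auto
  have "(\<Sum>i\<in>I. (mat_fst A x y i)\<^sup>2) = (A $ 1 $ 1)\<^sup>2 * (\<Sum>i\<in>I. (x i)\<^sup>2) + (2 * A $ 1 $ 1 * A $ 2 $ 1) * (\<Sum>i\<in>I. x i * y i) + (A $ 2 $ 1)\<^sup>2 * (\<Sum>i\<in>I. (y i)\<^sup>2)"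
    unfolding sum_distrib_left sum.distrib[symmetric] by (intro sum.cong refl) (simp add: mat_fst_def power2_eq_square algebra_simps)
  thus "int p dvd (\<Sum>i\<in>I. (mat_fst A x y i)\<^sup>2)" using * by presburger
  have "(\<Sum>i\<in>I. (mat_snd A x y i)\<^sup>2) = (A $ 1 $ 2)\<^sup>2 * (\<Sum>i\<in>I. (x i)\<^sup>2) + (2 * A $ 1 $ 2 * A $ 2 $ 2) * (\<Sum>i\<in>I. x i * y i) + (A $ 2 $ 2)\<^sup>2 * (\<Sum>i\<in>I. (y i)\<^sup>2)"
    unfolding sum_distrib_left sum.distrib[symmetric] by (intro sum.cong refl) (simp add: mat_snd_def power2_eq_square algebra_simps)
  thus "int p dvd (\<Sum>i\<in>I. (mat_snd A x y i)\<^sup>2)" using * by presburger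
  have "(\<Sum>i\<in>I. mat_fst A x y i * mat_snd A x y i) = (A $ 1 $ 1 * A $ 1 $ 2) * (\<Sum>i\<in>I. (x i)\<^sup>2) +
      (A $ 1 $ 1 * A $ 2 $ 2 + A $ 2 $ 1 * A $ 1 $ 2) * (\<Sum>i\<in>I. x i * y i) + (A $ 2 $ 1 * A $ 2 $ 2) * (\<Sum>i\<in>I. (y i)\<^sup>2)"
    unfolding sum_distrib_left sum.distrib[symmetric] by (intro sum.cong refl) (simp add: mat_fst_def mat_snd_def power2_eq_square algebra_simps)
  thus "int p dvd (\<Sum>i\<in>I. mat_fst A x y i * mat_snd A x y i)" using * by presburger
qed (use g in \<open>auto simp: admissible_def\<close>)

text \<open>
  The relations for \<open>\<Sum> x\<^sup>2\<close> and \<open>\<Sum> x y\<close> clear one factor \<open>p\<close> in the denominators of the exponents \<open>J\<close>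
  and \<open>N\<close>, and \<open>6 | m |I|\<close> takes care of the constant \<open>1/6\<close> in \<open>B\<^sub>2\<close>.  The same \<open>J\<close> and \<open>N\<close> serve
  for all multiples \<open>d y\<close>, which is what the Galois action needs.
\<close>
lemma admissible_q_expansion:
  assumes g: "admissible p m I x y"
  obtains J N where "\<And>d. \<not> int p dvd d \<Longrightarrow>
    has_q_expansion p (siegel_prod p (2 * m) I x (\<lambda>i. d * y i))
      (qlaurent p m J (d * N) I (\<lambda>i. nat (x i mod int p)) (\<lambda>i. d * y i))"
proof -
  note q = g[unfolded admissible_def]
  have pr: "prime p" and p: "p > 0" and I: "finite I" using q prime_gt_0_nat by auto
  have pr': "prime (int p)" using pr by simp
  define r where "r i = nat (x i mod int p)" for i
  define b where "b i = x i div int p" for i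
  have r: "int (r i) = x i mod int p" for i using p by (simp add: r_def)
  have x: "x i = int p * b i + int (r i)" for i by (simp add: b_def r)
  have dvd: "int p dvd int (r i) - x i" for i by (simp add: x)
  have "int p dvd (\<Sum>i\<in>I. (int (r i))\<^sup>2 - (x i)\<^sup>2)"
  proof (rule dvd_sum)
    fix i
    have "(int (r i))\<^sup>2 - (x i)\<^sup>2 = (int (r i) - x i) * (int (r i) + x i)" by (simp add: power2_eq_square algebra_simps)
    thus "int p dvd (int (r i))\<^sup>2 - (x i)\<^sup>2" using dvd by simp
  qed
  hence "int p dvd (\<Sum>i\<in>I. (int (r i))\<^sup>2 - (x i)\<^sup>2) + (\<Sum>i\<in>I. (x i)\<^sup>2)" using q by (intro dvd_add) auto
  hence "int p dvd (\<Sum>i\<in>I. (int (r i))\<^sup>2)" by (simp add: sum_subtractf)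
  then obtain R2 where R2: "(\<Sum>i\<in>I. (int (r i))\<^sup>2) = int p * R2" by blast
  have "int p dvd (\<Sum>i\<in>I. (int (r i) - x i) * y i)" by (intro dvd_sum dvd_mult2 dvd)
  hence "int p dvd (\<Sum>i\<in>I. (int (r i) - x i) * y i) + (\<Sum>i\<in>I. x i * y i)" using q by (intro dvd_add) auto
  hence "int p dvd (\<Sum>i\<in>I. int (r i) * y i)" by (simp add: left_diff_distrib sum_subtractf)
  then obtain RY where RY: "(\<Sum>i\<in>I. int (r i) * y i) = int p * RY" by blast
  obtain k where k: "m * int (card I) = 6 * k" using q by blast
  define J where "J = m * (R2 - (\<Sum>i\<in>I. int (r i))) + k * int p"
  define N where "N = RY - (\<Sum>i\<in>I. y i) - (\<Sum>i\<in>I. b i * y i)"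
  have pc: "(of_nat p :: complex) \<noteq> 0" using p by simp
  have J: "of_int J = (of_int m :: complex) * (\<Sum>i\<in>I. of_nat (r i) ^ 2 / of_nat p - of_nat (r i) + of_nat p / 6)"
  proof -
    have "(\<Sum>i\<in>I. of_nat (r i) ^ 2 :: complex) = of_int (\<Sum>i\<in>I. (int (r i))\<^sup>2)" by simp
    also have "\<dots> = of_nat p * of_int R2" unfolding R2 by simp
    finally have 1: "(\<Sum>i\<in>I. of_nat (r i) ^ 2 / of_nat p :: complex) = of_int R2"
      using pc by (simp flip: sum_divide_distrib)
    have "(of_int m * of_nat (card I) :: complex) = of_int (m * int (card I))" by simp
    also have "\<dots> = 6 * of_int k" unfolding k by simp
    finally have 2: "(of_int m * of_nat (card I) :: complex) = 6 * of_int k" .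
    have "of_int m * (\<Sum>i\<in>I. of_nat (r i) ^ 2 / of_nat p - of_nat (r i) + of_nat p / 6) =
      of_int m * (of_int R2 - (\<Sum>i\<in>I. of_nat (r i))) + (of_int m * of_nat (card I)) * (of_nat p / 6 :: complex)"
      by (simp add: sum.distrib sum_subtractf 1 algebra_simps)
    also have "\<dots> = of_int J" unfolding 2 by (simp add: J_def)
    finally show ?thesis by simp
  qed
  have N: "of_int (d * N) = (\<Sum>i\<in>I. of_int (d * y i) * (of_nat (r i) - of_nat p) / of_nat p - of_int (b i) * of_int (d * y i) :: complex)" for d
  proof -
    have "(\<Sum>i\<in>I. of_nat (r i) * of_int (y i) :: complex) = of_int (\<Sum>i\<in>I. int (r i) * y i)" by simp
    also have "\<dots> = of_nat p * of_int RY" unfolding RY by simp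
    finally have 1: "(\<Sum>i\<in>I. of_nat (r i) * of_int (y i) / of_nat p :: complex) = of_int RY"
      using pc by (simp flip: sum_divide_distrib)
    have "(\<Sum>i\<in>I. of_int (d * y i) * (of_nat (r i) - of_nat p) / of_nat p - of_int (b i) * of_int (d * y i)) =
      (\<Sum>i\<in>I. of_int d * (of_nat (r i) * of_int (y i) / of_nat p - of_int (y i) - of_int (b i) * of_int (y i)) :: complex)"
      using pc by (intro sum.cong refl) (simp add: field_simps)
    also have "\<dots> = of_int d * (of_int RY - (\<Sum>i\<in>I. of_int (y i)) - (\<Sum>i\<in>I. of_int (b i) * of_int (y i)))"
      unfolding sum_distrib_left[symmetric] sum_subtractf 1 ..
    also have "\<dots> = of_int (d * N)" by (simp add: N_def)
    finally show ?thesis by simp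
  qed
  show thesis
  proof (rule that)
    fix d assume d: "\<not> int p dvd d"
    have "has_q_expansion p (siegel_prod p (2 * m) I (\<lambda>i. int p * b i + int (r i)) (\<lambda>i. d * y i))
        (qlaurent p m J (d * N) I r (\<lambda>i. d * y i))"
    proof (rule siegel_prod_q_expansion[OF I p _ _ J N])
      show "r i < p" for i using r[of i] p by (metis of_nat_0_less_iff of_nat_less_iff pos_mod_bound)
      fix i assume i: "i \<in> I" "r i = 0"
      hence "int p dvd x i" by (simp add: x)
      hence "\<not> int p dvd y i" using q i by blast
      thus "\<not> int p dvd d * y i" using d pr' by (simp add: prime_dvd_mult_iff)
    qed
    moreover have "(\<lambda>i. int p * b i + int (r i)) = x" using x by (intro ext) simp
    moreover have "r = (\<lambda>i. nat (x i mod int p))" by (intro ext) (rule r_def)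
    ultimately show "has_q_expansion p (siegel_prod p (2 * m) I x (\<lambda>i. d * y i))
      (qlaurent p m J (d * N) I (\<lambda>i. nat (x i mod int p)) (\<lambda>i. d * y i))"
      by simp
  qed
qed

section \<open>The Galois action on products of Siegel functions\<close>

lemma Q_adjoin_subfield_hom:
  assumes "s 1 = 1"
    and "\<And>x y. x \<in> Q_adjoin \<zeta> \<Longrightarrow> y \<in> Q_adjoin \<zeta> \<Longrightarrow> s (x + y) = s x + s y"
    and "\<And>x y. x \<in> Q_adjoin \<zeta> \<Longrightarrow> y \<in> Q_adjoin \<zeta> \<Longrightarrow> s (x * y) = s x * s y"
  shows "subfield_hom (Q_adjoin \<zeta>) s"
proof
  fix x y assume "x \<in> Q_adjoin \<zeta>" "y \<in> Q_adjoin \<zeta>"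
  thus "x - y \<in> Q_adjoin \<zeta>" using Q_adjoin_add[OF _ Q_adjoin_uminus, of x \<zeta> y] by simp
qed (use assms in \<open>simp_all add: Q_adjoin_1 Q_adjoin_mult Q_adjoin_inverse\<close>)

lemma cyclotomic_aut_hom:
  fixes d :: "'p::prime_card mod_ring"
  assumes z: "\<zeta> ^ CARD('p) = 1" "\<zeta> \<noteq> 1" and d: "d \<noteq> 0"
  shows "subfield_hom (Q_adjoin \<zeta>) (cyclotomic_aut \<zeta> d)"
    and "cyclotomic_aut \<zeta> d \<zeta> = \<zeta> powi (to_int_mod_ring d)"
proof -
  let ?F = "(ring_of_type_algebra :: complex ring)\<lparr>carrier := Q_adjoin \<zeta>\<rparr>"
  have range: "to_int_mod_ring d \<in> {0..<int CARD('p)}"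
    using range_to_int_mod_ring[where ?'a = 'p] by blast
  have "to_int_mod_ring d \<noteq> 0"
    using d by (metis of_int_of_int_mod_ring of_int_mod_ring_to_int_mod_ring of_int_0)
  hence "0 < nat (to_int_mod_ring d)" "nat (to_int_mod_ring d) < CARD('p)" using range by (simp_all del: to_int_mod_ring_hom.hom_0_iff, linarith)
  hence "\<not> CARD('p) dvd nat (to_int_mod_ring d)" using nat_dvd_not_less by blast
  hence "coprime (nat (to_int_mod_ring d)) CARD('p)"
    using prime_card[where ?'a = 'p] by (metis coprime_commute prime_imp_coprime_nat)
  from cyclotomic_aut_exists[OF z this]
  have "\<exists>s. s \<in> ring_iso ?F ?F \<and> s \<zeta> = \<zeta> ^ nat (to_int_mod_ring d)" .
  from someI_ex[OF this]
  have s: "cyclotomic_aut \<zeta> d \<in> ring_iso ?F ?F" "cyclotomic_aut \<zeta> d \<zeta> = \<zeta> ^ nat (to_int_mod_ring d)"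
    unfolding cyclotomic_aut_def Let_def by auto
  show "cyclotomic_aut \<zeta> d \<zeta> = \<zeta> powi (to_int_mod_ring d)"
    using s(2) range by (simp add: power_int_def)
  show "subfield_hom (Q_adjoin \<zeta>) (cyclotomic_aut \<zeta> d)"
    using ring_iso_memE[OF s(1)] by (intro Q_adjoin_subfield_hom) (simp_all add: complex_ring_of_type_simps)
qed

lemma root_of_unity_eq_e2pi:
  assumes "p > 0" "z ^ p = 1"
  obtains j :: int where "z = unity_root p j"
proof -
  have z0: "z \<noteq> 0" using assms by (metis power_0_left zero_neq_one not_gr0)
  define w where "w = Ln z / (2 * of_real pi * \<i>)"
  have w: "e2pi w = z" using z0 by (simp add: e2pi_def w_def)
  have "e2pi (of_nat p * w) = 1" unfolding e2pi_of_nat_mult w by (rule assms(2))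
  then obtain j :: int where "of_nat p * w = of_int j" unfolding e2pi_eq_1_iff by (auto elim: Ints_cases)
  hence "w = of_int j / of_nat p" using assms(1) by (simp add: field_simps)
  thus ?thesis using w that by blast
qed

lemma e2pi_frac_eq_iff:
  assumes "p > 0"
  shows "unity_root p a = unity_root p b \<longleftrightarrow> int p dvd a - b"
proof -
  have "unity_root p a = unity_root p b \<longleftrightarrow> unity_root p (a - b) = 1"
    by (simp add: diff_divide_distrib e2pi_diff)
  also have "\<dots> \<longleftrightarrow> int p dvd a - b"
  proof
    assume "int p dvd a - b"
    then obtain k where "a - b = int p * k" by blast
    thus "unity_root p (a - b) = 1" using assms by simp
  qed (use e2pi_frac_ne_1[OF assms] in blast)
  finally show ?thesis .
qed

text \<open>
  The given root of unity is compared with \<open>e(1/p)\<close>: each of them is a power of the other, so that it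
  does not matter which of them is used to describe the field and its automorphisms.
\<close>
lemma roots_of_unity_powers:
  assumes p: "prime p" and \<zeta>: "\<zeta> ^ p = 1" "\<zeta> \<noteq> 1"
  obtains j t :: int where "\<not> int p dvd j"
    and "\<And>k. \<zeta> powi k = unity_root p (j * k)"
    and "\<And>k. unity_root p k = \<zeta> powi (t * k)"
proof -
  have p0: "p > 0" using p by (rule prime_gt_0_nat)
  obtain j :: int where j: "\<zeta> = unity_root p j" using root_of_unity_eq_e2pi[OF p0 \<zeta>(1)] .
  have j_dvd: "\<not> int p dvd j" using \<zeta>(2) e2pi_frac_eq_iff[OF p0, of j 0] by (simp add: j)
  hence "coprime j (int p)" using p by (metis coprime_commute prime_imp_coprime prime_int_nat_transfer nat_int of_nat_0_le_iff)
  then obtain t where "[j * t = 1] (mod int p)" using cong_solve_coprime_int by blast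
  hence t: "int p dvd j * t - 1" by (simp add: cong_iff_dvd_diff)
  have powi: "\<zeta> powi k = unity_root p (j * k)" for k
    using e2pi_of_int_mult[of k "of_int j / of_nat p"] by (simp add: j mult.commute)
  have "int p dvd k - j * (t * k)" for k
  proof -
    have "int p dvd - ((j * t - 1) * k)" using t by simp
    thus ?thesis by (simp add: algebra_simps)
  qed
  hence "unity_root p k = \<zeta> powi (t * k)" for k
    unfolding powi e2pi_frac_eq_iff[OF p0] .
  with powi j_dvd show ?thesis using that by blast
qed

text \<open>
  The identity theorem.  It is applied to the difference with removed singularities; where this
  vanishes, the two functions agree in a punctured neighbourhood, and the convention for the values
  of a nicely meromorphic function gives equality at the point itself.
\<close>
lemma nicely_meromorphic_eq_holomorphic:
  assumes f: "f nicely_meromorphic_on A" and g: "g holomorphic_on A" and A: "open A" "connected A"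
    and U: "open U" "U \<subseteq> A" "U \<noteq> {}" "\<And>z. z \<in> U \<Longrightarrow> f z = g z" and z: "z \<in> A"
  shows "f z = g z"
proof -
  have g_an: "g analytic_on A" using g A by (simp add: analytic_on_open)
  define h where "h = (\<lambda>z. f z - g z)"
  have h: "h meromorphic_on A" unfolding h_def
    using f g_an by (intro meromorphic_intros) (auto simp: nicely_meromorphic_on_def analytic_on_imp_meromorphic_on)
  have iso: "isolated_singularity_at h w" if "w \<in> A" for w
    using meromorphic_on_isolated_singularity[OF meromorphic_on_subset[OF h]] that by auto
  have ev: "eventually (\<lambda>x. remove_sings h x = h x) (at w)" if "w \<in> A" for w
    using eventually_remove_sings_eq_at[OF iso[OF that]] .
  obtain w where w: "w \<in> U" using U by blast
  have "eventually (\<lambda>x. x \<in> U) (at w)" using U(1) w by (rule eventually_at_in_open')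
  moreover have "eventually (\<lambda>x. remove_sings h x = h x) (at w)" using ev w U by blast
  ultimately have "eventually (\<lambda>x. remove_sings h x = 0) (at w)"
    by eventually_elim (simp add: h_def U)
  hence "frequently (\<lambda>x. remove_sings h x = 0) (at w)" by (intro eventually_frequently) auto
  hence zero: "remove_sings h x = 0" if "x \<in> A" for x
    using frequently_eq_meromorphic_imp_constant[OF _ remove_sings_nicely_meromorphic[OF h] A] w U that by blast
  have "eventually (\<lambda>x. x \<in> A) (at z)" using A(1) z by (rule eventually_at_in_open')
  with ev[OF z] have fg: "eventually (\<lambda>x. f x = g x) (at z)"
    by eventually_elim (use zero in \<open>auto simp: h_def\<close>)
  have "g \<midarrow>z\<rightarrow> g z"
    using g A z by (metis analytic_at_imp_isCont analytic_on_analytic_at g_an isContD)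
  hence lim: "f \<midarrow>z\<rightarrow> g z" using fg by (simp add: tendsto_cong)
  hence "\<not> is_pole f z" using not_tendsto_and_filterlim_at_infinity[of "at z" f "g z"] unfolding is_pole_def by auto
  hence "f \<midarrow>z\<rightarrow> f z" using f z by (auto simp: nicely_meromorphic_on_def)
  with lim show ?thesis using LIM_unique by blast
qed

lemma act_SL2Z_restrict:
  assumes "A \<in> SL2Z"
  shows "act_SL2Z (\<lambda>\<tau>\<in>\<H>. f \<tau>) A = (\<lambda>\<tau>\<in>\<H>. f (moebius_mat A \<tau>))"
  unfolding act_SL2Z_def
  by (rule restrict_ext) (use moebius_mat_in_upper_half_plane[OF assms] in \<open>simp add: moebius_mat_def\<close>)

lemma has_q_expansion_cong:
  assumes "\<And>\<tau>. \<tau> \<in> \<H> \<Longrightarrow> f \<tau> = g \<tau>"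
  shows "has_q_expansion p f F \<longleftrightarrow> has_q_expansion p g F"
  using assms unfolding has_q_expansion_def by simp

lemma has_q_expansion_cmult:
  assumes p: "p > 0" and F: "has_q_expansion p f F"
  shows "has_q_expansion p (\<lambda>\<tau>. c * f \<tau>) (fls_const c * F)"
proof -
  obtain B where B: "\<And>\<tau>. \<tau> \<in> \<H> \<Longrightarrow> Im \<tau> > B \<Longrightarrow> f \<tau> = eval_fls F (e2pi (\<tau> / of_nat p))"
    using F unfolding has_q_expansion_def e2pi_def by (metis times_divide_eq_right)
  have "(\<lambda>x. c * eval_fls F x) has_laurent_expansion fls_const c * F"
    using F by (intro has_laurent_expansion_cmult_left eval_fls_has_laurent_expansion) (simp add: has_q_expansion_def)
  from has_q_expansionI[OF this p, of B] B show ?thesis by simp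
qed

lemma admissible_dvd_12:
  assumes "admissible p m I x y"
  shows "12 dvd 2 * m * int (card I)"
proof -
  obtain k where "m * int (card I) = 6 * k" using assms unfolding admissible_def by blast
  hence *: "2 * m * int (card I) = 12 * k" by simp
  show ?thesis unfolding * by (rule dvd_triv_left)
qed

lemma admissible_nonzero: "admissible p m I x y \<Longrightarrow> i \<in> I \<Longrightarrow> \<not> (int p dvd x i \<and> int p dvd y i)"
  and admissible_pos: "admissible p m I x y \<Longrightarrow> p > 0"
  by (auto simp: admissible_def prime_gt_0_nat)

text \<open>
  For \<open>A\<close> in \<open>\<Gamma>(p)\<close>, the transformed vectors are integral shifts of the given ones, and the exponent
  of the shift is \<open>1/p\<^sup>2\<close> times an integral quadratic form whose coefficients and whose sums of
  monomials are both divisible by \<open>p\<close>.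
\<close>
lemma siegel_prod_Gamma_invariant:
  assumes g: "admissible p m I x y" and A: "A \<in> Gamma p" and \<tau>: "\<tau> \<in> \<H>"
  shows "siegel_prod p (2 * m) I x y (moebius_mat A \<tau>) = siegel_prod p (2 * m) I x y \<tau>"
proof -
  have ASL: "A \<in> SL2Z" and c: "\<And>i j. [A $ i $ j = mat 1 $ i $ j] (mod int p)" using A by (auto simp: Gamma_def)
  have d: "int p dvd A $ 1 $ 1 - 1" "int p dvd A $ 2 $ 2 - 1" "int p dvd A $ 1 $ 2" "int p dvd A $ 2 $ 1"
    using c[of 1 1] c[of 2 2] c[of 1 2] c[of 2 1] by (auto simp: cong_iff_dvd_diff mat_def)
  have p: "p > 0" by (rule admissible_pos[OF g])
  have "siegel_prod p (2 * m) I x y (moebius_mat A \<tau>) = siegel_prod p (2 * m) I (mat_fst A x y) (mat_snd A x y) \<tau>"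
    by (rule siegel_prod_moebius[OF ASL \<tau> admissible_dvd_12[OF g]])
  also have "\<dots> = e2pi (of_int (m * (\<Sum>i\<in>I. x i * mat_snd A x y i - y i * mat_fst A x y i)) / (of_nat p)\<^sup>2) * siegel_prod p (2 * m) I x y \<tau>"
  proof (rule siegel_prod_shift[OF \<tau> p], intro conjI)
    fix i
    have "mat_fst A x y i - x i = x i * (A $ 1 $ 1 - 1) + y i * A $ 2 $ 1"
      "mat_snd A x y i - y i = x i * A $ 1 $ 2 + y i * (A $ 2 $ 2 - 1)"
      by (simp_all add: mat_fst_def mat_snd_def algebra_simps)
    thus "int p dvd mat_fst A x y i - x i" "int p dvd mat_snd A x y i - y i"
      using d by (auto intro!: dvd_add dvd_mult)
  qed
  also have "(\<Sum>i\<in>I. x i * mat_snd A x y i - y i * mat_fst A x y i) =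
     A $ 1 $ 2 * (\<Sum>i\<in>I. (x i)\<^sup>2) + (A $ 2 $ 2 - 1 - (A $ 1 $ 1 - 1)) * (\<Sum>i\<in>I. x i * y i) - A $ 2 $ 1 * (\<Sum>i\<in>I. (y i)\<^sup>2)" (is "_ = ?E")
    unfolding sum_distrib_left sum.distrib[symmetric] sum_subtractf[symmetric]
    by (intro sum.cong refl) (simp add: mat_fst_def mat_snd_def power2_eq_square algebra_simps)
  also have "e2pi (of_int (m * ?E) / (of_nat p)\<^sup>2) = 1"
  proof -
    have "int p * int p dvd m * ?E"
    proof (rule dvd_mult, rule dvd_diff, rule dvd_add)
      note q = g[unfolded admissible_def]
      have d': "int p dvd A $ 2 $ 2 - 1 - (A $ 1 $ 1 - 1)" by (rule dvd_diff[OF d(2,1)])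
      show "int p * int p dvd A $ 1 $ 2 * (\<Sum>i\<in>I. (x i)\<^sup>2)"
        "int p * int p dvd A $ 2 $ 1 * (\<Sum>i\<in>I. (y i)\<^sup>2)"
        "int p * int p dvd (A $ 2 $ 2 - 1 - (A $ 1 $ 1 - 1)) * (\<Sum>i\<in>I. x i * y i)"
        using q d d' by (blast intro: mult_dvd_mono)+
    qed
    then obtain k where k: "m * ?E = int p * int p * k"
      by (rule dvdE)
    show ?thesis unfolding k using p by (simp add: power2_eq_square)
  qed
  finally show ?thesis by simp
qed

lemma not_dvd_det_SL2Z: "prime p \<Longrightarrow> A \<in> SL2Z \<Longrightarrow> \<not> int p dvd det A" for p :: nat
  using prime_gt_1_nat[of p] by (auto simp: SL2Z_def zdvd1_eq)

lemma siegel_prod_in_function_field: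
  assumes g: "admissible p m I x y" and \<kappa>: "\<kappa> \<in> Q_adjoin \<zeta>" and \<zeta>: "e2pi (1 / of_nat p) \<in> Q_adjoin \<zeta>"
  shows "(\<lambda>\<tau>\<in>\<H>. \<kappa> * siegel_prod p (2 * m) I x y \<tau>) \<in> function_field_X p \<zeta>"
proof -
  have pr: "prime p" using g by (simp add: admissible_def)
  have p: "p > 0" by (rule admissible_pos[OF g])
  have not1: "\<not> int p dvd 1" using prime_gt_1_nat[OF pr] by (simp add: zdvd1_eq)
  interpret id: subfield_hom "Q_adjoin \<zeta>" "\<lambda>x. x" by (rule Q_adjoin_subfield_hom) auto
  have q: "\<exists>F. has_q_expansion p (\<lambda>\<tau>. \<kappa> * siegel_prod p (2 * m) I x y \<tau>) F \<and> (\<forall>n. fls_nth F n \<in> Q_adjoin \<zeta>)"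
    if g: "admissible p m I x y" for x y
  proof -
    obtain J N where JN: "\<And>d. \<not> int p dvd d \<Longrightarrow>
      has_q_expansion p (siegel_prod p (2 * m) I x (\<lambda>i. d * y i))
        (qlaurent p m J (d * N) I (\<lambda>i. nat (x i mod int p)) (\<lambda>i. d * y i))"
      using admissible_q_expansion[OF g] by blast
    have "has_q_expansion p (siegel_prod p (2 * m) I x y) (qlaurent p m J N I (\<lambda>i. nat (x i mod int p)) y)"
      using JN[OF not1] by simp
    moreover have "fls_nth (qlaurent p m J N I (\<lambda>i. nat (x i mod int p)) y) n \<in> Q_adjoin \<zeta>" for n
    proof (rule id.conj_qlaurent(1)[OF p \<zeta>, where d = 1])
      fix i assume i: "i \<in> I"
      show "nat (x i mod int p) < p" using p by (simp add: nat_less_iff)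
      assume "nat (x i mod int p) = 0"
      hence "int p dvd x i" using p by (metis dvd_eq_mod_eq_0 nat_eq_iff2 nat_0_iff pos_mod_sign of_nat_0_less_iff antisym)
      thus "\<not> int p dvd y i" using admissible_nonzero[OF g i] by blast
    qed simp
    ultimately show ?thesis
      using has_q_expansion_cmult[OF p, of "siegel_prod p (2 * m) I x y" _ \<kappa>] id.mult_closed[OF \<kappa>] by (auto intro!: exI)
  qed
  have "(\<lambda>\<tau>. \<kappa> * siegel_prod p (2 * m) I x y \<tau>) holomorphic_on \<H>"
    using admissible_nonzero[OF g] by (intro holomorphic_intros siegel_prod_holomorphic p) auto
  hence "(\<lambda>\<tau>\<in>\<H>. \<kappa> * siegel_prod p (2 * m) I x y \<tau>) holomorphic_on \<H>"
    by (rule holomorphic_transform) simp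
  hence "(\<lambda>\<tau>\<in>\<H>. \<kappa> * siegel_prod p (2 * m) I x y \<tau>) nicely_meromorphic_on \<H>"
    by (intro analytic_on_imp_nicely_meromorphic_on) (simp add: analytic_on_open open_upper_half_plane)
  moreover have "act_SL2Z (\<lambda>\<tau>\<in>\<H>. \<kappa> * siegel_prod p (2 * m) I x y \<tau>) A = (\<lambda>\<tau>\<in>\<H>. \<kappa> * siegel_prod p (2 * m) I x y \<tau>)"
    if A: "A \<in> Gamma p" for A
  proof -
    have "A \<in> SL2Z" using A by (simp add: Gamma_def)
    thus ?thesis unfolding act_SL2Z_restrict[OF \<open>A \<in> SL2Z\<close>]
      by (intro restrict_ext) (simp add: siegel_prod_Gamma_invariant[OF g A])
  qed
  moreover have "\<exists>F. has_q_expansion p (act_SL2Z (\<lambda>\<tau>\<in>\<H>. \<kappa> * siegel_prod p (2 * m) I x y \<tau>) A) F"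
    if A: "A \<in> SL2Z" for A
  proof -
    obtain F where "has_q_expansion p (\<lambda>\<tau>. \<kappa> * siegel_prod p (2 * m) I (mat_fst A x y) (mat_snd A x y) \<tau>) F"
      using q[OF admissible_mat[OF g not_dvd_det_SL2Z[OF pr A]]] by blast
    hence "has_q_expansion p (act_SL2Z (\<lambda>\<tau>\<in>\<H>. \<kappa> * siegel_prod p (2 * m) I x y \<tau>) A) F"
      unfolding act_SL2Z_restrict[OF A]
      by (rule has_q_expansion_cong[THEN iffD1, rotated]) (simp add: siegel_prod_moebius[OF A _ admissible_dvd_12[OF g]])
    thus ?thesis by blast
  qed
  moreover have "\<exists>F. has_q_expansion p (\<lambda>\<tau>\<in>\<H>. \<kappa> * siegel_prod p (2 * m) I x y \<tau>) F \<and> (\<forall>n. fls_nth F n \<in> Q_adjoin \<zeta>)"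
  proof -
    obtain F where "has_q_expansion p (\<lambda>\<tau>. \<kappa> * siegel_prod p (2 * m) I x y \<tau>) F" "\<forall>n. fls_nth F n \<in> Q_adjoin \<zeta>"
      using q[OF g] by blast
    moreover from this(1) have "has_q_expansion p (\<lambda>\<tau>\<in>\<H>. \<kappa> * siegel_prod p (2 * m) I x y \<tau>) F"
      by (rule has_q_expansion_cong[THEN iffD1, rotated]) simp
    ultimately show ?thesis by blast
  qed
  ultimately show ?thesis unfolding function_field_X_def automorphic_functions_def by simp
qed

lemma admissible_mult_snd:
  assumes "admissible p m I x y" "\<not> int p dvd d"
  shows "admissible p m I x (\<lambda>i. d * y i)"
proof -
  have "admissible p m I (mat_fst (mat2 1 0 0 d) x y) (mat_snd (mat2 1 0 0 d) x y)"
    using assms by (intro admissible_mat) (simp_all add: det_2)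
  moreover have "mat_fst (mat2 1 0 0 d) x y = x" "mat_snd (mat2 1 0 0 d) x y = (\<lambda>i. d * y i)"
    by (simp_all add: fun_eq_iff mat_fst_def mat_snd_def)
  ultimately show ?thesis by simp
qed

text \<open>
  The function on the right has the conjugate \<open>q\<close>-expansion by \<open>conj_qlaurent\<close>.  A second function
  with this property would agree with it high in the half-plane, and hence everywhere.
\<close>
lemma act_diag_siegel_prod:
  fixes d :: "'p::prime_card mod_ring" and k :: int
  assumes z: "\<zeta> ^ CARD('p) = 1" "\<zeta> \<noteq> 1" and d: "d \<noteq> 0" and g: "admissible CARD('p) m I x y"
  shows "act_diag \<zeta> (\<lambda>\<tau>\<in>\<H>. unity_root CARD('p) k * siegel_prod CARD('p) (2 * m) I x y \<tau>) d =
    (\<lambda>\<tau>\<in>\<H>. unity_root CARD('p) (to_int_mod_ring d * k) *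
       siegel_prod CARD('p) (2 * m) I x (\<lambda>i. to_int_mod_ring d * y i) \<tau>)"
proof -
  define p where "p = CARD('p)"
  define d' where "d' = to_int_mod_ring d"
  define s where "s = cyclotomic_aut \<zeta> d"
  note z = z[folded p_def] and g = g[folded p_def]
  have pr: "prime p" using prime_card by (simp add: p_def)
  have p: "p > 0" using pr by (rule prime_gt_0_nat)
  have pr': "prime (int p)" using pr by simp
  interpret s: subfield_hom "Q_adjoin \<zeta>" s
    unfolding s_def by (rule cyclotomic_aut_hom[OF z[unfolded p_def] d])
  have s\<zeta>: "s \<zeta> = \<zeta> powi d'" unfolding s_def d'_def by (rule cyclotomic_aut_hom[OF z[unfolded p_def] d])
  obtain j t :: int where ek: "\<And>k. unity_root p k = \<zeta> powi (t * k)"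
    using roots_of_unity_powers[OF pr z] by metis
  have ek_in: "unity_root p k \<in> Q_adjoin \<zeta>" for k :: int
    unfolding ek by (intro s.power_int_closed Q_adjoin_self)
  have ek_s: "s (unity_root p k) = unity_root p (d' * k)" for k :: int
    unfolding ek s.hom_power_int[OF Q_adjoin_self] s\<zeta> by (simp add: mult_ac flip: power_int_mult)
  have e1_in: "e2pi (1 / of_nat p) \<in> Q_adjoin \<zeta>" and e1_s: "s (e2pi (1 / of_nat p)) = unity_root p d'"
    using ek_in[of 1] ek_s[of 1] by simp_all
  have d'0: "\<not> int p dvd d'"
    using d of_int_mod_ring_eq_0_iff[of d', where ?'p = 'p] by (simp add: d'_def p_def of_int_of_int_mod_ring)
  have not1: "\<not> int p dvd 1" using prime_gt_1_nat[OF pr] by (simp add: zdvd1_eq)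
  define r where "r = (\<lambda>i. nat (x i mod int p))"
  obtain J N where JN: "\<And>d. \<not> int p dvd d \<Longrightarrow>
      has_q_expansion p (siegel_prod p (2 * m) I x (\<lambda>i. d * y i)) (qlaurent p m J (d * N) I r (\<lambda>i. d * y i))"
    unfolding r_def using admissible_q_expansion[OF g] by blast
  define F1 where "F1 = fls_const (unity_root p k) * qlaurent p m J N I r y"
  define F2 where "F2 = fls_const (unity_root p (d' * k)) * qlaurent p m J (d' * N) I r (\<lambda>i. d' * y i)"
  define u where "u = (\<lambda>\<tau>\<in>\<H>. unity_root p k * siegel_prod p (2 * m) I x y \<tau>)"
  define v where "v = (\<lambda>\<tau>\<in>\<H>. unity_root p (d' * k) * siegel_prod p (2 * m) I x (\<lambda>i. d' * y i) \<tau>)"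
  have uF: "has_q_expansion p u F1" unfolding F1_def u_def
    by (rule has_q_expansion_cong[THEN iffD1, OF _ has_q_expansion_cmult[OF p]]) (use JN[OF not1] in simp_all)
  have vF: "has_q_expansion p v F2" unfolding F2_def v_def
    by (rule has_q_expansion_cong[THEN iffD1, OF _ has_q_expansion_cmult[OF p JN[OF d'0]]]) simp
  have rp: "r i < p" for i using p by (simp add: r_def nat_less_iff)
  have ynz: "\<not> int p dvd y i" if "i \<in> I" "r i = 0" for i
  proof -
    have "x i mod int p = 0" using that(2) p unfolding r_def by (metis nat_0_iff pos_mod_sign of_nat_0_less_iff antisym)
    thus ?thesis using admissible_nonzero[OF g that(1)] by (simp add: dvd_eq_mod_eq_0)
  qed
  have F12: "fls_nth F2 n = s (fls_nth F1 n)" for n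
  proof -
    have "fls_nth (qlaurent p m J N I r y) n \<in> Q_adjoin \<zeta>"
      "fls_nth (qlaurent p m J (d' * N) I r (\<lambda>i. d' * y i)) n = s (fls_nth (qlaurent p m J N I r y) n)"
      using s.conj_qlaurent[OF p e1_in e1_s, of I r y] ynz rp by blast+
    thus ?thesis by (simp add: F1_def F2_def s.hom_mult ek_in ek_s)
  qed
  have "act_diag \<zeta> u d = v" unfolding act_diag_def p_def[symmetric] s_def[symmetric]
  proof (rule the_equality)
    show "v \<in> function_field_X p \<zeta> \<and> (\<exists>F F'. has_q_expansion p u F \<and> has_q_expansion p v F' \<and> (\<forall>n. fls_nth F' n = s (fls_nth F n)))"
      using siegel_prod_in_function_field[OF admissible_mult_snd[OF g d'0] ek_in e1_in] uF vF F12 unfolding v_def by blast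
    fix w assume w: "w \<in> function_field_X p \<zeta> \<and> (\<exists>F F'. has_q_expansion p u F \<and> has_q_expansion p w F' \<and> (\<forall>n. fls_nth F' n = s (fls_nth F n)))"
    then obtain F F' where F: "has_q_expansion p u F" "has_q_expansion p w F'" "\<And>n. fls_nth F' n = s (fls_nth F n)" by blast
    have "F = F1" using has_q_expansion_unique[OF p F(1) uF] .
    hence "F' = F2" using F(3) F12 by (simp add: fls_eq_iff)
    hence wF: "has_q_expansion p w F2" using F(2) by simp
    obtain B where B: "\<And>\<tau>. \<tau> \<in> \<H> \<Longrightarrow> Im \<tau> > B \<Longrightarrow> w \<tau> = eval_fls F2 (exp (2 * of_real pi * \<i> * \<tau> / of_nat p))"
      using wF unfolding has_q_expansion_def by blast
    obtain B' where B': "\<And>\<tau>. \<tau> \<in> \<H> \<Longrightarrow> Im \<tau> > B' \<Longrightarrow> v \<tau> = eval_fls F2 (exp (2 * of_real pi * \<i> * \<tau> / of_nat p))"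
      using vF unfolding has_q_expansion_def by blast
    define M where "M = max 0 (max B B')"
    have w': "w \<in> extensional \<H>" "w nicely_meromorphic_on \<H>"
      using w by (auto simp: function_field_X_def automorphic_functions_def)
    have vhol: "v holomorphic_on \<H>"
    proof -
      have "(\<lambda>\<tau>. unity_root p (d' * k) * siegel_prod p (2 * m) I x (\<lambda>i. d' * y i) \<tau>) holomorphic_on \<H>"
        using admissible_nonzero[OF admissible_mult_snd[OF g d'0]] by (intro holomorphic_intros siegel_prod_holomorphic p) auto
      thus ?thesis unfolding v_def by (rule holomorphic_transform) simp
    qed
    show "w = v"
    proof (rule extensionalityI[of _ \<H>])
      fix \<tau> assume \<tau>: "\<tau> \<in> \<H>"
      show "w \<tau> = v \<tau>"
      proof (rule nicely_meromorphic_eq_holomorphic[OF w'(2) vhol open_upper_half_plane _ _ _ _ _ \<tau>])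
        show "connected \<H>" unfolding upper_half_plane_def by (intro convex_connected) (simp add: convex_halfspace_Im_gt)
        show "open {\<tau>. Im \<tau> > M}" by (simp add: open_halfspace_Im_gt)
        show "{\<tau>. Im \<tau> > M} \<subseteq> \<H>" by (auto simp: upper_half_plane_def M_def)
        have "Complex 0 (M + 1) \<in> {\<tau>. Im \<tau> > M}" by simp
        thus "{\<tau>. Im \<tau> > M} \<noteq> {}" by blast
        fix z assume "z \<in> {\<tau>. Im \<tau> > M}"
        hence "z \<in> \<H>" "Im z > B" "Im z > B'" by (auto simp: upper_half_plane_def M_def)
        thus "w z = v z" using B B' by simp
      qed
    qed (use w' in \<open>simp_all add: v_def\<close>)
  qed
  thus ?thesis unfolding u_def v_def p_def d'_def .
qed

section \<open>The main theorem\<close>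

lemma monoid_matrices: "monoid \<lparr>carrier = UNIV, mult = (**), one = mat 1 :: 'a::field ^ 2 ^ 2\<rparr>"
  by unfold_locales (simp_all add: matrix_mul_assoc)

lemma carrier_GL2: "carrier (GL2 :: ('p::prime_card mod_ring ^ 2 ^ 2) monoid) = {g. det g \<noteq> 0}"
proof -
  have "carrier (GL2 :: ('p mod_ring ^ 2 ^ 2) monoid) = {g. invertible g}"
    by (auto simp: GL2_def units_of_def Units_def invertible_def)
  thus ?thesis by (simp add: invertible_det_nz)
qed

lemma GL2_simps:
  "g \<otimes>\<^bsub>GL2\<^esub> h = g ** h" "\<one>\<^bsub>GL2\<^esub> = mat 1"
  by (simp_all add: GL2_def units_of_def)

lemma group_GL2: "group GL2"
  unfolding GL2_def by (rule monoid.units_group[OF monoid_matrices])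

text \<open>
  Closure under inverses is obtained from finiteness: right multiplication by an element is
  injective, and hence it attains the identity.
\<close>
lemma det_part_group:
  fixes G :: "('p::prime_card mod_ring ^ 2 ^ 2) set"
  assumes G: "subgroup G GL2" and H: "subgroup H (Fp_units\<lparr>carrier := det ` G\<rparr>)"
  shows det_part_mult: "g \<in> det_part G H \<Longrightarrow> h \<in> det_part G H \<Longrightarrow> g ** h \<in> det_part G H"
    and det_part_det_nz: "g \<in> det_part G H \<Longrightarrow> det g \<noteq> 0"
    and card_det_part_dvd: "card (det_part G H) dvd card G"
    and one_in_det_subgroup: "1 \<in> H"
    and det_subgroup_subset: "H \<subseteq> det ` G"
proof -
  let ?U = "Fp_units\<lparr>carrier := det ` G\<rparr> :: 'p mod_ring monoid"
  have U: "x \<otimes>\<^bsub>?U\<^esub> y = x * y" "\<one>\<^bsub>?U\<^esub> = 1" for x y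
    by (simp_all add: units_of_def ring_of_type_algebra_def)
  have H_mult: "x * y \<in> H" if "x \<in> H" "y \<in> H" for x y
    using subgroup.m_closed[OF H that] by (simp only: U)
  show H_one: "1 \<in> H" using subgroup.one_closed[OF H] by (simp only: U)
  show "H \<subseteq> det ` G" using subgroup.subset[OF H] by simp
  have G_mult: "g ** h \<in> G" if "g \<in> G" "h \<in> G" for g h
    using subgroup.m_closed[OF G that] by (simp add: GL2_simps)
  have G_one: "mat 1 \<in> G" using subgroup.one_closed[OF G] by (simp add: GL2_simps)
  have nz: "det g \<noteq> 0" if "g \<in> G" for g using subgroup.subset[OF G] that by (auto simp: carrier_GL2)
  show mult: "g ** h \<in> det_part G H" if "g \<in> det_part G H" "h \<in> det_part G H" for g h
    using that G_mult H_mult by (simp add: det_part_def det_mul)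
  show "det g \<noteq> 0" if "g \<in> det_part G H" for g using that nz by (simp add: det_part_def)
  let ?G = "GL2\<lparr>carrier := G\<rparr>"
  interpret G: group ?G by (rule subgroup.subgroup_is_group[OF G group_GL2])
  have one: "mat 1 \<in> det_part G H" using G_one H_one by (simp add: det_part_def)
  have "subgroup (det_part G H) ?G"
  proof (rule G.subgroupI)
    show "det_part G H \<subseteq> carrier ?G" by (auto simp: det_part_def)
    show "det_part G H \<noteq> {}" using one by blast
    show "g \<otimes>\<^bsub>?G\<^esub> h \<in> det_part G H" if "g \<in> det_part G H" "h \<in> det_part G H" for g h
      using mult[OF that] by (simp add: GL2_simps)
    fix g assume g: "g \<in> det_part G H"
    have "inj_on (\<lambda>h. h ** g) (det_part G H)"
      using matrix_mult_right_cancel[of g] nz g by (auto intro: inj_onI simp: det_part_def)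
    moreover have "(\<lambda>h. h ** g) ` det_part G H \<subseteq> det_part G H" using mult g by auto
    ultimately have "(\<lambda>h. h ** g) ` det_part G H = det_part G H" by (simp add: endo_inj_surj)
    then obtain h where h: "h \<in> det_part G H" "h ** g = mat 1" using one by (metis imageE)
    hence "inv\<^bsub>?G\<^esub> g = h" using g by (intro G.inv_equality) (auto simp: GL2_simps det_part_def)
    thus "inv\<^bsub>?G\<^esub> g \<in> det_part G H" using h by simp
  qed
  from G.lagrange[OF this] show "card (det_part G H) dvd card G"
    by (simp add: order_def) (metis dvd_triv_right)
qed

lemma diag_matrix_eq_mat2: "diag_matrix x y = mat2 x 0 0 y"
  by (simp add: diag_matrix_def)

context siegel_orbit
begin

abbreviation \<nu>1 :: "'p mod_ring ^ 2 \<Rightarrow> int" where "\<nu>1 a \<equiv> \<nu> a $ 1"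
abbreviation \<nu>2 :: "'p mod_ring ^ 2 \<Rightarrow> int" where "\<nu>2 a \<equiv> \<nu> a $ 2"

lemma admissible_orbit:
  assumes "Orb \<subseteq> UNIV - {0}" "6 dvd m * int (card Orb)"
  shows "admissible CARD('p) m Orb \<nu>1 \<nu>2"
  unfolding admissible_def
proof (intro conjI ballI notI)
  show "prime CARD('p)" by (rule prime_card)
  fix a assume a: "a \<in> Orb" and d: "int CARD('p) dvd \<nu>1 a \<and> int CARD('p) dvd \<nu>2 a"
  hence "(of_int (\<nu>1 a) :: 'p mod_ring) = 0" "(of_int (\<nu>2 a) :: 'p mod_ring) = 0"
    unfolding of_int_mod_ring_eq_0_iff by blast+
  hence "a = 0" using lifting_nth[OF a] by (simp add: vec_eq_iff forall_2)
  thus False using a assms(1) by blast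
qed (use quadratic_dvd p_eq assms in auto)

text \<open>
  Both sides belong to liftings of the same set, because \<open>a \<mapsto> a v* redmat M\<close> permutes \<open>Orb\<close>.
\<close>
lemma siegel_prod_transform:
  assumes M: "redmat M \<in> \<Gamma>" and \<tau>: "\<tau> \<in> \<H>"
  shows "siegel_prod CARD('p) (2 * m) Orb (mat_fst M \<nu>1 \<nu>2) (mat_snd M \<nu>1 \<nu>2) \<tau> =
    e2pi (of_int (cocycle M) / (of_nat CARD('p))\<^sup>2) * siegel_prod CARD('p) (2 * m) Orb \<nu>1 \<nu>2 \<tau>"
proof -
  have nth: "(\<nu> a v* M) $ 1 = mat_fst M \<nu>1 \<nu>2 a" "(\<nu> a v* M) $ 2 = mat_snd M \<nu>1 \<nu>2 a" for a
    by (simp_all add: vec_mult_2x2_nth mat_fst_def mat_snd_def)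
  have "siegel_prod CARD('p) (2 * m) Orb (mat_fst M \<nu>1 \<nu>2) (mat_snd M \<nu>1 \<nu>2) \<tau> =
    e2pi (of_int (m * (\<Sum>a\<in>Orb. \<nu>1 (a v* redmat M) * mat_snd M \<nu>1 \<nu>2 a - \<nu>2 (a v* redmat M) * mat_fst M \<nu>1 \<nu>2 a)) / (of_nat CARD('p))\<^sup>2) *
    siegel_prod CARD('p) (2 * m) Orb (\<lambda>a. \<nu>1 (a v* redmat M)) (\<lambda>a. \<nu>2 (a v* redmat M)) \<tau>"
  proof (rule siegel_prod_shift[OF \<tau>])
    fix a assume "a \<in> Orb"
    then obtain b where "\<nu> a v* M = \<nu> (a v* redmat M) + p \<odot> b" using shift_exists[OF M] by blast
    thus "int CARD('p) dvd mat_fst M \<nu>1 \<nu>2 a - \<nu>1 (a v* redmat M) \<and> int CARD('p) dvd mat_snd M \<nu>1 \<nu>2 a - \<nu>2 (a v* redmat M)"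
      by (simp add: nth[symmetric] smul_def p_eq)
  qed simp
  also have "m * (\<Sum>a\<in>Orb. \<nu>1 (a v* redmat M) * mat_snd M \<nu>1 \<nu>2 a - \<nu>2 (a v* redmat M) * mat_fst M \<nu>1 \<nu>2 a) = cocycle M"
    by (simp add: cocycle_def symp_def nth)
  also have "siegel_prod CARD('p) (2 * m) Orb (\<lambda>a. \<nu>1 (a v* redmat M)) (\<lambda>a. \<nu>2 (a v* redmat M)) \<tau> =
    siegel_prod CARD('p) (2 * m) Orb \<nu>1 \<nu>2 \<tau>"
    unfolding siegel_prod_def by (rule prod.reindex_bij_betw[OF bij_betw_orbit[OF M]])
  finally show ?thesis .
qed

text \<open>
  The matrix \<open>\<sigma>\<close> lifts to \<open>M = A diag(1, d)\<close> with \<open>A\<close> in the modular group.  Composition with \<open>A\<close> and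
  the Galois action by \<open>d\<close> together transform the product by \<open>M\<close>, and they multiply the exponent \<open>k\<close>
  of the constant by \<open>d\<close>.
\<close>
lemma act_GL2_siegel_prod:
  assumes admissible: "admissible CARD('p) m Orb \<nu>1 \<nu>2" and \<zeta>: "\<zeta> ^ CARD('p) = 1" "\<zeta> \<noteq> 1"
    and k0: "\<And>M. redmat M \<in> \<Gamma> \<Longrightarrow> p\<^sup>2 dvd cocycle M - p * k0 * (1 - det M)"
    and \<sigma>: "\<sigma> \<in> \<Gamma>"
  defines "d \<equiv> to_int_mod_ring (det \<sigma>)"
  shows "act_GL2 \<zeta> (\<lambda>\<tau>\<in>\<H>. unity_root CARD('p) k * siegel_prod CARD('p) (2 * m) Orb \<nu>1 \<nu>2 \<tau>) \<sigma> =
    (\<lambda>\<tau>\<in>\<H>. unity_root CARD('p) (d * k + k0 * (1 - d)) * siegel_prod CARD('p) (2 * m) Orb \<nu>1 \<nu>2 \<tau>)"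
proof -
  define n where "n = CARD('p)"
  have pr: "prime n" using prime_card by (simp add: n_def)
  have n0: "(of_nat n :: complex) \<noteq> 0" using pr by (auto simp: n_def)
  have pn: "p = int n" by (simp add: p_eq n_def)
  have det0: "det \<sigma> \<noteq> 0" using det_nz[OF \<sigma>] .
  define A where "A = SL2_lift (\<sigma> ** diag_matrix 1 (inverse (det \<sigma>)))"
  define M where "M = A ** mat2 1 0 0 d"
  have "det (\<sigma> ** diag_matrix 1 (inverse (det \<sigma>))) = 1"
    using det0 by (simp add: det_mul diag_matrix_eq_mat2 det_2[of "mat2 _ _ _ _"])
  from SL2_lift[OF this] have A: "A \<in> SL2Z" "redmat A = \<sigma> ** diag_matrix 1 (inverse (det \<sigma>))"
    by (simp_all add: A_def)
  have "(redmat (mat2 1 0 0 d) :: 'p mod_ring ^ 2 ^ 2) = mat2 1 0 0 (det \<sigma>)"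
    by (simp add: vec_eq_iff forall_2 d_def of_int_to_int_mod_ring)
  hence M: "redmat M = \<sigma>"
    using det0 by (simp add: M_def map_matrix_of_int_mult A diag_matrix_eq_mat2 mat2_mult flip: matrix_mul_assoc)
       (simp add: vec_eq_iff forall_2 mult_2x2_nth)
  have detM: "det M = d" using A(1) by (simp add: M_def det_mul SL2Z_def det_2[of "mat2 _ _ _ _"])
  have fs: "mat_fst M \<nu>1 \<nu>2 = mat_fst A \<nu>1 \<nu>2" "mat_snd M \<nu>1 \<nu>2 = (\<lambda>a. d * mat_snd A \<nu>1 \<nu>2 a)"
    by (simp_all add: fun_eq_iff mat_fst_def mat_snd_def M_def mult_2x2_nth algebra_simps)
  have gA: "admissible n m Orb (mat_fst A \<nu>1 \<nu>2) (mat_snd A \<nu>1 \<nu>2)"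
    using admissible_mat[OF admissible[folded n_def] not_dvd_det_SL2Z[OF pr A(1)]] .
  have "act_SL2Z (\<lambda>\<tau>\<in>\<H>. unity_root n k * siegel_prod n (2 * m) Orb \<nu>1 \<nu>2 \<tau>) A =
      (\<lambda>\<tau>\<in>\<H>. unity_root n k * siegel_prod n (2 * m) Orb (mat_fst A \<nu>1 \<nu>2) (mat_snd A \<nu>1 \<nu>2) \<tau>)"
    unfolding act_SL2Z_restrict[OF A(1)]
    by (intro restrict_ext) (simp add: siegel_prod_moebius[OF A(1) _ admissible_dvd_12[OF admissible[folded n_def]]])
  hence "act_GL2 \<zeta> (\<lambda>\<tau>\<in>\<H>. unity_root n k * siegel_prod n (2 * m) Orb \<nu>1 \<nu>2 \<tau>) \<sigma> =
      (\<lambda>\<tau>\<in>\<H>. unity_root n (d * k) * siegel_prod n (2 * m) Orb (mat_fst M \<nu>1 \<nu>2) (mat_snd M \<nu>1 \<nu>2) \<tau>)"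
    using act_diag_siegel_prod[OF \<zeta> det0 gA[unfolded n_def], of k]
    unfolding act_GL2_def A_def[symmetric] fs n_def d_def by simp
  also have "\<dots> = (\<lambda>\<tau>\<in>\<H>. unity_root n (d * k + k0 * (1 - d)) * siegel_prod n (2 * m) Orb \<nu>1 \<nu>2 \<tau>)"
  proof (rule restrict_ext)
    fix \<tau> assume \<tau>: "\<tau> \<in> \<H>"
    obtain z where z: "cocycle M - p * k0 * (1 - det M) = p\<^sup>2 * z" using k0[of M] M \<sigma> by auto
    hence "cocycle M = p * k0 * (1 - d) + p\<^sup>2 * z" by (simp add: detM)
    hence "(of_int (cocycle M) :: complex) = of_nat n * of_int (k0 * (1 - d)) + (of_nat n)\<^sup>2 * of_int z"
      by (simp add: pn mult.assoc)
    hence "(of_int (cocycle M) :: complex) / (of_nat n)\<^sup>2 = of_int (k0 * (1 - d)) / of_nat n + of_int z"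
      using n0 by (simp only: add_divide_distrib) (simp add: power2_eq_square)
    hence e: "e2pi (of_int (cocycle M) / (of_nat n)\<^sup>2) = unity_root n (k0 * (1 - d))"
      by (simp add: e2pi_add)
    have "unity_root n (d * k) * siegel_prod n (2 * m) Orb (mat_fst M \<nu>1 \<nu>2) (mat_snd M \<nu>1 \<nu>2) \<tau> =
      (unity_root n (d * k) * unity_root n (k0 * (1 - d))) * siegel_prod n (2 * m) Orb \<nu>1 \<nu>2 \<tau>"
      using siegel_prod_transform[of M \<tau>] M \<sigma> \<tau> e by (simp add: n_def)
    also have "unity_root n (d * k) * unity_root n (k0 * (1 - d)) = unity_root n (d * k + k0 * (1 - d))"
      by (simp only: of_int_add add_divide_distrib e2pi_add)
    finally show "unity_root n (d * k) * siegel_prod n (2 * m) Orb (mat_fst M \<nu>1 \<nu>2) (mat_snd M \<nu>1 \<nu>2) \<tau> =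
      unity_root n (d * k + k0 * (1 - d)) * siegel_prod n (2 * m) Orb \<nu>1 \<nu>2 \<tau>" .
  qed
  finally show ?thesis unfolding n_def .
qed

end

theorem theorem5p5:
  fixes \<zeta> :: complex
    and G :: "('p::prime_card mod_ring ^ 2 ^ 2) set"
    and H :: "'p mod_ring set"
    and Orb :: "('p mod_ring ^ 2) set"
    and l :: "'p mod_ring ^ 2 \<Rightarrow> rat ^ 2"
    and m :: int
    and u :: "complex \<Rightarrow> complex"
  assumes p: "CARD('p) \<ge> 5"
    and zeta: "primitive_root_of_unity CARD('p) \<zeta>"
    and G: "subgroup G GL2" "- mat 1 \<in> G" "\<not> CARD('p) dvd card G"
    and H: "subgroup H (Fp_units\<lparr>carrier := det ` G\<rparr>)"
    and Orb: "Orb \<subseteq> UNIV - {0}" "\<And>g a. g \<in> det_part G H \<Longrightarrow> a \<in> Orb \<Longrightarrow> a v* g \<in> Orb"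
    and quadratic:
      "(\<Sum>a\<in>Orb. (a $ 1) ^ 2) = 0"
      "(\<Sum>a\<in>Orb. a $ 1 * a $ 2) = 0"
      "(\<Sum>a\<in>Orb. (a $ 2) ^ 2) = 0"
    and m: "2 dvd m" "12 dvd m * int (card Orb)"
    and l: "is_lifting Orb l"
    and u: "u = (\<lambda>\<tau>\<in>\<H>. \<Prod>a\<in>Orb. siegel (l a) \<tau> powi m)"
  shows "u \<in> function_field_XG \<zeta> G {1} \<and>
    (\<exists>k::int. (\<lambda>\<tau>\<in>\<H>. \<zeta> powi k * u \<tau>) \<in> function_field_XG \<zeta> G H) \<and>
    (H \<noteq> {1} \<longrightarrow>
      (\<forall>k k' :: int.
         (\<lambda>\<tau>\<in>\<H>. \<zeta> powi k * u \<tau>) \<in> function_field_XG \<zeta> G H \<and>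
         (\<lambda>\<tau>\<in>\<H>. \<zeta> powi k' * u \<tau>) \<in> function_field_XG \<zeta> G H \<longrightarrow>
         [k = k'] (mod int CARD('p))))"
proof -
  define n where "n = CARD('p)"
  have pr: "prime n" using prime_card by (simp add: n_def)
  have pr': "prime (int n)" using pr by simp
  have n0: "n > 0" using pr by (rule prime_gt_0_nat)
  have n1: "n > 1" using pr by (rule prime_gt_1_nat)
  have \<zeta>: "\<zeta> ^ n = 1" "\<zeta> \<noteq> 1"
    using zeta n1 unfolding primitive_root_of_unity_def n_def[symmetric] by (auto dest: bspec[of _ _ 1])
  note \<zeta>' = \<zeta>[unfolded n_def]
  obtain j t :: int where j_dvd: "\<not> int n dvd j"
    and \<zeta>_powi: "\<And>k. \<zeta> powi k = unity_root n (j * k)"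
    and e2pi_powi: "\<And>k. unity_root n k = \<zeta> powi (t * k)"
    using roots_of_unity_powers[OF pr \<zeta>] by metis
  interpret K: subfield_hom "Q_adjoin \<zeta>" "\<lambda>x. x" by (rule Q_adjoin_subfield_hom) auto
  have e2pi_in: "unity_root n k \<in> Q_adjoin \<zeta>" for k
    unfolding e2pi_powi by (intro K.power_int_closed Q_adjoin_self)
  have "\<forall>a\<in>Orb. \<exists>v :: int ^ 2. \<forall>i. l a $ i = of_int (v $ i) / of_nat n \<and> of_int (v $ i) = a $ i"
  proof
    fix a assume a: "a \<in> Orb"
    have "\<forall>i. \<exists>k::int. l a $ i = of_int k / of_nat n \<and> of_int k = a $ i"
      using l a unfolding is_lifting_def n_def by blast
    then obtain f where "\<forall>i. l a $ i = of_int (f i :: int) / of_nat n \<and> of_int (f i) = a $ i" by metis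
    hence "\<forall>i. l a $ i = of_int ((\<chi> i. f i) $ i) / of_nat n \<and> of_int ((\<chi> i. f i) $ i) = a $ i" by simp
    thus "\<exists>v :: int ^ 2. \<forall>i. l a $ i = of_int (v $ i) / of_nat n \<and> of_int (v $ i) = a $ i" by blast
  qed
  then obtain \<nu> :: "'p mod_ring ^ 2 \<Rightarrow> int ^ 2" where
    \<nu>: "\<And>a i. a \<in> Orb \<Longrightarrow> l a $ i = of_int (\<nu> a $ i) / of_nat n \<and> of_int (\<nu> a $ i) = a $ i" by metis
  obtain m' where m': "m = 2 * m'" using m(1) by blast
  define \<Gamma> where "\<Gamma> = det_part G H"
  note \<Gamma> = det_part_group[OF G(1) H, folded \<Gamma>_def]
  interpret siegel_orbit \<Gamma> Orb \<nu> m' "int n"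
  proof
    show "int n = int CARD('p)" by (simp add: n_def)
    show "\<not> CARD('p) dvd card \<Gamma>" using \<Gamma>(3) G(3) dvd_trans by blast
    show "red (\<nu> a) = a" if "a \<in> Orb" for a using \<nu>[OF that] by (simp add: red_def vec_eq_iff)
  qed (use Orb(2) \<Gamma> quadratic in \<open>simp_all add: \<Gamma>_def\<close>)
  have "6 dvd m' * int (card Orb)"
  proof -
    obtain k where "2 * m' * int (card Orb) = 12 * k" using m(2) unfolding m' by (rule dvdE)
    hence "m' * int (card Orb) = 6 * k" by simp
    thus ?thesis by simp
  qed
  hence admissible: "admissible n m' Orb \<nu>1 \<nu>2" unfolding n_def by (rule admissible_orbit[OF Orb(1)])
  define U where "U = siegel_prod n m Orb \<nu>1 \<nu>2"
  have "l a = frac_vec n (\<nu>1 a) (\<nu>2 a)" if "a \<in> Orb" for a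
    using \<nu>[OF that] by (simp add: vec_eq_iff forall_2)
  hence u: "u = (\<lambda>\<tau>\<in>\<H>. U \<tau>)" by (simp add: u U_def siegel_prod_def cong: prod.cong)
  \<comment> \<open>all multiples of \<open>u\<close> by powers of \<open>\<zeta>\<close> are of this form, since \<open>\<zeta> = e(j/p)\<close>\<close>
  define V where "V k = (\<lambda>\<tau>\<in>\<H>. unity_root n k * U \<tau>)" for k :: int
  have V_field: "V k \<in> function_field_X n \<zeta>" for k
    unfolding V_def U_def m' using e2pi_in[of 1] by (intro siegel_prod_in_function_field[OF admissible] e2pi_in) simp
  have V_eq_iff: "V k = V k' \<longleftrightarrow> int n dvd k - k'" for k k'
  proof
    assume eq: "V k = V k'"
    have \<i>: "\<i> \<in> \<H>" by (simp add: upper_half_plane_def)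
    have "U \<i> \<noteq> 0" unfolding U_def using admissible admissible_nonzero[OF admissible] n0 \<i>
      by (intro siegel_prod_nonzero) (auto simp: admissible_def)
    moreover have "V k \<i> = V k' \<i>" using eq by simp
    ultimately have "unity_root n k = unity_root n k'" using \<i> by (simp add: V_def)
    thus "int n dvd k - k'" by (simp add: e2pi_frac_eq_iff[OF n0])
  next
    assume "int n dvd k - k'"
    hence "unity_root n k = unity_root n k'" by (simp add: e2pi_frac_eq_iff[OF n0])
    thus "V k = V k'" by (simp add: V_def)
  qed
  have V_\<zeta>: "(\<lambda>\<tau>\<in>\<H>. \<zeta> powi k * u \<tau>) = V (j * k)" for k
    unfolding V_def by (rule restrict_ext) (simp add: u \<zeta>_powi)
  have V_0: "u = V 0" unfolding V_def u by (rule restrict_ext) simp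
  obtain k0 where k0: "\<And>M. redmat M \<in> \<Gamma> \<Longrightarrow> (int n)\<^sup>2 dvd cocycle M - int n * k0 * (1 - det M)"
    using cocycle_is_coboundary by blast
  have fixed_iff: "act_GL2 \<zeta> (V k) \<sigma> = V k \<longleftrightarrow> int n dvd (1 - to_int_mod_ring (det \<sigma>)) * (k0 - k)"
    if \<sigma>: "\<sigma> \<in> \<Gamma>" for \<sigma> k
  proof -
    define d where "d = to_int_mod_ring (det \<sigma>)"
    have "act_GL2 \<zeta> (V k) \<sigma> = V (d * k + k0 * (1 - d))"
      using act_GL2_siegel_prod[OF admissible[unfolded n_def] \<zeta>' k0 \<sigma>, of k]
      unfolding V_def U_def m' d_def n_def .
    moreover have "d * k + k0 * (1 - d) - k = (1 - d) * (k0 - k)" by (simp add: algebra_simps)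
    ultimately show ?thesis by (simp add: V_eq_iff d_def)
  qed
  have XG_iff: "V k \<in> function_field_XG \<zeta> G H \<longleftrightarrow> (\<forall>\<sigma>\<in>\<Gamma>. int n dvd (1 - to_int_mod_ring (det \<sigma>)) * (k0 - k))" for k
    unfolding function_field_XG_def using V_field fixed_iff by (auto simp: \<Gamma>_def n_def)
  have "u \<in> function_field_XG \<zeta> G {1}"
  proof -
    have "act_GL2 \<zeta> (V 0) \<sigma> = V 0" if "\<sigma> \<in> det_part G {1}" for \<sigma>
    proof -
      have "\<sigma> \<in> \<Gamma>" "det \<sigma> = 1" using that \<Gamma>(4) by (auto simp: det_part_def \<Gamma>_def)
      thus ?thesis by (simp add: fixed_iff)
    qed
    thus ?thesis using V_field by (simp add: V_0 function_field_XG_def n_def)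
  qed
  moreover have "\<exists>k::int. (\<lambda>\<tau>\<in>\<H>. \<zeta> powi k * u \<tau>) \<in> function_field_XG \<zeta> G H"
  proof
    have "int n dvd k0 - j * (t * k0)"
      unfolding e2pi_frac_eq_iff[OF n0, symmetric] e2pi_powi[of k0] \<zeta>_powi ..
    thus "(\<lambda>\<tau>\<in>\<H>. \<zeta> powi (t * k0) * u \<tau>) \<in> function_field_XG \<zeta> G H"
      unfolding V_\<zeta> XG_iff by simp
  qed
  moreover have "[k = k'] (mod int n)"
    if H1: "H \<noteq> {1}" and kk': "(\<lambda>\<tau>\<in>\<H>. \<zeta> powi k * u \<tau>) \<in> function_field_XG \<zeta> G H"
      "(\<lambda>\<tau>\<in>\<H>. \<zeta> powi k' * u \<tau>) \<in> function_field_XG \<zeta> G H" for k k'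
  proof -
    obtain h where h: "h \<in> H" "h \<noteq> 1" using H1 \<Gamma>(4) by blast
    obtain \<sigma> where \<sigma>: "\<sigma> \<in> G" "h = det \<sigma>" using subsetD[OF \<Gamma>(5) h(1)] by (rule imageE)
    have \<sigma>\<Gamma>: "\<sigma> \<in> \<Gamma>" using h \<sigma> by (simp add: \<Gamma>_def det_part_def)
    define d where "d = to_int_mod_ring (det \<sigma>)"
    have "(of_int (1 - d) :: 'p mod_ring) \<noteq> 0" using h \<sigma> by (simp add: d_def of_int_to_int_mod_ring)
    hence "\<not> int n dvd 1 - d" unfolding of_int_mod_ring_eq_0_iff n_def .
    moreover have "int n dvd (1 - d) * (k0 - j * k)" "int n dvd (1 - d) * (k0 - j * k')"
      using kk' \<sigma>\<Gamma> unfolding V_\<zeta> XG_iff d_def by blast+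
    ultimately have "int n dvd k0 - j * k" "int n dvd k0 - j * k'"
      using prime_dvd_mult_iff[OF pr'] by blast+
    hence "int n dvd (k0 - j * k') - (k0 - j * k)" by (rule dvd_diff[rotated])
    hence "int n dvd j * (k - k')" by (simp add: algebra_simps)
    hence "int n dvd k - k'" using prime_dvd_mult_iff[OF pr'] j_dvd by blast
    thus ?thesis by (simp add: cong_iff_dvd_diff)
  qed
  ultimately show ?thesis unfolding n_def by blast
qed

end
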